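(* Let $k\ge 1$ be an integer, let $T$ be an oriented tree with $k$ arcs, and let $D$ be a digraph with $\delta^0(D)\ge k/2$ that contains no oriented $4$-cycle as a subgraph. If $\Delta^\pm(D)>\Delta^{tot}(T)$, then $D$ contains $T$ as a subgraph.
   Context: Digraphs are finite, without loops or parallel arcs (directed $2$-cycles, i.e. arcs $xy$ and $yx$, are allowed); an oriented graph/tree is a digraph whose underlying graph is simple (no $2$-cycles). For a vertex $a$, $\deg^+(a)$ and $\deg^-(a)$ are its out- and indegree. The minimum semidegree $\delta^0(D)$ is the minimum over all vertices of $D$ of both their indegrees and their outdegrees. $\Delta^{tot}(T)$ is the maximum degree of the underlying (undirected) graph of $T$. $\Delta^\pm(D)$ is the largest integer $m$ such that $D$ has a vertex of outdegree at least $m$ and a vertex of indegree at least $m$ (possibly the same vertex), i.e. $\Delta^\pm(D)=\min\{\max_a \deg^+(a),\max_a\deg^-(a)\}$. An oriented $4$-cycle is any orientation of a cycle on $4$ distinct vertices; "$D$ contains no oriented $4$-cycle" means no such orientation is a subgraph of $D$. $D$ contains $T$ means there is an injective map $V(T)\to V(D)$ sending each arc $xy$ of $T$ to an arc of $D$ from the image of $x$ to the image of $y$. *)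

theory Defs
  imports Complex_Main "Graph_Theory.Graph_Theory"
begin

locale oriented_graph = digraph +
  assumes no_two_cycles: "asym (arcs_ends G)"

text \<open>
  The library predicates \<open>forest\<close> and \<open>tree\<close> only exclude directed cycles, so that a transitive
  triangle is a \<open>tree\<close>. An oriented tree has to be a tree in the undirected sense: a cycle of the
  underlying graph is a cycle of the symmetric digraph \<open>mk_symmetric G\<close> of length at least 3
  (length 2 arises from traversing a single edge back and forth).
\<close>

locale oriented_tree = oriented_graph +
  assumes underlying_connected: "Digraph_Component.connected G"
    and underlying_acyclic:
      "\<not> (\<exists>p. pre_digraph.cycle (with_proj (mk_symmetric G)) p \<and> 3 \<le> length p)"

definition min_semidegree :: "('a, 'b) pre_digraph \<Rightarrow> nat" where
  "min_semidegree G = Min (in_degree G ` verts G \<union> out_degree G ` verts G)"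

text \<open>
  The out-degree in \<open>mk_symmetric G\<close> is the number of neighbours in the underlying simple graph.
\<close>

definition max_total_degree :: "('a, 'b) pre_digraph \<Rightarrow> nat" where
  "max_total_degree G = Max (out_degree (with_proj (mk_symmetric G)) ` verts G)"

definition max_pm_degree :: "('a, 'b) pre_digraph \<Rightarrow> nat" where
  "max_pm_degree G =
    (GREATEST m. (\<exists>a\<in>verts G. m \<le> out_degree G a) \<and> (\<exists>b\<in>verts G. m \<le> in_degree G b))"

lemma max_pm_degree_eq_min:
  assumes "finite (verts G)" "verts G \<noteq> {}"
  shows "max_pm_degree G = min (Max (out_degree G ` verts G)) (Max (in_degree G ` verts G))"
proof -
  have *: "(\<exists>v\<in>verts G. m \<le> f v) \<longleftrightarrow> m \<le> Max (f ` verts G)" for m and f :: "'a \<Rightarrow> nat"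
    using assms by (subst Max_ge_iff) auto
  show ?thesis
    unfolding max_pm_degree_def * by (intro Greatest_equality) auto
qed

definition oriented_4_cycle :: "('a, 'b) pre_digraph \<Rightarrow> bool" where
  "oriented_4_cycle C \<longleftrightarrow> oriented_graph C \<and>
    (\<exists>a b c d. distinct [a, b, c, d] \<and> verts C = {a, b, c, d} \<and>
      parcs (mk_symmetric C) = {(a, b), (b, a), (b, c), (c, b), (c, d), (d, c), (d, a), (a, d)})"

definition contains_digraph :: "('a, 'b) pre_digraph \<Rightarrow> ('c, 'd) pre_digraph \<Rightarrow> bool" where
  "contains_digraph D T \<longleftrightarrow>
    (\<exists>f. inj_on f (verts T) \<and> f ` verts T \<subseteq> verts D \<and>
      (\<forall>x y. x \<rightarrow>\<^bsub>T\<^esub> y \<longrightarrow> f x \<rightarrow>\<^bsub>D\<^esub> f y))"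

end

theory Submission
  imports Defs
begin

text \<open>
  Two distinct vertices of \<open>D\<close> have at most one common neighbour. First the non-leaves of \<open>T\<close> are
  embedded greedily by increasing distance from a root. If the image \<open>v\<close> of \<open>t\<close> has many neighbours
  among the images of a vertex set \<open>W\<close>, then no vertex of \<open>T\<close> other than \<open>t\<close> has two neighbours in
  \<open>W\<close>; hence the neighbourhoods of the vertices in \<open>W\<close> are disjoint and \<open>2 |W|\<close> is essentially at
  most the number of vertices of \<open>T\<close>, so that semidegree \<open>k/2\<close> suffices to continue. Then all leaves
  are placed simultaneously by Hall's theorem. A set of leaves violating Hall's condition can only
  involve few vertices \<open>v\<close>, because their neighbourhoods of size at least \<open>k/2\<close> hardly overlap.

  The vertex with the most leaves is mapped to a vertex of large out- or indegree. This is needed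
  only if some vertex has at least two leaves, or if \<open>T\<close> is a path with at most four arcs.
\<close>

section \<open>Digraphs without 4-cycles\<close>

text \<open>The counting leaves almost no slack: a vertex of the digraph is only guaranteed k/2
  candidates of each sign, and charging two tree vertices to each element of \<open>W\<close> gives
  a bound of just this order. The obstacle is an element of \<open>W\<close> that pays for one
  vertex only (\<open>bad\<close>). Once all non-leaves are placed, a bad vertex other than the root
  comes from an edge between the images of a vertex and its grandparent. Therefore such edges are
  avoided while possible; where one is unavoidable, a signed neighbourhood of the middle image is
  exhausted. Two neighbourhoods share at most one vertex, so two exhausted ones need about k - 1
  images of non-leaves, while a tree with L leaves has only k + 1 - L non-leaves. This is a
  contradiction for L >= 3; trees with L = 2 are paths, and these need an argument of their own. A
  root with several leaves adds a second obstacle: non-leaves may use up the neighbours of its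
  image. Those neighbours are reserved, which costs every other image at most one candidate, and the
  leaves of the root pay for this loss in the count.\<close>

lemma hall_marriage:
  fixes A :: "'i \<Rightarrow> 'b set"
  assumes "finite I" and "\<And>i. i \<in> I \<Longrightarrow> finite (A i)"
    and "\<And>J. J \<subseteq> I \<Longrightarrow> card J \<le> card (\<Union>i\<in>J. A i)"
  shows "\<exists>h. inj_on h I \<and> (\<forall>i\<in>I. h i \<in> A i)"
  using assms
proof (induction "card I" arbitrary: I A rule: less_induct)
  case less
  note fin = less.prems(1) and finA = less.prems(2) and hall = less.prems(3)
  show ?case
  \<comment> \<open>Halmos-Vaughan induction. A proper tight subfamily is matched inside its own
    union and the rest outside it, which keeps Hall's condition for the rest. Without a tight
    subfamily every proper nonempty one has a spare candidate, so one value may be fixed and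
    deleted.\<close>
  proof (cases "\<exists>J. J \<subset> I \<and> J \<noteq> {} \<and> card (\<Union>i\<in>J. A i) \<le> card J")
    case True
    then obtain J where J: "J \<subset> I" "J \<noteq> {}" "card (\<Union>i\<in>J. A i) \<le> card J" by blast
    have finJ: "finite J" using J fin by (meson finite_subset psubset_imp_subset)
    let ?N = "\<Union>i\<in>J. A i"
    have finN: "finite ?N" using finJ finA J by blast
    have "card J < card I" using J fin by (simp add: psubset_card_mono)
    then have "\<exists>h. inj_on h J \<and> (\<forall>i\<in>J. h i \<in> A i)"
    proof (rule less.hyps)
      show "finite J" by (fact finJ)
      show "finite (A i)" if "i \<in> J" for i using that finA J by blast
      show "card K \<le> card (\<Union>i\<in>K. A i)" if "K \<subseteq> J" for K using that hall J by blast
    qed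
    then obtain h where h: "inj_on h J" "\<forall>i\<in>J. h i \<in> A i" by blast
    have "card (I - J) < card I"
      using J fin finJ by (intro psubset_card_mono) auto
    then have "\<exists>g. inj_on g (I - J) \<and> (\<forall>i\<in>I - J. g i \<in> A i - ?N)"
    proof (rule less.hyps)
      show "finite (I - J)" using fin by simp
      show "finite (A i - ?N)" if "i \<in> I - J" for i using that finA by blast
      show "card K \<le> card (\<Union>i\<in>K. A i - ?N)" if K: "K \<subseteq> I - J" for K
      proof -
        have finK: "finite K" using K fin finite_subset by blast
        have "card K + card J = card (K \<union> J)"
          using K finK finJ by (subst card_Un_disjoint) auto
        also have "\<dots> \<le> card (\<Union>i\<in>K \<union> J. A i)" using hall K J by blast
        also have "(\<Union>i\<in>K \<union> J. A i) = (\<Union>i\<in>K. A i - ?N) \<union> ?N" by blast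
        also have "card \<dots> \<le> card (\<Union>i\<in>K. A i - ?N) + card ?N" by (rule card_Un_le)
        finally show ?thesis using J by linarith
      qed
    qed
    then obtain g where g: "inj_on g (I - J)" "\<forall>i\<in>I - J. g i \<in> A i - ?N" by blast
    let ?h = "\<lambda>i. if i \<in> J then h i else g i"
    have "inj_on ?h I"
    proof (rule inj_onI)
      fix x y assume xy: "x \<in> I" "y \<in> I" "?h x = ?h y"
      show "x = y"
      proof (cases "x \<in> J"; cases "y \<in> J")
        assume "x \<in> J" "y \<in> J" then show ?thesis using xy h by (auto dest: inj_onD)
      next
        assume "x \<in> J" "y \<notin> J" then show ?thesis using xy h g by auto
      next
        assume "x \<notin> J" "y \<in> J" then show ?thesis using xy h g by (metis DiffI DiffD2 UN_I)
      next
        assume "x \<notin> J" "y \<notin> J" then show ?thesis using xy g by (auto dest: inj_onD)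
      qed
    qed
    moreover have "\<forall>i\<in>I. ?h i \<in> A i" using h g by auto
    ultimately show ?thesis by blast
  next
    case False
    show ?thesis
    proof (cases "I = {}")
      case True then show ?thesis by simp
    next
      case nonempty: False
      then obtain i where i: "i \<in> I" by blast
      have "card {i} \<le> card (\<Union>j\<in>{i}. A j)" using hall i by blast
      then have "A i \<noteq> {}" by auto
      then obtain x where x: "x \<in> A i" by blast
      have "card (I - {i}) < card I" using i fin by (meson card_Diff1_less)
      then have "\<exists>g. inj_on g (I - {i}) \<and> (\<forall>j\<in>I - {i}. g j \<in> A j - {x})"
      proof (rule less.hyps)
        show "finite (I - {i})" using fin by simp
        show "finite (A j - {x})" if "j \<in> I - {i}" for j using that finA by blast
        show "card K \<le> card (\<Union>j\<in>K. A j - {x})" if K: "K \<subseteq> I - {i}" for K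
        proof (cases "K = {}")
          case True then show ?thesis by simp
        next
          case Kne: False
          have "K \<subset> I" using K i by blast
          then have "card K < card (\<Union>j\<in>K. A j)" using False Kne by (meson not_le)
          moreover have "(\<Union>j\<in>K. A j - {x}) = (\<Union>j\<in>K. A j) - {x}" by blast
          moreover have "finite (\<Union>j\<in>K. A j)"
            using finA fin K by (meson Diff_subset finite_UN_I finite_subset subset_iff)
          ultimately show ?thesis by (auto simp: card_Diff_singleton_if)
        qed
      qed
      then obtain g where g: "inj_on g (I - {i})" "\<forall>j\<in>I - {i}. g j \<in> A j - {x}" by blast
      let ?h = "g(i := x)"
      have "inj_on ?h I" using g by (auto simp: inj_on_def)
      moreover have "\<forall>j\<in>I. ?h j \<in> A j" using g x by auto
      ultimately show ?thesis by blast
    qed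
  qed
qed

section \<open>Adjacency and signed neighbourhoods\<close>

definition adj :: "('v \<Rightarrow> 'v \<Rightarrow> bool) \<Rightarrow> 'v \<Rightarrow> 'v \<Rightarrow> bool" where
  "adj R x y \<longleftrightarrow> R x y \<or> R y x"

definition nbrs :: "('v \<Rightarrow> 'v \<Rightarrow> bool) \<Rightarrow> 'v \<Rightarrow> 'v set" where
  "nbrs R x = {y. adj R x y}"

text \<open>The sign selects out-neighbours (\<open>True\<close>) or in-neighbours
  (\<open>False\<close>), so that one argument serves both orientations. For a tree edge the sign in
  use is \<open>B (p x) x\<close>: the image of \<open>x\<close> has to lie in that neighbourhood of
  the image of its parent.\<close>

definition signed_nbrs :: "('v \<Rightarrow> 'v \<Rightarrow> bool) \<Rightarrow> bool \<Rightarrow> 'v \<Rightarrow> 'v set" where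
  "signed_nbrs R s x = {y. if s then R x y else R y x}"

lemma adj_sym: "adj R x y \<Longrightarrow> adj R y x"
  by (auto simp: adj_def)

lemma adj_commute: "adj R x y \<longleftrightarrow> adj R y x"
  by (auto simp: adj_def)

lemma in_nbrs [simp]: "y \<in> nbrs R x \<longleftrightarrow> adj R x y"
  by (simp add: nbrs_def)

lemma nb_adj: "y \<in> signed_nbrs R s x \<Longrightarrow> adj R x y"
  by (auto simp: signed_nbrs_def adj_def split: if_splits)

lemma nb_flip: "y \<in> signed_nbrs R s x \<longleftrightarrow> x \<in> signed_nbrs R (\<not> s) y"
  by (auto simp: signed_nbrs_def)

text \<open>Adjacency ignores directions, so 2-cycles need no separate treatment: \<open>x\<close>,
  \<open>a\<close>, \<open>y\<close>, \<open>b\<close> with \<open>a\<close> and \<open>b\<close>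
  distinct would span a 4-cycle of edges, and one arc per edge gives an oriented one.\<close>

locale c4_free_digraph =
  fixes X :: "'a set" and A :: "'a \<Rightarrow> 'a \<Rightarrow> bool"
  assumes finite_X: "finite X"
    and arc_in: "A x y \<Longrightarrow> x \<in> X \<and> y \<in> X"
    and arc_irrefl: "\<not> A x x"
    and common_nbr: "x \<noteq> y \<Longrightarrow> adj A x a \<Longrightarrow> adj A y a \<Longrightarrow> adj A x b \<Longrightarrow> adj A y b \<Longrightarrow> a = b"
begin

lemma adj_irrefl [simp]: "\<not> adj A x x"
  by (simp add: adj_def arc_irrefl)

lemma adj_in: "adj A x y \<Longrightarrow> x \<in> X \<and> y \<in> X"
  using arc_in by (auto simp: adj_def)

lemma nb_sub: "signed_nbrs A s x \<subseteq> X"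
  using adj_in nb_adj by fast

lemma nbrs_sub: "nbrs A x \<subseteq> X"
  using adj_in by auto

lemma finite_nb [simp]: "finite (signed_nbrs A s x)"
  using nb_sub finite_X finite_subset by blast

lemma finite_nbrs [simp]: "finite (nbrs A x)"
  using nbrs_sub finite_X finite_subset by blast

lemma card_common: "x \<noteq> y \<Longrightarrow> C \<subseteq> nbrs A x \<Longrightarrow> D \<subseteq> nbrs A y \<Longrightarrow> card (C \<inter> D) \<le> 1"
proof -
  assume *: "x \<noteq> y" "C \<subseteq> nbrs A x" "D \<subseteq> nbrs A y"
  then have "finite (C \<inter> D)" by (meson finite_Int finite_nbrs finite_subset)
  moreover have "a = b" if "a \<in> C \<inter> D" "b \<in> C \<inter> D" for a b
    using that * by (intro common_nbr[of x y a b]) auto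
  ultimately show ?thesis by (simp add: card_le_Suc0_iff_eq)
qed

lemma nb_sub_nbrs: "signed_nbrs A s x \<subseteq> nbrs A x"
  by (auto dest: nb_adj)

lemma card_Un_common:
  assumes "x \<noteq> y" "C \<subseteq> nbrs A x" "D \<subseteq> nbrs A y"
  shows "card C + card D \<le> card (C \<union> D) + 1"
proof -
  have "finite C" "finite D" using assms by (meson finite_nbrs finite_subset)+
  then show ?thesis using card_Un_Int[of C D] card_common[OF assms] by linarith
qed

lemma card_Un_nb:
  "x \<noteq> y \<Longrightarrow> card (signed_nbrs A s x) + card (signed_nbrs A s' y) \<le> card (signed_nbrs A s x \<union> signed_nbrs A s' y) + 1"
  by (rule card_Un_common) (auto dest: nb_adj)

end

section \<open>Packing neighbourhoods in a rooted tree\<close>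

text \<open>The parent map \<open>p\<close> and the depth \<open>d\<close> replace paths in the
  tree. Only differences of depths are fixed; the depth of the root is arbitrary, which is why
  \<open>d r\<close> is subtracted when vertices are numbered by depth.\<close>

locale rooted_tree =
  fixes V :: "'c set" and B :: "'c \<Rightarrow> 'c \<Rightarrow> bool" and r :: 'c
    and p :: "'c \<Rightarrow> 'c" and d :: "'c \<Rightarrow> nat"
  assumes finite_V: "finite V"
    and root_in: "r \<in> V"
    and parent_in: "x \<in> V \<Longrightarrow> x \<noteq> r \<Longrightarrow> p x \<in> V"
    and depth: "x \<in> V \<Longrightarrow> x \<noteq> r \<Longrightarrow> d x = Suc (d (p x))"
    and edge_cases: "B x y \<Longrightarrow> x \<in> V \<and> y \<in> V \<and> ((y \<noteq> r \<and> p y = x) \<or> (x \<noteq> r \<and> p x = y))"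
    and parent_edge: "x \<in> V \<Longrightarrow> x \<noteq> r \<Longrightarrow> B x (p x) \<or> B (p x) x"
    and B_asym: "B x y \<Longrightarrow> \<not> B y x"
begin

lemma adj_iff:
  "adj B x y \<longleftrightarrow> x \<in> V \<and> y \<in> V \<and> ((y \<noteq> r \<and> p y = x) \<or> (x \<noteq> r \<and> p x = y))"
  unfolding adj_def using edge_cases parent_edge by blast

lemma adj_in_V: "adj B x y \<Longrightarrow> x \<in> V \<and> y \<in> V"
  by (simp add: adj_iff)

lemma adj_parent: "x \<in> V \<Longrightarrow> x \<noteq> r \<Longrightarrow> adj B x (p x)"
  using parent_in by (auto simp: adj_iff)

lemma parent_neq: "x \<in> V \<Longrightarrow> x \<noteq> r \<Longrightarrow> p x \<noteq> x"
  using depth by fastforce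

lemma adj_neq: "adj B x y \<Longrightarrow> x \<noteq> y"
  using parent_neq by (auto simp: adj_iff)

lemma grandparent_neq: "x \<in> V \<Longrightarrow> x \<noteq> r \<Longrightarrow> p x \<noteq> r \<Longrightarrow> p (p x) \<noteq> x"
  using depth[of x] depth[of "p x"] parent_in[of x] by auto

lemma nbrs_in_V: "nbrs B x \<subseteq> V"
  using adj_in_V by auto

lemma finite_tnbrs [simp]: "finite (nbrs B x)"
  using nbrs_in_V finite_V finite_subset by blast

lemma root_depth_le: "x \<in> V \<Longrightarrow> d r \<le> d x"
proof (induction "d x" arbitrary: x rule: less_induct)
  case less
  show ?case
  proof (cases "x = r")
    case False
    then show ?thesis using less.hyps[of "p x"] depth[of x] parent_in[of x] less.prems by simp
  qed simp
qed

lemma root_depth_less: "x \<in> V \<Longrightarrow> x \<noteq> r \<Longrightarrow> d r < d x"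
  using root_depth_le[of "p x"] depth[of x] parent_in[of x] by simp

lemma depth_eq_root: "x \<in> V \<Longrightarrow> d x = d r \<Longrightarrow> x = r"
  using root_depth_less by force

definition children :: "'c \<Rightarrow> 'c set" where
  "children x = {y \<in> V. y \<noteq> r \<and> p y = x}"

lemma finite_chl [simp]: "finite (children x)"
  using finite_V by (simp add: children_def)

lemma nbrs_eq: "x \<in> V \<Longrightarrow> nbrs B x = children x \<union> (if x = r then {} else {p x})"
  using parent_in by (auto simp: children_def nbrs_def adj_iff)

lemma parent_notin_chl: "x \<in> V \<Longrightarrow> x \<noteq> r \<Longrightarrow> p x \<notin> children x"
  unfolding children_def using grandparent_neq by auto

lemma degree_eq: "x \<in> V \<Longrightarrow> card (nbrs B x) = card (children x) + (if x = r then 0 else 1)"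
  using parent_notin_chl by (auto simp: nbrs_eq)

lemma sum_card_chl: "(\<Sum>x\<in>V. card (children x)) + 1 = card V"
proof -
  have "V - {r} = (\<Union>x\<in>V. children x)" using parent_in by (auto simp: children_def)
  moreover have "card (\<Union>x\<in>V. children x) = (\<Sum>x\<in>V. card (children x))"
    using finite_V by (intro card_UN_disjoint) (auto simp: children_def)
  ultimately show ?thesis using card_Suc_Diff1[OF finite_V root_in] by simp
qed

lemma sum_degree: "(\<Sum>x\<in>V. card (nbrs B x)) + 2 = 2 * card V"
proof -
  have "(\<Sum>x\<in>V. card (nbrs B x)) = (\<Sum>x\<in>V. card (children x)) + (\<Sum>x\<in>V. if x = r then 0 else 1)"
    by (subst sum.distrib[symmetric]) (rule sum.cong, auto simp: degree_eq)
  moreover have "(\<Sum>x\<in>V. if x = r then 0 else (1::nat)) = card (V - {r})"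
    using finite_V by (simp add: sum.If_cases Int_def set_diff_eq)
  moreover have "card (V - {r}) + 1 = card V"
    using card_Suc_Diff1[OF finite_V root_in] by simp
  ultimately show ?thesis using sum_card_chl by linarith
qed

definition leaves :: "'c set" where
  "leaves = {x \<in> V. card (nbrs B x) = 1}"

definition core :: "'c set" where
  "core = V - leaves"

definition leaves_at :: "'c \<Rightarrow> 'c set" where
  "leaves_at x = children x \<inter> leaves"

lemma leaves_sub: "leaves \<subseteq> V" and core_sub: "core \<subseteq> V"
  by (auto simp: leaves_def core_def)

lemma finite_leaves [simp]: "finite leaves" and finite_core [simp]: "finite core"
  using leaves_sub core_sub finite_V finite_subset by blast+

lemma finite_leaves_at [simp]: "finite (leaves_at x)"
  by (simp add: leaves_at_def)

lemma card_core: "card core + card leaves = card V"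
  unfolding core_def using leaves_sub finite_V by (simp add: card_Diff_subset card_mono)

text \<open>
  \<open>block t W w\<close> is the share of the tree paid for by \<open>w\<close>: if no vertex other than \<open>t\<close> has two
  neighbours in \<open>W\<close>, then these shares are pairwise disjoint.
\<close>

definition block :: "'c \<Rightarrow> 'c set \<Rightarrow> 'c \<Rightarrow> 'c set" where
  "block t W w = (nbrs B w - {t}) \<union> (if \<exists>w'\<in>W. adj B w w' then {} else {w})"

text \<open>These are the elements of \<open>W\<close> whose share can drop to a single vertex: one
  of the two neighbours is \<open>t\<close>, which is removed from every neighbourhood, and the
  vertex itself is left to its neighbour in \<open>W\<close>.\<close>

definition bad :: "'c \<Rightarrow> 'c set \<Rightarrow> 'c set" where
  "bad t W = {w \<in> W. adj B t w \<and> card (nbrs B w) = 2 \<and> (\<exists>w'\<in>W. adj B w w')}"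

lemma sum_card_block_le:
  assumes "finite C" "finite W" "t \<notin> W"
    and sub: "\<And>w. w \<in> W \<Longrightarrow> block t W w \<subseteq> C"
    and one: "\<And>x w w'. x \<noteq> t \<Longrightarrow> w \<in> W \<Longrightarrow> w' \<in> W \<Longrightarrow> adj B x w \<Longrightarrow> adj B x w' \<Longrightarrow> w = w'"
  shows "(\<Sum>w\<in>W. card (block t W w)) \<le> card C"
proof -
  \<comment> \<open>A vertex in two blocks would have two neighbours in \<open>W\<close>, or would
    be an element of \<open>W\<close> adjacent to another one, and then it is not in its own
    block.\<close>
  have "block t W w \<inter> block t W w' = {}" if "w \<in> W" "w' \<in> W" "w \<noteq> w'" for w w'
  proof (rule ccontr)
    assume "block t W w \<inter> block t W w' \<noteq> {}"
    then obtain x where "x \<in> block t W w" "x \<in> block t W w'" by blast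
    then show False
      using that one[of x w w'] adj_commute[of B] unfolding block_def
      by (auto split: if_splits)
  qed
  then have "(\<Sum>w\<in>W. card (block t W w)) = card (\<Union>w\<in>W. block t W w)"
    using assms finite_subset[OF sub] by (intro card_UN_disjoint[symmetric]) auto
  also have "\<dots> \<le> card C" using assms by (intro card_mono) auto
  finally show ?thesis .
qed

lemma card_block_ge:
  assumes "w \<in> W" "t \<notin> W" "2 \<le> card (nbrs B w)"
  shows "2 \<le> card (block t W w) + (if w \<in> bad t W then 1 else 0)"
proof (cases "\<exists>w'\<in>W. adj B w w'")
  case True
  then have "block t W w = nbrs B w - {t}" by (simp add: block_def)
  then have le: "card (nbrs B w) \<le> card (block t W w) + (if adj B t w then 1 else 0)"
    by (cases "adj B t w") (simp_all add: card_Diff_singleton_if adj_commute[of B w t])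
  show ?thesis
  proof (cases "adj B t w \<and> card (nbrs B w) = 2")
    case True2: True
    then have "w \<in> bad t W" using assms(1) True by (simp add: bad_def)
    then show ?thesis using le True2 by simp
  next
    case False
    then show ?thesis using le assms(3) by (auto split: if_splits)
  qed
next
  case False
  then have "block t W w = insert w (nbrs B w - {t})" by (auto simp: block_def)
  moreover have "w \<notin> nbrs B w - {t}" using adj_neq[of w w] by auto
  ultimately have "card (block t W w) = Suc (card (nbrs B w - {t}))" by simp
  moreover have "card (nbrs B w) \<le> Suc (card (nbrs B w - {t}))"
    by (cases "t \<in> nbrs B w") (simp_all add: card_Diff_singleton_if)
  ultimately show ?thesis using assms(3) by linarith
qed

text \<open>Every share has at least two vertices, except that a bad vertex may be short by one. The
  second inequality replaces the bound 2 for one chosen \<open>q\<close> by the true size of its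
  share.\<close>

lemma packing:
  assumes "finite C" "finite W" "t \<notin> W"
    and "\<And>w. w \<in> W \<Longrightarrow> block t W w \<subseteq> C"
    and "\<And>x w w'. x \<noteq> t \<Longrightarrow> w \<in> W \<Longrightarrow> w' \<in> W \<Longrightarrow> adj B x w \<Longrightarrow> adj B x w' \<Longrightarrow> w = w'"
    and deg: "\<And>w. w \<in> W \<Longrightarrow> 2 \<le> card (nbrs B w)"
  shows "2 * card W \<le> card C + card (bad t W)"
    and "q \<in> W \<Longrightarrow> q \<notin> bad t W \<Longrightarrow> 2 * card W + card (block t W q) \<le> card C + card (bad t W) + 2"
proof -
  let ?b = "\<lambda>w. if w \<in> bad t W then 1 else (0::nat)"
  have le: "(\<Sum>w\<in>W. card (block t W w)) \<le> card C" by (rule sum_card_block_le) fact+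
  have badW: "bad t W \<subseteq> W" by (auto simp: bad_def)
  have sb: "(\<Sum>w\<in>W. ?b w) = card (bad t W)"
    using assms(2) badW by (simp add: sum.If_cases Int_absorb1)
  have each: "2 \<le> card (block t W w) + ?b w" if "w \<in> W" for w
    using card_block_ge[OF that assms(3) deg[OF that]] .
  have "2 * card W = (\<Sum>w\<in>W. 2)" by simp
  also have "\<dots> \<le> (\<Sum>w\<in>W. card (block t W w) + ?b w)" by (intro sum_mono each)
  also have "\<dots> \<le> card C + card (bad t W)" using le sb by (simp add: sum.distrib)
  finally show "2 * card W \<le> card C + card (bad t W)" .
  assume q: "q \<in> W" "q \<notin> bad t W"
  have "(\<Sum>w\<in>W - {q}. 2) \<le> (\<Sum>w\<in>W - {q}. card (block t W w) + ?b w)"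
    by (intro sum_mono each) auto
  moreover have "(\<Sum>w\<in>W. card (block t W w) + ?b w)
      = (card (block t W q) + ?b q) + (\<Sum>w\<in>W - {q}. card (block t W w) + ?b w)"
    using assms(2) q(1) by (rule sum.remove)
  moreover have "(\<Sum>w\<in>W. card (block t W w) + ?b w) \<le> card C + card (bad t W)"
    using le sb by (simp add: sum.distrib)
  moreover have "(\<Sum>w\<in>W - {q}. 2) + 2 = 2 * card W"
    using card.remove[OF assms(2) q(1)] by simp
  ultimately show "2 * card W + card (block t W q) \<le> card C + card (bad t W) + 2"
    using q(2) by simp
qed

end

section \<open>Leaves and non-leaves when the root is not a leaf\<close>

locale rooted_tree_core = rooted_tree +
  assumes root_degree: "2 \<le> card (nbrs B r)"
begin

lemma root_core: "r \<in> core"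
  using root_in root_degree by (simp add: core_def leaves_def)

lemma leaf_neq_root: "x \<in> leaves \<Longrightarrow> x \<noteq> r"
  using root_core by (auto simp: core_def)

lemma nbrs_nonempty: "x \<in> V \<Longrightarrow> nbrs B x \<noteq> {}"
  using root_degree adj_parent[of x] by (cases "x = r") auto

lemma core_degree: "x \<in> core \<Longrightarrow> 2 \<le> card (nbrs B x)"
proof -
  assume "x \<in> core"
  then have "card (nbrs B x) \<noteq> 0" "card (nbrs B x) \<noteq> 1"
    using nbrs_nonempty by (auto simp: core_def leaves_def)
  then show ?thesis by linarith
qed

lemma leaf_nbrs: "x \<in> leaves \<Longrightarrow> nbrs B x = {p x}"
proof -
  assume x: "x \<in> leaves"
  then have "p x \<in> nbrs B x" using adj_parent leaf_neq_root leaves_sub by auto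
  moreover have "card (nbrs B x) = 1" using x by (simp add: leaves_def)
  ultimately show ?thesis by (metis card_1_singletonE singletonD)
qed

lemma leaf_chl: "x \<in> leaves \<Longrightarrow> children x = {}"
  using leaf_nbrs[of x] nbrs_eq[of x] leaves_sub leaf_neq_root[of x] parent_notin_chl[of x] by auto

lemma parent_core: "x \<in> V \<Longrightarrow> x \<noteq> r \<Longrightarrow> p x \<in> core"
  using leaf_chl[of "p x"] parent_in[of x] by (auto simp: core_def children_def)

lemma core_child: "x \<in> core \<Longrightarrow> children x \<noteq> {}"
  using core_degree[of x] degree_eq[of x] core_sub by (cases "x = r") auto

lemma leaves_at_iff: "x \<in> leaves_at t \<longleftrightarrow> x \<in> leaves \<and> p x = t"
  using leaf_neq_root leaves_sub by (auto simp: leaves_at_def children_def)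

lemma adj_leaf: "x \<in> leaves \<Longrightarrow> adj B x y \<longleftrightarrow> y = p x"
  using leaf_nbrs by (metis in_nbrs singleton_iff)

end

section \<open>Greedy embedding of the non-leaves\<close>

locale tree_embedding = c4_free_digraph X A + rooted_tree_core V B r p d
  for X :: "'a set" and A and V :: "'c set" and B r p d +
  fixes k :: nat
  assumes card_V: "card V = Suc k"
    and semidegree: "v \<in> X \<Longrightarrow> k \<le> 2 * card (signed_nbrs A s v)"
begin

text \<open>The domain consists of full levels of non-leaves and part of the next level. Hence the
  children of the siblings of a vertex still to be placed are not placed either.\<close>

definition partial_embedding :: "'c set \<Rightarrow> ('c \<Rightarrow> 'a) \<Rightarrow> bool" where
  "partial_embedding U f \<longleftrightarrow> U \<subseteq> core \<and> r \<in> U \<and> (\<forall>x\<in>U. \<forall>y\<in>core. d y < d x \<longrightarrow> y \<in> U) \<and>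
     inj_on f U \<and> f ` U \<subseteq> X \<and> (\<forall>x\<in>U - {r}. f x \<in> signed_nbrs A (B (p x) x) (f (p x)))"

definition preimage :: "'c set \<Rightarrow> ('c \<Rightarrow> 'a) \<Rightarrow> 'a set \<Rightarrow> 'c set" where
  "preimage U f N = {w \<in> U. f w \<in> N}"

lemma core_in_V: "x \<in> core \<Longrightarrow> x \<in> V"
  using core_sub by blast

lemma partial_sub: "partial_embedding U f \<Longrightarrow> U \<subseteq> core"
  by (simp add: partial_embedding_def)

lemma partial_finite: "partial_embedding U f \<Longrightarrow> finite U"
  using partial_sub finite_core finite_subset by blast

lemma partial_inj: "partial_embedding U f \<Longrightarrow> inj_on f U"
  by (simp add: partial_embedding_def)

lemma partial_in: "partial_embedding U f \<Longrightarrow> x \<in> U \<Longrightarrow> f x \<in> X"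
  by (auto simp: partial_embedding_def)

lemma partial_parent: "partial_embedding U f \<Longrightarrow> x \<in> U \<Longrightarrow> x \<noteq> r \<Longrightarrow> p x \<in> U"
  unfolding partial_embedding_def using parent_core[of x] depth[of x] core_in_V[of x]
  by (metis lessI subsetD)

lemma partial_adj:
  assumes "partial_embedding U f" "x \<in> U" "y \<in> U" "adj B x y"
  shows "adj A (f x) (f y)"
proof -
  have *: "adj A (f (p z)) (f z)" if "z \<in> U" "z \<noteq> r" for z
    using assms(1) that unfolding partial_embedding_def by (meson Diff_iff nb_adj singletonD)
  show ?thesis using assms *[of x] *[of y] adj_sym unfolding adj_iff by metis
qed

lemma finite_preimage [simp]: "partial_embedding U f \<Longrightarrow> finite (preimage U f N)"
  using partial_finite by (simp add: preimage_def)

lemma card_preimage: "partial_embedding U f \<Longrightarrow> card (preimage U f N) = card (N \<inter> f ` U)"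
proof -
  assume "partial_embedding U f"
  then have "inj_on f (preimage U f N)"
    using partial_inj by (auto simp: preimage_def intro: inj_on_subset)
  then have "card (preimage U f N) = card (f ` preimage U f N)" by (simp add: card_image)
  also have "f ` preimage U f N = N \<inter> f ` U" by (auto simp: preimage_def)
  finally show ?thesis .
qed

lemma centre_notin_preimage: "t \<notin> preimage U f (signed_nbrs A s (f t))"
  by (auto simp: preimage_def dest: nb_adj)

text \<open>If \<open>x\<close> is already placed, two neighbours in the preimage would give two
  common neighbours of the images of \<open>x\<close> and \<open>t\<close>. Otherwise the only
  placed neighbour of \<open>x\<close> can be its parent, since placed vertices have placed
  parents.\<close>

lemma preimage_one:
  assumes pe: "partial_embedding U f" and t: "t \<in> U" and x: "x \<noteq> t"
    and w: "w \<in> preimage U f (signed_nbrs A s (f t))" "w' \<in> preimage U f (signed_nbrs A s (f t))"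
    and a: "adj B x w" "adj B x w'"
  shows "w = w'"
proof (cases "x \<in> U")
  case True
  have "f x \<noteq> f t" using True t x partial_inj[OF pe] by (meson inj_onD)
  moreover have "adj A (f x) (f w)" "adj A (f x) (f w')"
    using partial_adj[OF pe True] w a by (auto simp: preimage_def)
  moreover have "adj A (f t) (f w)" "adj A (f t) (f w')"
    using w by (auto simp: preimage_def dest: nb_adj)
  ultimately have "f w = f w'" by (meson common_nbr)
  then show ?thesis using w partial_inj[OF pe] by (auto simp: preimage_def dest: inj_onD)
next
  case False
  have "u = p x" if "u \<in> U" "adj B x u" for u
    using that False partial_parent[OF pe, of u] by (auto simp: adj_iff)
  then show ?thesis using w a by (auto simp: preimage_def)
qed

lemma packing_partial:
  assumes pe: "partial_embedding U f" and t: "t \<in> U" and C: "finite C"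
    and sub: "\<And>w. w \<in> preimage U f (signed_nbrs A s (f t)) \<Longrightarrow> block t (preimage U f (signed_nbrs A s (f t))) w \<subseteq> C"
  defines "W \<equiv> preimage U f (signed_nbrs A s (f t))"
  shows "2 * card W \<le> card C + card (bad t W)"
    and "q \<in> W \<Longrightarrow> q \<notin> bad t W \<Longrightarrow> 2 * card W + card (block t W q) \<le> card C + card (bad t W) + 2"
proof -
  have deg: "2 \<le> card (nbrs B w)" if "w \<in> W" for w
    using that core_degree partial_sub[OF pe] by (auto simp: W_def preimage_def)
  have "finite W" "t \<notin> W" using pe centre_notin_preimage by (auto simp: W_def)
  moreover have "w = w'" if "x \<noteq> t" "w \<in> W" "w' \<in> W" "adj B x w" "adj B x w'" for x w w'
    using preimage_one[OF pe t] that unfolding W_def by blast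
  ultimately show "2 * card W \<le> card C + card (bad t W)"
    "q \<in> W \<Longrightarrow> q \<notin> bad t W \<Longrightarrow> 2 * card W + card (block t W q) \<le> card C + card (bad t W) + 2"
    using packing[OF C \<open>finite W\<close> \<open>t \<notin> W\<close> sub[folded W_def] _ deg] by blast+
qed

section \<open>The next vertex in breadth-first order\<close>

definition next_vertex :: "'c set \<Rightarrow> 'c \<Rightarrow> bool" where
  "next_vertex U y \<longleftrightarrow> y \<in> core - U \<and> (\<forall>z\<in>core - U. d y \<le> d z)"

lemma nextv_parent: "partial_embedding U f \<Longrightarrow> next_vertex U y \<Longrightarrow> y \<noteq> r \<and> p y \<in> U"
proof -
  assume a: "partial_embedding U f" "next_vertex U y"
  then have "y \<noteq> r" by (auto simp: next_vertex_def partial_embedding_def)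
  moreover have "y \<in> V" using a core_sub by (auto simp: next_vertex_def)
  ultimately have "p y \<in> core" "d (p y) < d y" using parent_core depth by auto
  then show ?thesis using a \<open>y \<noteq> r\<close> unfolding next_vertex_def by force
qed

lemma nextv_nephew:
  assumes "partial_embedding U f" "next_vertex U y" "w \<in> V" "w \<noteq> r" "p w = p y" "z \<in> children w"
  shows "z \<notin> U"
proof
  assume "z \<in> U"
  have y: "y \<in> V" "y \<noteq> r" using assms nextv_parent core_sub by (auto simp: next_vertex_def)
  have "d z = Suc (d w)" using assms(6) depth by (auto simp: children_def)
  also have "d w = d y" using depth[of w] depth[of y] assms y by simp
  finally show False using \<open>z \<in> U\<close> assms(1,2) unfolding partial_embedding_def next_vertex_def by auto
qed

text \<open>A bad child of \<open>p y\<close> would need a neighbour in the preimage other than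
  \<open>p y\<close>, hence one of its own children, but these lie one level below \<open>y\<close>
  and are not placed. Only the grandparent of \<open>y\<close> remains.\<close>

lemma nextv_bad:
  assumes "partial_embedding U f" "next_vertex U y"
  shows "bad (p y) (preimage U f (signed_nbrs A s (f (p y)))) \<subseteq> (if p y = r then {} else {p (p y)})"
proof
  fix w assume w: "w \<in> bad (p y) (preimage U f (signed_nbrs A s (f (p y))))"
  let ?t = "p y" and ?W = "preimage U f (signed_nbrs A s (f (p y)))"
  obtain w' where w': "w' \<in> ?W" "adj B w w'" and at: "adj B ?t w" using w by (auto simp: bad_def)
  have "w' \<noteq> ?t" "w' \<in> U" using w' centre_notin_preimage by (auto simp: preimage_def)
  show "w \<in> (if ?t = r then {} else {p ?t})"
  proof (cases "w \<noteq> r \<and> p w = ?t")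
    case True
    then have "w' \<in> children w" using w' \<open>w' \<noteq> ?t\<close> by (auto simp: adj_iff children_def)
    then show ?thesis using nextv_nephew[OF assms] True at adj_in_V \<open>w' \<in> U\<close> by blast
  next
    case False
    then show ?thesis using at by (auto simp: adj_iff)
  qed
qed

lemma nextv_block:
  assumes "partial_embedding U f" "next_vertex U y" "y' \<in> children y"
    and "w \<in> preimage U f (signed_nbrs A s (f (p y)))"
  shows "block (p y) (preimage U f (signed_nbrs A s (f (p y)))) w \<subseteq> V - {p y, y, y'}"
proof -
  have w: "w \<in> U" "w \<noteq> p y" using assms(4) centre_notin_preimage by (auto simp: preimage_def)
  have y: "y \<notin> U" "y \<in> V" using assms core_sub by (auto simp: next_vertex_def)
  have y': "y' \<notin> U" "y' \<in> V" "y' \<noteq> r" "p y' = y"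
    using partial_parent[OF assms(1), of y'] assms(3) y by (auto simp: children_def)
  have wV: "w \<in> V" using w assms(1) partial_sub core_sub by blast
  have "\<not> adj B w y" using w y partial_parent[OF assms(1) w(1)] by (auto simp: adj_iff)
  moreover have "\<not> adj B w y'" using w y' y partial_parent[OF assms(1) w(1)] by (auto simp: adj_iff)
  ultimately show ?thesis
    using w y y' wV nbrs_in_V unfolding block_def by (auto dest: adj_in_V)
qed

lemma card_removed_three:
  assumes "partial_embedding U f" "next_vertex U y" "y' \<in> children y"
  shows "card (V - {p y, y, y'}) + 2 = k"
proof -
  have y: "y \<in> V" "y \<noteq> r" "p y \<in> V"
    using assms nextv_parent[OF assms(1,2)] core_sub partial_sub by (auto simp: next_vertex_def)
  have y': "y' \<in> V" "y' \<noteq> r" "p y' = y" using assms(3) by (auto simp: children_def)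
  have "card {p y, y, y'} = 3"
    using y y' parent_neq[of y] parent_neq[of y'] grandparent_neq[of y'] by auto
  moreover have "card (V - {p y, y, y'}) = card V - card {p y, y, y'}"
    using y y' by (intro card_Diff_subset) auto
  moreover have "card {p y, y, y'} \<le> card V" using y y' finite_V by (intro card_mono) auto
  ultimately show ?thesis using card_V by simp
qed

lemma nextv_few:
  assumes "partial_embedding U f" "next_vertex U y"
  shows "2 * card (preimage U f (signed_nbrs A s (f (p y)))) + 1 \<le> k"
proof -
  obtain y' where y': "y' \<in> children y" using core_child assms by (auto simp: next_vertex_def)
  let ?W = "preimage U f (signed_nbrs A s (f (p y)))"
  have "2 * card ?W \<le> card (V - {p y, y, y'}) + card (bad (p y) ?W)"
    using assms nextv_parent nextv_block[OF assms y'] finite_V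
    by (intro packing_partial(1)) auto
  moreover have "card (bad (p y) ?W) \<le> 1"
    by (rule order_trans[OF card_mono[OF _ nextv_bad[OF assms]]]) auto
  ultimately show ?thesis using card_removed_three[OF assms y'] by linarith
qed

text \<open>\<open>F\<close> is a set of vertices of the digraph to be kept free, \<open>U0\<close>
  a part placed in advance. The last clause is the price for an edge between the images of a vertex
  and of its grandparent: a signed neighbourhood of the middle image is then exhausted.\<close>

definition careful_embedding :: "'a set \<Rightarrow> 'c set \<Rightarrow> 'c set \<Rightarrow> ('c \<Rightarrow> 'a) \<Rightarrow> bool" where
  "careful_embedding F U0 U f \<longleftrightarrow> partial_embedding U f \<and> U0 \<subseteq> U \<and> f ` U \<inter> F = {} \<and>
     (\<forall>y\<in>U - U0. y \<noteq> r \<longrightarrow> p y \<noteq> r \<longrightarrow> adj A (f y) (f (p (p y))) \<longrightarrow>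
        (\<exists>s. signed_nbrs A s (f (p y)) \<subseteq> f ` U \<union> F))"

lemma partial_extend:
  assumes pe: "partial_embedding U f" and y: "next_vertex U y"
    and z: "z \<in> signed_nbrs A (B (p y) y) (f (p y))" "z \<notin> f ` U"
  shows "partial_embedding (insert y U) (f(y := z))"
proof -
  have yU: "y \<notin> U" "y \<in> core" using y by (auto simp: next_vertex_def)
  have py: "y \<noteq> r" "p y \<in> U" using nextv_parent[OF pe y] by auto
  have 1: "v \<in> insert y U" if "u \<in> insert y U" "v \<in> core" "d v < d u" for u v
    using that pe y unfolding partial_embedding_def next_vertex_def by (metis Diff_iff insert_iff not_le)
  have 2: "inj_on (f(y := z)) (insert y U)"
    using partial_inj[OF pe] yU z by (auto simp: inj_on_def)
  have 3: "(f(y := z)) x \<in> signed_nbrs A (B (p x) x) ((f(y := z)) (p x))" if "x \<in> insert y U - {r}" for x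
  proof (cases "x = y")
    case True
    then show ?thesis using z py yU by auto
  next
    case False
    then have "x \<in> U" "x \<noteq> r" using that by auto
    then have "p x \<noteq> y" using partial_parent[OF pe] yU by blast
    then show ?thesis using False \<open>x \<in> U\<close> \<open>x \<noteq> r\<close> pe by (auto simp: partial_embedding_def)
  qed
  have 4: "z \<in> X" using z nb_sub by blast
  show ?thesis
    unfolding partial_embedding_def using 1 2 3 4 pe yU by (auto simp: partial_embedding_def)
qed

text \<open>
  Prefer an image that is not adjacent to the image of the grandparent. If no such image is left,
  then the remaining candidates are common neighbours of the images of the parent and the
  grandparent, so there is only one, and using it saturates the image of the parent.
\<close>

lemma nice_extend:
  assumes ni: "careful_embedding F U0 U f" and y: "next_vertex U y"
    and ex: "\<exists>z\<in>signed_nbrs A (B (p y) y) (f (p y)). z \<notin> f ` U \<union> F"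
  shows "\<exists>z. careful_embedding F U0 (insert y U) (f(y := z))"
proof -
  have pe: "partial_embedding U f" using ni by (simp add: careful_embedding_def)
  let ?N = "signed_nbrs A (B (p y) y) (f (p y))"
  have yU: "y \<notin> U" "y \<in> core" using y by (auto simp: next_vertex_def)
  have py: "y \<noteq> r" "p y \<in> U" using nextv_parent[OF pe y] by auto
  have "\<exists>z\<in>?N - (f ` U \<union> F). p y \<noteq> r \<longrightarrow> adj A z (f (p (p y))) \<longrightarrow> ?N \<subseteq> insert z (f ` U) \<union> F"
  proof (cases "p y = r \<or> (\<exists>z\<in>?N - (f ` U \<union> F). \<not> adj A z (f (p (p y))))")
    case True
    then show ?thesis using ex by blast
  next
    case False
    then have ppU: "p (p y) \<in> U" using partial_parent[OF pe py(2)] by blast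
    have "p (p y) \<noteq> p y" using False py pe partial_sub parent_neq core_sub by blast
    then have ne: "f (p (p y)) \<noteq> f (p y)"
      using ppU py partial_inj[OF pe] by (meson inj_onD)
    obtain z where z: "z \<in> ?N - (f ` U \<union> F)" using ex by blast
    have aj: "adj A (f (p (p y))) u" if "u \<in> ?N - (f ` U \<union> F)" for u
      using False that by (intro adj_sym[of A u]) blast
    have "z' = z" if "z' \<in> ?N - (f ` U \<union> F)" for z'
    proof (rule common_nbr[OF ne])
      show "adj A (f (p (p y))) z'" "adj A (f (p (p y))) z" by (rule aj[OF that], rule aj[OF z])
      show "adj A (f (p y)) z'" "adj A (f (p y)) z" using that z by (auto dest: nb_adj)
    qed
    then show ?thesis using z by blast
  qed
  then obtain z where z: "z \<in> ?N" "z \<notin> f ` U \<union> F"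
    and sat: "p y \<noteq> r \<Longrightarrow> adj A z (f (p (p y))) \<Longrightarrow> ?N \<subseteq> insert z (f ` U) \<union> F" by blast
  let ?f = "f(y := z)"
  have pe': "partial_embedding (insert y U) ?f" using partial_extend[OF pe y z(1)] z by blast
  have im: "?f ` insert y U = insert z (f ` U)" using yU by auto
  have "\<exists>s. signed_nbrs A s (?f (p x)) \<subseteq> ?f ` insert y U \<union> F"
    if x: "x \<in> insert y U - U0" "x \<noteq> r" "p x \<noteq> r" "adj A (?f x) (?f (p (p x)))" for x
  proof (cases "x = y")
    case True
    have "p (p y) \<in> U" using partial_parent[OF pe py(2)] True x by simp
    then have "p (p y) \<noteq> y" using yU by metis
    then have "adj A z (f (p (p y)))" using x(4) True by simp
    then have "?N \<subseteq> insert z (f ` U) \<union> F" using sat x True by blast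
    moreover have "p y \<noteq> y" using py yU by metis
    then have "?f (p x) = f (p y)" using True by simp
    ultimately show ?thesis using im by auto
  next
    case False
    then have xU: "x \<in> U" "p x \<in> U" "p (p x) \<in> U"
      using x partial_parent[OF pe] by auto
    then have "x \<noteq> y" "p x \<noteq> y" "p (p x) \<noteq> y" using yU by metis+
    then have "adj A (f x) (f (p (p x)))" using x(4) by simp
    then obtain s where "signed_nbrs A s (f (p x)) \<subseteq> f ` U \<union> F"
      using ni x xU unfolding careful_embedding_def by blast
    then show ?thesis using im \<open>p x \<noteq> y\<close> by auto
  qed
  note sat' = this
  have "U0 \<subseteq> insert y U" "f ` U \<inter> F = {}" using ni by (auto simp: careful_embedding_def)
  then have "?f ` insert y U \<inter> F = {}" using im z(2) by simp
  then have "careful_embedding F U0 (insert y U) ?f"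
    unfolding careful_embedding_def using pe' \<open>U0 \<subseteq> insert y U\<close> sat' by blast
  then show ?thesis by blast
qed

text \<open>The existence of a candidate is a hypothesis, since it rests on different counts for the
  two choices of \<open>F\<close>: the empty set, and the reserved neighbours of the image of the
  root.\<close>

lemma nice_complete:
  assumes "careful_embedding F U0 U f" and "\<forall>x\<in>U0. f x = f0 x"
    and ex: "\<And>U f y. careful_embedding F U0 U f \<Longrightarrow> \<forall>x\<in>U0. f x = f0 x \<Longrightarrow> next_vertex U y \<Longrightarrow>
      \<exists>z\<in>signed_nbrs A (B (p y) y) (f (p y)). z \<notin> f ` U \<union> F"
  shows "\<exists>g. careful_embedding F U0 core g \<and> (\<forall>x\<in>U0. g x = f0 x)"
  using assms(1,2)
proof (induction "card (core - U)" arbitrary: U f rule: less_induct)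
  case less
  show ?case
  proof (cases "core - U = {}")
    case True
    then have "U = core" using less.prems by (auto simp: careful_embedding_def partial_embedding_def)
    then show ?thesis using less.prems by blast
  next
    case False
    then obtain y0 where "y0 \<in> core - U" by blast
    then obtain y where y: "next_vertex U y"
      unfolding next_vertex_def using ex_has_least_nat[of "\<lambda>z. z \<in> core - U" y0 d] by blast
    obtain z where z: "careful_embedding F U0 (insert y U) (f(y := z))"
      using nice_extend[OF less.prems(1) y ex[OF less.prems y]] by blast
    have yU: "y \<in> core - U" using y by (simp add: next_vertex_def)
    then have "card (core - insert y U) < card (core - U)" by (intro psubset_card_mono) auto
    moreover have "\<forall>x\<in>U0. (f(y := z)) x = f0 x"
      using less.prems yU by (auto simp: careful_embedding_def)
    ultimately show ?thesis using less.hyps[OF _ z] by blast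
  qed
qed

section \<open>Placing all leaves simultaneously\<close>

definition avail :: "('c \<Rightarrow> 'a) \<Rightarrow> 'c \<Rightarrow> 'a set" where
  "avail f x = signed_nbrs A (B (p x) x) (f (p x)) - f ` core"

lemma finite_avail [simp]: "finite (avail f x)"
  by (simp add: avail_def)

lemma embeds_if_hall:
  assumes pe: "partial_embedding core f"
    and hall: "\<And>J. J \<subseteq> leaves \<Longrightarrow> J \<noteq> {} \<Longrightarrow> card J \<le> card (\<Union>x\<in>J. avail f x)"
  shows "\<exists>g. inj_on g V \<and> g ` V \<subseteq> X \<and> (\<forall>x y. B x y \<longrightarrow> A (g x) (g y))"
proof -
  have "\<exists>h. inj_on h leaves \<and> (\<forall>x\<in>leaves. h x \<in> avail f x)"
  proof (rule hall_marriage)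
    show "card J \<le> card (\<Union>x\<in>J. avail f x)" if "J \<subseteq> leaves" for J
      using hall[OF that] by (cases "J = {}") auto
  qed auto
  then obtain h where h: "inj_on h leaves" "\<And>x. x \<in> leaves \<Longrightarrow> h x \<in> avail f x" by blast
  let ?g = "\<lambda>x. if x \<in> leaves then h x else f x"
  have V: "V = leaves \<union> core" using leaves_sub by (auto simp: core_def)
  have disj: "x \<notin> leaves" if "x \<in> core" for x using that by (simp add: core_def)
  have hn: "h x \<in> signed_nbrs A (B (p x) x) (f (p x))" "h x \<notin> f ` core" if "x \<in> leaves" for x
    using h(2)[OF that] by (auto simp: avail_def)
  have "inj_on ?g V"
  proof (rule inj_onI)
    fix x y assume *: "x \<in> V" "y \<in> V" "?g x = ?g y"
    then consider "x \<in> leaves" "y \<in> leaves" | "x \<in> core" "y \<in> core" | "x \<in> leaves" "y \<in> core"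
      | "x \<in> core" "y \<in> leaves" using V by blast
    then show "x = y"
    proof cases
      case 1 then show ?thesis using * h(1) by (auto dest: inj_onD)
    next
      case 2 then show ?thesis using * disj partial_inj[OF pe] by (auto dest: inj_onD)
    next
      case 3 then show ?thesis using * disj hn(2)[of x] by force
    next
      case 4 then show ?thesis using * disj hn(2)[of y] by force
    qed
  qed
  moreover have "?g ` V \<subseteq> X"
    using V subsetD[OF nb_sub hn(1)] partial_in[OF pe] by auto
  moreover have *: "?g x \<in> signed_nbrs A (B (p x) x) (?g (p x))" if x: "x \<in> V" "x \<noteq> r" for x
  proof -
    have "?g (p x) = f (p x)" using parent_core[OF x] disj by auto
    then show ?thesis using hn(1)[of x] x V pe by (auto simp: partial_embedding_def)
  qed
  then have "A (?g x) (?g y)" if xy: "B x y" for x y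
    using edge_cases[OF xy] *[of x] *[of y] B_asym[OF xy] xy unfolding signed_nbrs_def by auto
  ultimately show ?thesis by (intro exI[of _ ?g]) blast
qed

end

section \<open>Three neighbourhoods that pairwise share at most one vertex\<close>

context c4_free_digraph
begin

text \<open>Inclusion-exclusion with the overlaps kept explicit, because the tight case needs that
  they are exactly 1 and 2.\<close>

lemma three_nb_bound:
  assumes "v1 \<noteq> v2" "v1 \<noteq> v3" "v2 \<noteq> v3" "finite Y"
    and "C1 \<subseteq> nbrs A v1" "C2 \<subseteq> nbrs A v2" "C3 \<subseteq> nbrs A v3" "C1 \<union> C2 \<union> C3 \<subseteq> Y"
  shows "card C1 + card C2 + card C3 \<le> card Y + card (C1 \<inter> C2) + card (C3 \<inter> (C1 \<union> C2))"
    and "card (C1 \<inter> C2) \<le> 1" and "card (C3 \<inter> (C1 \<union> C2)) \<le> 2"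
proof -
  have fin: "finite C1" "finite C2" "finite C3" by (rule finite_subset[OF _ finite_nbrs], fact)+
  have "card C1 + card C2 = card (C1 \<union> C2) + card (C1 \<inter> C2)"
    using fin by (intro card_Un_Int)
  moreover have "card C3 + card (C1 \<union> C2) = card (C3 \<union> (C1 \<union> C2)) + card (C3 \<inter> (C1 \<union> C2))"
    using fin by (intro card_Un_Int) auto
  moreover have "card (C3 \<union> (C1 \<union> C2)) \<le> card Y" using assms by (intro card_mono) auto
  ultimately show "card C1 + card C2 + card C3 \<le> card Y + card (C1 \<inter> C2) + card (C3 \<inter> (C1 \<union> C2))"
    by linarith
  show "card (C1 \<inter> C2) \<le> 1" using assms by (intro card_common)
  have "card (C3 \<inter> C1) \<le> 1" "card (C3 \<inter> C2) \<le> 1"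
    using card_common[OF assms(2)[symmetric] assms(7) assms(5)]
      card_common[OF assms(3)[symmetric] assms(7) assms(6)] by auto
  moreover have "C3 \<inter> (C1 \<union> C2) = (C3 \<inter> C1) \<union> (C3 \<inter> C2)" by blast
  ultimately show "card (C3 \<inter> (C1 \<union> C2)) \<le> 2"
    using card_Un_le[of "C3 \<inter> C1" "C3 \<inter> C2"] by simp
qed

text \<open>If \<open>v1\<close> and \<open>v3\<close> were not adjacent, both would have to be
  covered by the middle neighbourhood. Tightness (9 = 6 + 3) forces it also to meet each of the
  other two, in different vertices, and this makes four vertices in a set of three.\<close>

lemma three_nb_tight_adj:
  assumes ne: "v1 \<noteq> v2" "v1 \<noteq> v3" "v2 \<noteq> v3" and Y: "finite Y" "card Y = 6"
    and c: "3 \<le> card (signed_nbrs A s1 v1)" "card (signed_nbrs A s2 v2) = 3" "3 \<le> card (signed_nbrs A s3 v3)"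
    and cov: "signed_nbrs A s1 v1 \<union> signed_nbrs A s2 v2 \<union> signed_nbrs A s3 v3 = Y" and v: "v1 \<in> Y" "v3 \<in> Y"
  shows "adj A v1 v3"
proof (rule ccontr)
  assume na: "\<not> adj A v1 v3"
  let ?C1 = "signed_nbrs A s1 v1" and ?C2 = "signed_nbrs A s2 v2" and ?C3 = "signed_nbrs A s3 v3"
  have self: "v \<notin> signed_nbrs A s v" for s v using nb_adj[of v A s v] by auto
  have "v1 \<notin> ?C3" "v3 \<notin> ?C1" using na adj_sym nb_adj by metis+
  then have v13: "v1 \<in> ?C2" "v3 \<in> ?C2" using cov v self[of v1 s1] self[of v3 s3] by auto
  have sub: "?C1 \<subseteq> nbrs A v1" "?C2 \<subseteq> nbrs A v2" "?C3 \<subseteq> nbrs A v3" by (rule nb_sub_nbrs)+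
  note b = three_nb_bound[OF ne Y(1) sub eq_refl[OF cov]]
  have "card (?C1 \<inter> ?C2) \<noteq> 0" using b c Y by linarith
  then obtain a where a: "a \<in> ?C1" "a \<in> ?C2" by (metis Int_iff card.empty equals0I)
  have two: "card (?C3 \<inter> (?C1 \<union> ?C2)) \<ge> 2" using b c Y by linarith
  have "card (?C3 \<inter> ?C1) \<le> 1" using ne sub by (intro card_common) auto
  moreover have "?C3 \<inter> (?C1 \<union> ?C2) = (?C3 \<inter> ?C1) \<union> (?C3 \<inter> ?C2)" by blast
  then have "card (?C3 \<inter> (?C1 \<union> ?C2)) \<le> card (?C3 \<inter> ?C1) + card (?C3 \<inter> ?C2)"
    by (metis card_Un_le)
  ultimately have "card (?C3 \<inter> ?C2) \<noteq> 0" using two by linarith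
  then obtain b where b: "b \<in> ?C3" "b \<in> ?C2" by (metis Int_iff card.empty equals0I)
  have "a \<noteq> b"
  proof
    assume "a = b"
    \<comment> \<open>With \<open>a = b\<close> the third neighbourhood meets each of the others
      only in \<open>a\<close>, but the overlap has two vertices.\<close>
    have "?C3 \<inter> (?C1 \<union> ?C2) \<subseteq> {a}"
    proof
      fix z assume z: "z \<in> ?C3 \<inter> (?C1 \<union> ?C2)"
      show "z \<in> {a}"
      proof (cases "z \<in> ?C1")
        case True
        then show ?thesis using z a b \<open>a = b\<close> common_nbr[OF ne(2), of z a] by (auto dest: nb_adj)
      next
        case False
        then show ?thesis using z a b \<open>a = b\<close> common_nbr[OF ne(3), of z a] by (auto dest: nb_adj)
      qed
    qed
    then have "card (?C3 \<inter> (?C1 \<union> ?C2)) \<le> card {a}" by (intro card_mono) auto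
    then show False using two by simp
  qed
  moreover have "a \<noteq> v1" "a \<noteq> v3" "b \<noteq> v1" "b \<noteq> v3"
    using a b self \<open>v1 \<notin> ?C3\<close> \<open>v3 \<notin> ?C1\<close> by auto
  ultimately have "card {a, b, v1, v3} = 4" using ne by simp
  moreover have "card {a, b, v1, v3} \<le> card ?C2" using a b v13 by (intro card_mono) auto
  ultimately show False using c by simp
qed

end

section \<open>Counting at the supports of the leaves\<close>

context tree_embedding
begin

text \<open>By the handshake sum, the number of leaves is 2 plus the sum of (degree - 2) over the
  non-leaves, and all these summands are nonnegative. Keeping one or two of them gives the
  bounds.\<close>

lemma degree_root_le: "card (nbrs B r) \<le> card leaves"
  and degree_add_root_le: "t \<in> core \<Longrightarrow> t \<noteq> r \<Longrightarrow> card (nbrs B t) + card (nbrs B r) \<le> card leaves + 2"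
proof -
  let ?g = "\<lambda>x. card (nbrs B x)"
  have "sum ?g V = sum ?g leaves + sum ?g core"
    unfolding core_def using leaves_sub finite_V by (metis sum.subset_diff add.commute)
  moreover have "sum ?g leaves = card leaves" by (simp add: leaves_def)
  moreover have "sum ?g core = ?g r + sum ?g (core - {r})" using root_core by (intro sum.remove) auto
  ultimately have s: "card leaves + ?g r + sum ?g (core - {r}) + 2 = 2 * card V"
    using sum_degree by simp
  have lb: "2 * card S \<le> sum ?g S" if "S \<subseteq> core" for S
    using sum_mono[of S "\<lambda>_. 2" ?g] core_degree that by (auto simp: mult.commute)
  have s1: "core - {r} \<subseteq> core" and s2: "core - {r} - {t} \<subseteq> core" by blast+
  have c: "card (core - {r}) + 1 = card core" using root_core card_Suc_Diff1[of core r] by simp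
  show "?g r \<le> card leaves" using lb[OF s1] s c card_core by linarith
  assume t: "t \<in> core" "t \<noteq> r"
  have "sum ?g (core - {r}) = ?g t + sum ?g (core - {r} - {t})" using t by (intro sum.remove) auto
  moreover have "card (core - {r} - {t}) + 1 = card (core - {r})"
    using t card_Suc_Diff1[of "core - {r}" t] by simp
  ultimately show "?g t + ?g r \<le> card leaves + 2"
    using lb[OF s2] s c card_core by linarith
qed

lemma card_core_leaves: "card core + card leaves = k + 1"
  using card_core card_V by simp

lemma support_core: "x \<in> leaves \<Longrightarrow> p x \<in> core"
  using parent_core leaf_neq_root leaves_sub by blast

lemma block_leaves_at:
  assumes "partial_embedding core f" "t \<in> core"
    and w: "w \<in> preimage core f (signed_nbrs A s (f t))"
  shows "block t (preimage core f (signed_nbrs A s (f t))) w \<subseteq> V - insert t (leaves_at t)"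
proof -
  have wc: "w \<in> core" "w \<noteq> t" using w centre_notin_preimage by (auto simp: preimage_def)
  have "\<not> adj B w x" if "x \<in> leaves_at t" for x
    using that adj_leaf[of x w] wc adj_commute[of B] by (auto simp: leaves_at_iff)
  moreover have "x \<noteq> w" if "x \<in> leaves_at t" for x
    using that wc by (auto simp: leaves_at_iff core_def)
  ultimately show ?thesis
    using wc core_sub by (auto simp: block_def dest: adj_in_V)
qed

lemma card_minus_leaves_at:
  assumes "t \<in> core" shows "card (V - insert t (leaves_at t)) + card (leaves_at t) = k"
proof -
  have "t \<notin> leaves_at t" using assms by (auto simp: leaves_at_iff core_def)
  then have c: "card (insert t (leaves_at t)) = Suc (card (leaves_at t))" by simp
  have s: "insert t (leaves_at t) \<subseteq> V" using assms core_sub leaves_sub by (auto simp: leaves_at_iff)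
  then have "card (insert t (leaves_at t)) \<le> card V" using finite_V card_mono by blast
  then show ?thesis using s c card_V by (simp add: card_Diff_subset)
qed

text \<open>Neither \<open>t\<close> nor a leaf at \<open>t\<close> belongs to a block, so the
  shares live on k minus the number of these leaves.\<close>

lemma support_packing:
  assumes "partial_embedding core f" "t \<in> core"
  defines "W \<equiv> \<lambda>s. preimage core f (signed_nbrs A s (f t))"
  shows "2 * card (W s) + card (leaves_at t) \<le> k + card (bad t (W s))"
    and "q \<in> W s \<Longrightarrow> q \<notin> bad t (W s) \<Longrightarrow>
      2 * card (W s) + card (block t (W s) q) + card (leaves_at t) \<le> k + card (bad t (W s)) + 2"
proof -
  have fC: "finite (V - insert t (leaves_at t))" using finite_V by simp
  note pk = packing_partial[OF assms(1,2) fC block_leaves_at[OF assms(1,2)]]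
  show "2 * card (W s) + card (leaves_at t) \<le> k + card (bad t (W s))"
    using pk(1)[where s = s] card_minus_leaves_at[OF assms(2)] unfolding W_def by linarith
  show "2 * card (W s) + card (block t (W s) q) + card (leaves_at t) \<le> k + card (bad t (W s)) + 2"
    if "q \<in> W s" "q \<notin> bad t (W s)"
    using pk(2)[where q = q and s = s] that card_minus_leaves_at[OF assms(2)] unfolding W_def by linarith
qed

text \<open>A bad \<open>m\<close> has exactly two neighbours, \<open>t\<close> and some
  \<open>w\<close> whose image is adjacent to that of \<open>t\<close>. One is the parent of
  \<open>m\<close> and the other a child, so a vertex and its grandparent have adjacent images. The
  condition on \<open>U0\<close> ensures that this child was placed by the careful rule.\<close>

lemma bad_saturated:
  assumes ni: "careful_embedding F U0 core f" and U0: "\<And>x. x \<in> U0 \<Longrightarrow> x = r \<or> p x = r"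
    and t: "t \<in> core" and m: "m \<in> bad t (preimage core f (signed_nbrs A s (f t)))" "m \<noteq> r"
  shows "\<exists>s. signed_nbrs A s (f m) \<subseteq> f ` core \<union> F"
proof -
  obtain w where w: "w \<in> core" "f w \<in> signed_nbrs A s (f t)" "adj B m w" and mt: "adj B t m" and mc: "m \<in> core"
    using m by (auto simp: bad_def preimage_def)
  have two: "adj A (f t) (f w)" "adj A (f w) (f t)" using w(2) nb_adj adj_sym by metis+
  have "w \<noteq> t" using two by auto
  have *: "\<exists>s. signed_nbrs A s (f m) \<subseteq> f ` core \<union> F"
    if "y \<in> core" "y \<noteq> r" "p y = m" "adj A (f y) (f (p m))" for y
    using ni that m(2) U0[of y] unfolding careful_embedding_def by (metis Diff_iff)
  show ?thesis
  proof (cases "w \<noteq> r \<and> p w = m")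
    case True
    have "t \<noteq> r \<and> p t = m \<or> p m = t" using mt by (auto simp: adj_iff)
    \<comment> \<open>If both were children of \<open>m\<close>, the parent of \<open>m\<close>
      would be a third neighbour.\<close>
    moreover have "\<not> (t \<noteq> r \<and> p t = m)"
    proof
      assume t2: "t \<noteq> r \<and> p t = m"
      have "{t, w, p m} \<subseteq> nbrs B m"
        using t2 True adj_parent[of m] adj_parent[of t] adj_parent[of w] m(2) mc t w core_sub adj_sym
        by (metis empty_subsetI in_nbrs insert_subset subsetD)
      moreover have "p m \<noteq> t" "p m \<noteq> w"
        using t2 True grandparent_neq[of t] grandparent_neq[of w] core_in_V[OF t] core_in_V[OF w(1)] m(2)
        by metis+
      ultimately have "3 \<le> card (nbrs B m)"
        using \<open>w \<noteq> t\<close> card_mono[of "nbrs B m" "{t, w, p m}"] by simp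
      then show False using m by (auto simp: bad_def)
    qed
    ultimately have "p m = t" by blast
    then show ?thesis using *[of w] True w two by auto
  next
    case False
    then have pm: "p m = w" using w(3) by (auto simp: adj_iff)
    then have "t \<noteq> r \<and> p t = m" using mt \<open>w \<noteq> t\<close> by (auto simp: adj_iff)
    then show ?thesis using *[of t] pm t two by auto
  qed
qed

lemma card_avail:
  assumes "partial_embedding core f"
  shows "card (avail f x) + card (preimage core f (signed_nbrs A (B (p x) x) (f (p x))))
    = card (signed_nbrs A (B (p x) x) (f (p x)))"
proof -
  let ?N = "signed_nbrs A (B (p x) x) (f (p x))"
  have "card (?N - f ` core) + card (?N \<inter> f ` core) = card ?N"
    by (subst card_Un_disjoint[symmetric]) (auto intro: arg_cong[of _ _ card])
  then show ?thesis using card_preimage[OF assms] by (simp add: avail_def)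
qed

lemma nb_sub_avail:
  "x \<in> J \<Longrightarrow> signed_nbrs A (B (p x) x) (f (p x)) \<subseteq> f ` core \<union> (\<Union>x\<in>J. avail f x)"
  by (auto simp: avail_def)

text \<open>This set contains the signed neighbourhoods in question at all supports of
  \<open>J\<close>. A violation of Hall's condition makes it too small for them.\<close>

lemma card_core_Un_avail:
  assumes "partial_embedding core f" "finite J"
  shows "card (f ` core \<union> (\<Union>x\<in>J. avail f x)) + card leaves = k + 1 + card (\<Union>x\<in>J. avail f x)"
proof -
  have "card (f ` core \<union> (\<Union>x\<in>J. avail f x)) = card (f ` core) + card (\<Union>x\<in>J. avail f x)"
    using assms(2) by (intro card_Un_disjoint) (auto simp: avail_def)
  moreover have "card (f ` core) = card core" using partial_inj[OF assms(1)] by (rule card_image)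
  ultimately show ?thesis using card_core_leaves by simp
qed

end

section \<open>Trees with at most one leaf at each vertex\<close>

context tree_embedding
begin

lemma partial_root: "v \<in> X \<Longrightarrow> partial_embedding {r} (\<lambda>_. v)"
proof -
  assume "v \<in> X"
  moreover have "\<not> d y < d r" if "y \<in> core" for y using root_depth_le[OF core_in_V[OF that]] by simp
  ultimately show ?thesis using root_core by (auto simp: partial_embedding_def)
qed

lemma greedy_choice:
  assumes "partial_embedding U f" "next_vertex U y" "card (signed_nbrs A s (f (p y)) \<inter> F) \<le> m"
    and "2 * (card (preimage U f (signed_nbrs A s (f (p y)))) + m) < k"
  shows "\<exists>z\<in>signed_nbrs A s (f (p y)). z \<notin> f ` U \<union> F"
proof (rule ccontr)
  let ?N = "signed_nbrs A s (f (p y))"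
  assume "\<not> ?thesis"
  then have "?N = (?N \<inter> f ` U) \<union> (?N \<inter> F)" by blast
  then have "card ?N \<le> card (?N \<inter> f ` U) + card (?N \<inter> F)" by (metis card_Un_le)
  moreover have "k \<le> 2 * card ?N"
    using semidegree partial_in nextv_parent assms(1,2) by blast
  moreover have "card (?N \<inter> f ` U) = card (preimage U f ?N)" using card_preimage[OF assms(1)] by simp
  ultimately have "card ?N \<le> card (preimage U f ?N) + m" using assms(3) by linarith
  then have "2 * card ?N \<le> 2 * (card (preimage U f ?N) + m)" by (rule mult_le_mono2)
  then show False using \<open>k \<le> 2 * card ?N\<close> assms(4) by (meson leD le_trans)
qed

lemma inj_parent_leaves:
  assumes "\<And>t. card (leaves_at t) \<le> 1"
  shows "inj_on p leaves"
proof (rule inj_onI)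
  fix x y assume "x \<in> leaves" "y \<in> leaves" "p x = p y"
  then have "x \<in> leaves_at (p x)" "y \<in> leaves_at (p x)" by (auto simp: leaves_at_iff)
  then show "x = y" using assms[of "p x"] card_le_Suc0_iff_eq[of "leaves_at (p x)"] by auto
qed

text \<open>Excludes the tight case in which two leaves compete for one candidate \<open>z\<close>.
  With the support of \<open>y\<close> as root, every non-leaf other than the two supports is
  mapped, level by level, into the neighbourhood of the image of that root only, since otherwise a
  4-cycle closes. Nothing but \<open>z\<close> and the image of \<open>p y\<close> is left for the
  other support.\<close>

lemma twin_supports:
  assumes reroot: "\<exists>p' d'. rooted_tree V B (p y) p' d'"
    and deg3: "3 \<le> card (nbrs B r)" and L: "card leaves = 3" and k: "5 \<le> k"
    and pe: "partial_embedding core f" and xy: "x \<in> leaves" "y \<in> leaves" "p x \<noteq> p y" "p x \<noteq> r"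
    and cov: "signed_nbrs A s (f (p x)) \<union> signed_nbrs A s' (f (p y)) = insert z (f ` core)"
    and z: "z \<in> signed_nbrs A s (f (p x))" "z \<in> signed_nbrs A s' (f (p y))" "z \<notin> f ` core"
  shows False
proof -
  define t q where "t = p x" and "q = p y"
  have tq: "t \<in> core" "q \<in> core" "t \<noteq> q" "t \<noteq> r"
    using xy support_core by (auto simp: t_def q_def)
  let ?N = "signed_nbrs A s (f t)" and ?N' = "signed_nbrs A s' (f q)"
  have cov: "?N \<union> ?N' = insert z (f ` core)" and z: "z \<in> ?N" "z \<in> ?N'" "z \<notin> f ` core"
    using assms by (auto simp: t_def q_def)
  have inj: "inj_on f core" using pe by (rule partial_inj)
  then have ftq: "f t \<noteq> f q" using tq by (meson inj_onD)
  have excl: "u = z" if "adj A (f t) u" "adj A (f q) u" for u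
    using common_nbr[OF ftq that] z by (meson nb_adj)
  have "f t \<in> ?N'" using cov tq nb_adj[of "f t" A s "f t"] by auto
  then have adjtq: "adj A (f t) (f q)" using nb_adj adj_sym by metis
  obtain p' d' where rt: "rooted_tree V B q p' d'" using reroot by (auto simp: q_def)
  interpret R: rooted_tree V B q p' d' by (rule rt)
  \<comment> \<open>The degrees of \<open>t\<close> and of the root add up to at most 3 + 2, and the
    root takes at least 3.\<close>
  have "card (nbrs B t) \<le> 2" using degree_add_root_le[OF tq(1,4)] deg3 L by linarith
  have Rp: "p' u \<in> core" if u: "u \<in> core" "u \<noteq> q" for u
  proof (rule ccontr)
    assume "p' u \<notin> core"
    then have l: "p' u \<in> leaves" using u core_in_V R.parent_in by (simp add: core_def)
    have uV: "u \<in> V" using u core_in_V by blast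
    have lq: "p' u \<noteq> q" using l tq by (auto simp: core_def)
    have "adj B (p' u) u" "adj B (p' u) (p' (p' u))"
      using R.adj_parent[OF uV u(2)] R.adj_parent[OF R.parent_in[OF uV u(2)] lq] adj_sym by metis+
    then have "u = p' (p' u)" using l adj_leaf by metis
    then show False using R.grandparent_neq[OF uV u(2) lq] by simp
  qed
  \<comment> \<open>The neighbours of \<open>t\<close> are its leaf \<open>x\<close> and its parent
    towards \<open>q\<close>, so no non-leaf lies below \<open>t\<close>.\<close>
  have nt: "p' u \<noteq> t" if u: "u \<in> core" "u \<noteq> q" for u
  proof
    assume pu: "p' u = t"
    have uV: "u \<in> V" and tV: "t \<in> V" using u tq core_in_V by auto
    have "adj B t u" "adj B t (p' t)" "adj B t x"
      using R.adj_parent[OF uV u(2)] R.adj_parent[OF tV tq(3)] adj_leaf[OF xy(1)] pu adj_sym t_def by metis+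
    then have "{u, p' t, x} \<subseteq> nbrs B t" by simp
    moreover have "p' t \<noteq> u" using R.grandparent_neq[OF uV u(2)] pu tq by metis
    moreover have "x \<noteq> u" "x \<noteq> p' t" using Rp[OF tq(1,3)] u xy by (auto simp: core_def)
    ultimately have "3 \<le> card (nbrs B t)" using card_mono[of "nbrs B t" "{u, p' t, x}"] by auto
    then show False using \<open>card (nbrs B t) \<le> 2\<close> by simp
  qed
  have main: "f u \<in> ?N' \<and> f u \<notin> ?N" if "u \<in> core" "u \<noteq> q" "u \<noteq> t" for u
    using that
  proof (induction "d' u" arbitrary: u rule: less_induct)
    case less
    have uV: "u \<in> V" using less.prems core_in_V by blast
    have w: "p' u \<in> core" "p' u \<noteq> t" using Rp nt less.prems by auto
    have a: "adj A (f u) (f (p' u))"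
      using partial_adj[OF pe less.prems(1) w(1) R.adj_parent[OF uV less.prems(2)]] .
    have in_or: "f u \<in> ?N \<or> f u \<in> ?N'" using cov less.prems(1) by blast
    have "f u \<notin> ?N"
    proof
      assume fN: "f u \<in> ?N"
      show False
      proof (cases "p' u = q")
        case True
        then have "adj A (f q) (f u)" using a adj_sym by metis
        then have "f u = z" using excl nb_adj[OF fN] by blast
        then show False using z less.prems(1) by blast
      next
        case False
        have "d' (p' u) < d' u" using R.depth[OF uV less.prems(2)] by simp
        then have "f (p' u) \<in> ?N'" using less.hyps w False by blast
        moreover have "f u \<noteq> f q" using inj less.prems tq by (meson inj_onD)
        \<comment> \<open>Otherwise the images of \<open>u\<close> and \<open>q\<close> have the two
          common neighbours \<open>f t\<close> and \<open>f (p' u)\<close>.\<close>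
        ultimately have "f t = f (p' u)"
          using common_nbr[of "f u" "f q" "f t" "f (p' u)"] a adjtq nb_adj[OF fN] nb_adj adj_sym by metis
        then show False using inj w tq by (metis inj_onD)
      qed
    qed
    then show ?case using in_or by blast
  qed
  have "?N \<subseteq> {f q, z}"
  proof
    fix u assume u: "u \<in> ?N"
    have "u \<noteq> f t" using nb_adj[OF u] by auto
    then show "u \<in> {f q, z}" using u cov main by blast
  qed
  then have "card ?N \<le> card {f q, z}" by (intro card_mono) auto
  also have "\<dots> \<le> 2" by (simp add: card_insert_if)
  finally show False using semidegree[OF partial_in[OF pe tq(1)], of s] k by linarith
qed

text \<open>The root may go anywhere and no vertex is reserved. Distinct leaves have distinct
  supports, so there are at least as many non-leaves as leaves, and at least three leaves; hence k
  >= 5.\<close>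

lemma embeds_if_branching:
  assumes reroot: "\<And>q. q \<in> V \<Longrightarrow> \<exists>p' d'. rooted_tree V B q p' d'"
    and deg3: "3 \<le> card (nbrs B r)" and one: "\<And>t. card (leaves_at t) \<le> 1" and X: "X \<noteq> {}"
  shows "\<exists>g. inj_on g V \<and> g ` V \<subseteq> X \<and> (\<forall>x y. B x y \<longrightarrow> A (g x) (g y))"
proof -
  obtain v0 where v0: "v0 \<in> X" using X by blast
  have "careful_embedding {} {r} {r} (\<lambda>_. v0)" using partial_root[OF v0] by (simp add: careful_embedding_def)
  moreover have "\<exists>z\<in>signed_nbrs A (B (p y) y) (f (p y)). z \<notin> f ` U \<union> {}" if "careful_embedding {} {r} U f" "next_vertex U y" for U f y
    using nextv_few[of U f y "B (p y) y"] that by (intro greedy_choice[where m = 0]) (auto simp: careful_embedding_def)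
  ultimately obtain f where ni: "careful_embedding {} {r} core f"
    using nice_complete[of "{}" "{r}" "{r}" "\<lambda>_. v0" "\<lambda>_. v0"] by blast
  then have pe: "partial_embedding core f" by (simp add: careful_embedding_def)
  have inj: "inj_on f core" using pe by (rule partial_inj)
  have L3: "3 \<le> card leaves" using degree_root_le deg3 by linarith
  have injp: "inj_on p leaves" using one by (rule inj_parent_leaves)
  have "card leaves \<le> card core"
    using card_inj_on_le[OF injp] support_core finite_core by blast
  then have kL: "2 * card leaves \<le> k + 1" using card_core_leaves by simp
  have sd: "k \<le> 2 * card (signed_nbrs A s (f t))" if "t \<in> core" for s t
    using semidegree partial_in[OF pe] that by blast
  have fne: "f (p x) \<noteq> f (p y)" if "x \<in> leaves" "y \<in> leaves" "x \<noteq> y" for x y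
    using that inj injp support_core by (meson inj_onD)
  let ?N = "\<lambda>x. signed_nbrs A (B (p x) x) (f (p x))"
  \<comment> \<open>An exhausted leaf forces a bad vertex \<open>m\<close>, which is saturated. Two
    signed neighbourhoods then occupy at least k - 1 images of non-leaves, but there are only k + 1
    - L <= k - 2.\<close>
  have single: "avail f x \<noteq> {}" if x: "x \<in> leaves" for x
  proof
    assume e: "avail f x = {}"
    have t: "p x \<in> core" using x support_core by blast
    let ?W = "preimage core f (?N x)"
    have "x \<in> leaves_at (p x)" using x by (simp add: leaves_at_iff)
    then have "0 < card (leaves_at (p x))" by (auto simp: card_gt_0_iff)
    moreover have "2 * card ?W + card (leaves_at (p x)) \<le> k + card (bad (p x) ?W)"
      by (rule support_packing(1)[OF pe t])
    moreover have "card ?W = card (?N x)" using card_avail[OF pe, of x] e by simp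
    ultimately have "card (bad (p x) ?W) \<noteq> 0" using sd[OF t, of "B (p x) x"] by linarith
    then obtain m where m: "m \<in> bad (p x) ?W" by (metis card.empty equals0I)
    then have "m \<noteq> r" using deg3 by (auto simp: bad_def)
    then obtain s where s: "signed_nbrs A s (f m) \<subseteq> f ` core \<union> {}"
      using bad_saturated[OF ni _ t m] by auto
    have mc: "m \<in> core" "m \<noteq> p x" using m centre_notin_preimage by (auto simp: bad_def preimage_def)
    then have ne: "f m \<noteq> f (p x)" using inj t by (meson inj_onD)
    have "?N x \<subseteq> f ` core" using e by (auto simp: avail_def)
    then have "card (signed_nbrs A s (f m) \<union> ?N x) \<le> card (f ` core)" using s by (intro card_mono) auto
    also have "\<dots> = card core" using inj by (rule card_image)
    finally have "k \<le> card core + 1"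
      using card_Un_nb[OF ne, of s "B (p x) x"] sd[OF mc(1), of s] sd[OF t, of "B (p x) x"] by linarith
    then show False using card_core_leaves L3 by linarith
  qed
  have "card J \<le> card (\<Union>x\<in>J. avail f x)" if J: "J \<subseteq> leaves" "J \<noteq> {}" for J
  proof (rule ccontr)
    let ?S = "\<Union>x\<in>J. avail f x"
    assume "\<not> card J \<le> card ?S"
    then have lt: "card ?S < card J" by simp
    have finJ: "finite J" using J finite_leaves finite_subset by blast
    have finS: "finite ?S" using finJ by auto
    have cJ: "card J \<le> card leaves" using J by (intro card_mono) auto
    obtain x where x: "x \<in> J" using J by blast
    have "0 < card (avail f x)" using single x J by (auto simp: card_gt_0_iff)
    moreover have "card (avail f x) \<le> card ?S" using x finS by (intro card_mono) auto
    ultimately have "2 \<le> card J" using lt by linarith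
    let ?Y = "f ` core \<union> ?S"
    have finY: "finite ?Y" using finS by simp
    have cY: "card ?Y + card leaves = k + 1 + card ?S" by (rule card_core_Un_avail[OF pe finJ])
    have NY: "?N u \<subseteq> ?Y" if "u \<in> J" for u using nb_sub_avail[OF that] .
    show False
    proof (cases "card J = 2")
      case True
      then obtain y where y: "J = {x, y}" "x \<noteq> y" using x by (metis card_2_iff insertE insert_commute singletonD)
      have xy: "x \<in> leaves" "y \<in> leaves" using y J by auto
      have S1: "card ?S = 1" using \<open>0 < card (avail f x)\<close> \<open>card (avail f x) \<le> card ?S\<close> lt True by linarith
      then obtain z where z: "?S = {z}" by (auto simp: card_1_singleton_iff)
      have az: "avail f x = {z}" "avail f y = {z}"
        using z y single[OF xy(1)] single[OF xy(2)] by auto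
      then have zN: "z \<in> ?N x" "z \<in> ?N y" "z \<notin> f ` core" by (auto simp: avail_def)
      have "card (?N x \<union> ?N y) \<le> card ?Y" using NY y finY by (intro card_mono) auto
      moreover have "k \<le> card (?N x \<union> ?N y) + 1"
        using card_Un_nb[OF fne[OF xy y(2)], of "B (p x) x" "B (p y) y"]
          sd[OF support_core[OF xy(1)], of "B (p x) x"] sd[OF support_core[OF xy(2)], of "B (p y) y"] by linarith
      \<comment> \<open>The two neighbourhoods cover at least k - 1 vertices of \<open>?Y\<close>,
        which has k + 2 - L; so L = 3 and both bounds are equalities.\<close>
      ultimately have L: "card leaves = 3" "card ?Y \<le> card (?N x \<union> ?N y)" using cY S1 L3 by linarith+
      have "?N x \<union> ?N y = ?Y" using NY y finY L(2) by (intro card_seteq) auto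
      then have cov: "?N x \<union> ?N y = insert z (f ` core)" using z by auto
      have k5: "5 \<le> k" using kL L by simp
      have rr: "\<exists>p' d'. rooted_tree V B (p u) p' d'" if "u \<in> leaves" for u
        using reroot support_core[OF that] core_in_V by blast
      have pne: "p x \<noteq> p y" using injp xy y(2) by (meson inj_onD)
      show False
      proof (cases "p x = r")
        case False
        show False by (rule twin_supports[OF rr[OF xy(2)] deg3 L(1) k5 pe xy pne False cov zN])
      next
        case True
        then have "p y \<noteq> r" using pne by simp
        moreover have "?N y \<union> ?N x = insert z (f ` core)" using cov by blast
        ultimately show False
          using twin_supports[OF rr[OF xy(1)] deg3 L(1) k5 pe xy(2,1) pne[symmetric] _ _ zN(2,1,3)] by blast
      qed
    next
      case False
      then have J3: "3 \<le> card J" using \<open>2 \<le> card J\<close> by linarith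
      then obtain K where K: "K \<subseteq> J" "card K = 3" "finite K" by (rule obtain_subset_with_card_n)
      then obtain x1 x2 x3 where K3: "K = {x1, x2, x3}" "x1 \<noteq> x2" "x1 \<noteq> x3" "x2 \<noteq> x3"
        by (auto simp: card_3_iff)
      then have xJ: "x1 \<in> J" "x2 \<in> J" "x3 \<in> J" using K by auto
      then have xl: "x1 \<in> leaves" "x2 \<in> leaves" "x3 \<in> leaves" using J by auto
      note ne = fne[OF xl(1,2) K3(2)] fne[OF xl(1,3) K3(3)] fne[OF xl(2,3) K3(4)]
      have sub: "?N x1 \<union> ?N x2 \<union> ?N x3 \<subseteq> ?Y" using NY xJ by blast
      note b = three_nb_bound[OF ne finY nb_sub_nbrs nb_sub_nbrs nb_sub_nbrs sub]
      note sds = sd[OF support_core[OF xl(1)], of "B (p x1) x1"] sd[OF support_core[OF xl(2)], of "B (p x2) x2"]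
        sd[OF support_core[OF xl(3)], of "B (p x3) x3"]
      have Yk: "card ?Y \<le> k" using cY lt cJ by linarith
      \<comment> \<open>Three times k/2, rounded up, is at most k + 3. For k >= 5 this holds only at
        k = 6, with equality.\<close>
      have k6: "k = 6"
      proof -
        have "card (?N x1) + card (?N x2) + card (?N x3) \<le> k + 3" using b Yk by linarith
        moreover have "5 \<le> k" using kL L3 by linarith
        ultimately show ?thesis using sds by presburger
      qed
      have c3: "3 \<le> card (?N x1)" "3 \<le> card (?N x2)" "3 \<le> card (?N x3)" using sds k6 by linarith+
      then have eq3: "card (?N x1) = 3" "card (?N x2) = 3" "card (?N x3) = 3" "card ?Y = 6"
        using b Yk k6 by linarith+
      have S2: "card ?S \<le> 2" using cY eq3 k6 kL by linarith
      have "card (?N x1 \<union> ?N x2) + card (?N x1 \<inter> ?N x2) = 6"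
        using card_Un_Int[of "?N x1" "?N x2"] eq3 by simp
      moreover have "card (?N x3 \<union> (?N x1 \<union> ?N x2)) + card (?N x3 \<inter> (?N x1 \<union> ?N x2)) = 3 + card (?N x1 \<union> ?N x2)"
        using card_Un_Int[of "?N x3" "?N x1 \<union> ?N x2"] eq3 by simp
      ultimately have "6 \<le> card (?N x3 \<union> (?N x1 \<union> ?N x2))" using b by linarith
      then have covY: "?N x1 \<union> ?N x2 \<union> ?N x3 = ?Y"
        using sub eq3(4) finY by (intro card_seteq) (auto simp: Un_ac)
      have inY: "f (p x) \<in> ?Y" if "x \<in> leaves" for x using support_core[OF that] by blast
      have perm: "?N x1 \<union> ?N x3 \<union> ?N x2 = ?Y" "?N x2 \<union> ?N x1 \<union> ?N x3 = ?Y" using covY by blast+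
      have a13: "adj A (f (p x1)) (f (p x3))"
        by (rule three_nb_tight_adj[OF ne finY eq3(4) c3(1) eq3(2) c3(3) covY inY[OF xl(1)] inY[OF xl(3)]])
      have a12: "adj A (f (p x1)) (f (p x2))"
        by (rule three_nb_tight_adj[OF ne(2) ne(1) ne(3)[symmetric] finY eq3(4) c3(1) eq3(3) c3(2) perm(1)
              inY[OF xl(1)] inY[OF xl(2)]])
      have a23: "adj A (f (p x2)) (f (p x3))"
        by (rule three_nb_tight_adj[OF ne(1)[symmetric] ne(3) ne(2) finY eq3(4) c3(2) eq3(1) c3(3) perm(2)
              inY[OF xl(2)] inY[OF xl(3)]])
      \<comment> \<open>The three images are pairwise adjacent, so the only common neighbour of two
        of them is the third, which is occupied. Thus three nonempty candidate sets are disjoint,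
        against |S| <= 2.\<close>
      have dis: "avail f u \<inter> avail f u' = {}"
        if "u \<in> leaves" "u' \<in> leaves" "u \<noteq> u'" "u'' \<in> leaves"
          "adj A (f (p u)) (f (p u''))" "adj A (f (p u')) (f (p u''))" for u u' u''
      proof (rule ccontr)
        assume "avail f u \<inter> avail f u' \<noteq> {}"
        then obtain z where z: "z \<in> ?N u" "z \<in> ?N u'" "z \<notin> f ` core" by (auto simp: avail_def)
        then have "z = f (p u'')"
          using common_nbr[OF fne[OF that(1-3)]] that(5,6) nb_adj by metis
        then show False using z support_core[OF that(4)] by blast
      qed
      have d12: "avail f x1 \<inter> avail f x2 = {}" using dis[OF xl(1,2) K3(2) xl(3)] a13 a23 by blast
      have d13: "avail f x1 \<inter> avail f x3 = {}"
        using dis[OF xl(1,3) K3(3) xl(2)] a12 adj_sym[OF a23] by blast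
      have d23: "avail f x2 \<inter> avail f x3 = {}"
        using dis[OF xl(2,3) K3(4) xl(1)] adj_sym[OF a12] adj_sym[OF a13] by blast
      have "card (avail f x1) + card (avail f x2) + card (avail f x3)
          = card (avail f x1 \<union> avail f x2 \<union> avail f x3)"
        using d12 d13 d23 by (subst card_Un_disjoint | auto)+
      also have "\<dots> \<le> card ?S" using xJ finS by (intro card_mono) auto
      finally have "card (avail f x1) + card (avail f x2) + card (avail f x3) \<le> 2" using S2 by linarith
      moreover have "0 < card (avail f x1)" "0 < card (avail f x2)" "0 < card (avail f x3)"
        using single xl by (simp_all add: card_gt_0_iff)
      ultimately show False by linarith
    qed
  qed
  then show ?thesis by (intro embeds_if_hall[OF pe]) auto
qed

end

section \<open>Trees with several leaves at the root\<close>

text \<open>The sign \<open>s\<close> is carried by at least half of the children of the root. The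
  large neighbourhood of \<open>v0\<close> serves this sign; for the other one, half of the children
  fit into the guaranteed k/2.\<close>

locale heavy_root = tree_embedding X A V B r p d k
  for X :: "'a set" and A and V :: "'c set" and B r p d k +
  fixes s :: bool and v0 :: 'a
  assumes two_leaves: "2 \<le> card (leaves_at r)"
    and most_leaves: "t \<in> core \<Longrightarrow> card (leaves_at t) \<le> card (leaves_at r)"
    and sign_majority: "2 * card {y \<in> children r. B r y = (\<not> s)} \<le> card (children r)"
    and v0_in: "v0 \<in> X"
    and v0_big: "card (children r) < card (signed_nbrs A s v0)"
begin

definition inner :: "'c set" where
  "inner = children r \<inter> core"

lemma finite_inner [simp]: "finite inner"
  by (simp add: inner_def)

lemma inner_iff: "x \<in> inner \<longleftrightarrow> x \<in> core \<and> x \<noteq> r \<and> p x = r"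
  using core_sub by (auto simp: inner_def children_def)

lemma chl_root: "children r = inner \<union> leaves_at r" "inner \<inter> leaves_at r = {}"
  by (auto simp: inner_def leaves_at_def core_def children_def)

lemma card_chl_root: "card (children r) = card inner + card (leaves_at r)"
  unfolding chl_root(1) using chl_root(2) by (intro card_Un_disjoint) auto

lemma nbrs_root: "nbrs B r = children r"
  using nbrs_eq[OF root_in] by simp

lemma inner_nonempty: "x \<in> core \<Longrightarrow> x \<noteq> r \<Longrightarrow> inner \<noteq> {}"
proof (induction "d x" arbitrary: x rule: less_induct)
  case less
  show ?case
  proof (cases "p x = r")
    case True
    then show ?thesis using less.prems inner_iff by blast
  next
    case False
    then show ?thesis
      using less.hyps[of "p x"] less.prems parent_core[of x] depth[of x] core_in_V[of x] by simp
  qed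
qed

lemma degree_root_less: "inner \<noteq> {} \<Longrightarrow> card (children r) < k" and degree_root_le_k: "card (children r) \<le> k"
proof -
  have "card (insert r (children r)) \<le> card V"
    using root_in finite_V by (intro card_mono) (auto simp: children_def)
  moreover have "r \<notin> children r" by (simp add: children_def)
  ultimately show "card (children r) \<le> k" using card_V by simp
  assume "inner \<noteq> {}"
  then obtain x where x: "x \<in> core" "x \<noteq> r" "p x = r" using inner_iff by blast
  then obtain y where y: "y \<in> V" "y \<noteq> r" "p y = x" using core_child[of x] by (auto simp: children_def)
  have "y \<notin> insert r (children r)" using x y by (auto simp: children_def)
  then have "card (insert y (insert r (children r))) = card (children r) + 2" using \<open>r \<notin> children r\<close> by simp
  moreover have "card (insert y (insert r (children r))) \<le> card V"
    using root_in finite_V y by (intro card_mono) (auto simp: children_def)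
  ultimately show "card (children r) < k" using card_V by simp
qed

text \<open>
  The images of the inner children of the root are chosen so that each leaf of the root, and each
  leaf with the minority orientation, still has one candidate more than needed.
\<close>

lemma place_inner:
  "\<exists>g. inj_on g inner \<and> (\<forall>y\<in>inner. g y \<in> signed_nbrs A (B r y) v0) \<and>
     card (leaves_at r) < card (signed_nbrs A s v0 - g ` inner) \<and>
     card {y \<in> leaves_at r. B r y = (\<not> s)} + (if inner = {} then 0 else 1)
       \<le> card (signed_nbrs A (\<not> s) v0 - g ` inner)"
proof -
  define Nm where "Nm = signed_nbrs A (\<not> s) v0"
  let ?Np = "signed_nbrs A s v0"
  let ?Pp = "{y \<in> inner. B r y = s}" and ?Pm = "{y \<in> inner. B r y = (\<not> s)}"
  let ?Lm = "{y \<in> leaves_at r. B r y = (\<not> s)}" and ?e = "if inner = {} then 0 else (1::nat)"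
  define e where "e = ?e"
  define pm pp lm where "pm = card ?Pm" and "pp = card ?Pp" and "lm = card ?Lm"
  have e1: "e \<le> 1" by (simp add: e_def)
  have "{y \<in> children r. B r y = (\<not> s)} = ?Pm \<union> ?Lm" using chl_root by auto
  then have dm: "card {y \<in> children r. B r y = (\<not> s)} = pm + lm"
    unfolding pm_def lm_def using chl_root(2) by (simp only:) (intro card_Un_disjoint, auto)
  have "inner = ?Pp \<union> ?Pm" by auto
  then have P: "card inner = pp + pm"
    unfolding pm_def pp_def by (subst card_Un_disjoint[symmetric]) (auto intro: arg_cong[of _ _ card])
  \<comment> \<open>The spare unit \<open>e\<close> is affordable because a root with an inner child
    has degree less than k: that child has a child of its own.\<close>
  have "2 * pm + 2 * lm + e \<le> k"
  proof (cases "inner = {}")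
    case True
    then show ?thesis using sign_majority degree_root_le_k dm by (simp add: e_def)
  next
    case False
    then show ?thesis using sign_majority degree_root_less[OF False] dm by (simp add: e_def)
  qed
  then have Nm: "pm + lm + e \<le> card Nm"
    using semidegree[OF v0_in, of "\<not> s", folded Nm_def] e1 by linarith
  have finNm: "finite Nm" by (simp add: Nm_def)
  have "pm \<le> card Nm" using Nm by linarith
  \<comment> \<open>In the minority neighbourhood, \<open>B1\<close> receives the inner children of
    that sign and \<open>B2\<close> is set aside for the leaves of that sign and, if there are inner
    children, one spare vertex. \<open>C\<close>, for the majority, avoids both, since 2-cycles may
    make the two neighbourhoods of \<open>v0\<close> overlap.\<close>
  then obtain B1 where B1: "B1 \<subseteq> Nm" "card B1 = pm" "finite B1"
    by (rule obtain_subset_with_card_n)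
  have "card (Nm - B1) = card Nm - card B1" using B1 by (intro card_Diff_subset) auto
  then have "lm + e \<le> card (Nm - B1)" using Nm B1 by linarith
  then obtain B2 where B2: "B2 \<subseteq> Nm - B1" "card B2 = lm + e" "finite B2"
    by (rule obtain_subset_with_card_n)
  have "card ?Np - card (B1 \<union> B2) \<le> card (?Np - (B1 \<union> B2))"
    using B1 B2 by (intro diff_card_le_card_Diff) auto
  moreover have "card (B1 \<union> B2) \<le> pm + lm + e"
    using card_Un_le[of B1 B2] B1(2) B2(2) by linarith
  moreover have "lm \<le> card (leaves_at r)" unfolding lm_def by (intro card_mono) auto
  ultimately have "pp \<le> card (?Np - (B1 \<union> B2))"
    using v0_big e1 P card_chl_root by linarith
  then obtain C where C: "C \<subseteq> ?Np - (B1 \<union> B2)" "card C = pp" "finite C"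
    by (rule obtain_subset_with_card_n)
  obtain g1 where g1: "bij_betw g1 ?Pm B1"
    using B1 finite_same_card_bij[of ?Pm B1] by (auto simp: pm_def)
  obtain g2 where g2: "bij_betw g2 ?Pp C"
    using C finite_same_card_bij[of ?Pp C] by (auto simp: pp_def)
  let ?g = "\<lambda>y. if B r y = s then g2 y else g1 y"
  have g1': "g1 y \<in> B1" if "y \<in> ?Pm" for y using g1 that by (auto simp: bij_betw_def)
  have g2': "g2 y \<in> C" if "y \<in> ?Pp" for y using g2 that by (auto simp: bij_betw_def)
  have inj: "inj_on ?g inner"
  proof (rule inj_onI)
    fix x y assume xy: "x \<in> inner" "y \<in> inner" "?g x = ?g y"
    have d: "B1 \<inter> C = {}" using C by blast
    show "x = y"
    proof (cases "(B r x = s) = (B r y = s)")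
      case True
      then show ?thesis using xy g1 g2 unfolding bij_betw_def by (auto dest: inj_onD split: if_splits)
    next
      case False
      then show ?thesis using xy d g1'[of x] g1'[of y] g2'[of x] g2'[of y]
        by (auto split: if_splits)
    qed
  qed
  have im: "?g ` inner \<subseteq> B1 \<union> C" using g1' g2' by auto
  have "?g y \<in> signed_nbrs A (B r y) v0" if y: "y \<in> inner" for y
  proof (cases "B r y = s")
    case True
    then show ?thesis using g2'[of y] y C by auto
  next
    case False
    then have "B r y = (\<not> s)" by auto
    then show ?thesis using g1'[of y] y B1 False by (auto simp: Nm_def)
  qed
  moreover have "card (leaves_at r) < card (?Np - ?g ` inner)"
  proof -
    have "card ?Np - card (?g ` inner) \<le> card (?Np - ?g ` inner)" by (intro diff_card_le_card_Diff) auto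
    moreover have "card (?g ` inner) = card inner" using inj by (rule card_image)
    ultimately show ?thesis using v0_big card_chl_root by linarith
  qed
  moreover have "card ?Lm + ?e \<le> card (Nm - ?g ` inner)"
  proof -
    have "B2 \<subseteq> Nm - ?g ` inner" using B2 C im by blast
    then have "card B2 \<le> card (Nm - ?g ` inner)" using finNm by (intro card_mono) auto
    then show ?thesis using B2 by (simp add: lm_def e_def)
  qed
  ultimately show ?thesis using inj unfolding Nm_def by (intro exI[of _ ?g]) blast
qed

end

section \<open>Reserving the neighbours of the image of the root\<close>

context heavy_root
begin

abbreviation base :: "'c set" where
  "base \<equiv> insert r inner"

text \<open>All neighbours of \<open>v0\<close> not given to inner children are kept for the leaves
  of the root. This costs the image of any other vertex at most one candidate, as it shares at most
  one neighbour with \<open>v0\<close>.\<close>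

abbreviation forbidden :: "('c \<Rightarrow> 'a) \<Rightarrow> 'a set" where
  "forbidden g \<equiv> nbrs A v0 - g ` inner"

lemma base_cases: "x \<in> base \<Longrightarrow> x = r \<or> p x = r"
  using inner_iff by blast

lemma nice_base:
  assumes g: "inj_on g inner" "\<forall>y\<in>inner. g y \<in> signed_nbrs A (B r y) v0"
  shows "careful_embedding (forbidden g) base base (g(r := v0))"
proof -
  have rn: "r \<notin> inner" by (simp add: inner_iff)
  have ag: "adj A v0 (g y)" if "y \<in> inner" for y using g(2) that by (meson nb_adj)
  have v0n: "v0 \<notin> g ` inner"
  proof
    assume "v0 \<in> g ` inner"
    then obtain y where "y \<in> inner" "v0 = g y" by blast
    then show False using ag[of y] by simp
  qed
  have dc: "y \<in> base" if "x \<in> base" "y \<in> core" "d y < d x" for x y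
  proof -
    have "d x \<le> Suc (d r)" using that(1) depth[of x] core_in_V by (auto simp: inner_iff)
    then have "d y = d r" using that root_depth_le[OF core_in_V[OF that(2)]] by linarith
    then show ?thesis using depth_eq_root core_in_V that(2) by blast
  qed
  have im: "(g(r := v0)) ` base = insert v0 (g ` inner)" using rn by auto
  have "inj_on (g(r := v0)) base" using g(1) rn v0n by (auto simp: inj_on_def)
  moreover have "(g(r := v0)) ` base \<subseteq> X" using v0_in im adj_in[OF ag] by auto
  moreover have "(g(r := v0)) x \<in> signed_nbrs A (B (p x) x) ((g(r := v0)) (p x))" if "x \<in> base - {r}" for x
    using that g(2) rn by (auto simp: inner_iff)
  ultimately have "partial_embedding base (g(r := v0))"
    unfolding partial_embedding_def using dc root_core by (auto simp: inner_def)
  moreover have "(g(r := v0)) ` base \<inter> forbidden g = {}" using im by auto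
  ultimately show ?thesis by (auto simp: careful_embedding_def)
qed

lemma degree_root_ge: "inner \<noteq> {} \<Longrightarrow> 3 \<le> card (nbrs B r)"
proof -
  assume "inner \<noteq> {}"
  then have "0 < card inner" by (simp add: card_gt_0_iff)
  then show ?thesis using nbrs_root card_chl_root two_leaves by simp
qed

text \<open>If the reservation costs a candidate, the inequality of \<open>nextv_few\<close> has to
  improve by 2. The leaves of the root, or the large share of the root itself, provide this.\<close>

lemma nice_step:
  assumes ni: "careful_embedding (forbidden g) base U f" and agree: "\<forall>x\<in>base. f x = (g(r := v0)) x"
    and y: "next_vertex U y"
  shows "\<exists>z\<in>signed_nbrs A (B (p y) y) (f (p y)). z \<notin> f ` U \<union> forbidden g"
proof -
  have pe: "partial_embedding U f" and bU: "base \<subseteq> U" and disj: "f ` U \<inter> forbidden g = {}"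
    using ni by (auto simp: careful_embedding_def)
  have fr: "f r = v0" and fg: "f ` inner = g ` inner" using agree by (auto simp: inner_iff)
  define t where "t = p y"
  have y': "y \<in> core" "y \<notin> U" "y \<noteq> r" "t \<in> U"
    using y nextv_parent[OF pe y] by (auto simp: next_vertex_def t_def)
  have "y \<notin> inner" using y' bU by blast
  then have tr: "t \<noteq> r" using y' by (simp add: inner_iff t_def)
  have tc: "t \<in> core" using y' pe partial_sub by blast
  have ne: "f t \<noteq> v0" using fr tr y' bU partial_inj[OF pe] by (metis inj_onD insert_subset)
  define N where "N = signed_nbrs A (B t y) (f t)"
  define W where "W = preimage U f N"
  have few: "2 * card W + 1 \<le> k" using nextv_few[OF pe y] unfolding W_def N_def t_def by blast
  have cF: "card (N \<inter> forbidden g) \<le> 1"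
    unfolding N_def using ne by (intro card_common[of "f t" v0]) (auto dest: nb_adj)
  show ?thesis
  proof (cases "N \<inter> forbidden g = {}")
    case True
    then show ?thesis
      using few unfolding N_def W_def t_def by (intro greedy_choice[OF pe y, where m = 0]) auto
  next
    case False
    then obtain z where z: "z \<in> N" "adj A v0 z" "z \<notin> g ` inner" by auto
    \<comment> \<open>The only common neighbour of \<open>f t\<close> and \<open>v0\<close> is the
      reserved \<open>z\<close>, so no inner child of the root has its image in
      \<open>N\<close>.\<close>
    have noinner: "x \<notin> W" if "x \<in> inner" for x
    proof
      assume "x \<in> W"
      then have "f x \<in> N" by (simp add: W_def preimage_def)
      moreover have "adj B r x"
        using that adj_parent[of x] core_in_V[of x] adj_commute[of B r x] by (auto simp: inner_iff)
      then have "adj A v0 (f x)"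
        using partial_adj[OF pe, of r x] that bU fr by auto
      ultimately have "f x = z" using common_nbr[OF ne] z nb_adj unfolding N_def by metis
      then show False using z fg that by blast
    qed
    obtain y2 where y2: "y2 \<in> children y" using core_child y' by blast
    let ?C = "V - {t, y, y2}"
    have cC: "card ?C + 2 = k" using card_removed_three[OF pe y y2] by (simp add: t_def)
    have blk: "block t W w \<subseteq> ?C" if "w \<in> W" for w
      using nextv_block[OF pe y y2] that unfolding W_def N_def t_def by blast
    have badt: "bad t W \<subseteq> {p t}"
      using nextv_bad[OF pe y] tr unfolding W_def N_def t_def by auto
    then have bad1: "card (bad t W) \<le> 1" using card_mono[of "{p t}" "bad t W"] by simp
    have inr: "inner \<noteq> {}" using inner_nonempty[OF tc tr] .
    have Wc: "W \<subseteq> core" using pe partial_sub by (auto simp: W_def preimage_def)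
    have "2 * card W + 3 \<le> k"
    \<comment> \<open>Without the root in \<open>W\<close>, no block contains a leaf of the root,
      which frees at least two vertices of \<open>?C\<close>. With it, the root has a share of at
      least three vertices, and of at least four if \<open>t\<close> is not its child.\<close>
    proof (cases "r \<in> W")
      case False
      have "block t W w \<subseteq> ?C - leaves_at r" if w: "w \<in> W" for w
      proof -
        have "w \<notin> leaves" "w \<noteq> r" using w Wc False by (auto simp: core_def)
        then have "x \<notin> block t W w" if "x \<in> leaves_at r" for x
          using that adj_leaf[of x w] adj_commute[of B x w] by (auto simp: block_def leaves_at_iff)
        then show ?thesis using blk[OF w] by blast
      qed
      then have "2 * card W \<le> card (?C - leaves_at r) + card (bad t W)"
        unfolding W_def N_def using finite_V by (intro packing_partial(1)[OF pe y'(4)]) auto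
      moreover have "card (?C - leaves_at r) + card (leaves_at r) = card ?C"
      proof -
        have "leaves_at r \<subseteq> ?C"
          using y' y2 tc leaves_sub by (auto simp: leaves_at_iff core_def children_def)
        then show ?thesis using finite_V by (simp add: card_Diff_subset card_mono)
      qed
      ultimately show ?thesis using cC bad1 two_leaves by linarith
    next
      case True
      have nw: "\<not> adj B r w" if "w \<in> W" for w
      proof -
        have "w \<notin> children r" using that noinner[of w] Wc unfolding inner_def by blast
        then show ?thesis using nbrs_root in_nbrs by metis
      qed
      have bl: "block t W r = insert r (nbrs B r - {t})" using nw by (auto simp: block_def)
      have "r \<notin> nbrs B r" using adj_neq by fastforce
      have rb: "r \<notin> bad t W" using degree_root_ge[OF inr] by (auto simp: bad_def)
      have pk: "2 * card W + card (block t W r) \<le> card ?C + card (bad t W) + 2"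
        using True rb finite_V blk unfolding W_def N_def
        by (intro packing_partial(2)[OF pe y'(4)]) auto
      show ?thesis
      proof (cases "t \<in> nbrs B r")
        case t1: True
        then have "p t = r" using tr by (auto simp: nbrs_root children_def)
        then have "bad t W = {}" using badt rb by auto
        moreover have "card (block t W r) = card (nbrs B r)"
          using t1 \<open>r \<notin> nbrs B r\<close> card_Suc_Diff1[of "nbrs B r" t] by (simp add: bl)
        ultimately show ?thesis using pk cC degree_root_ge[OF inr] by simp
      next
        case t2: False
        then have "card (block t W r) = card (nbrs B r) + 1"
          using \<open>r \<notin> nbrs B r\<close> by (simp add: bl)
        then show ?thesis using pk cC degree_root_ge[OF inr] bad1 by linarith
      qed
    qed
    then show ?thesis
      using cF unfolding W_def N_def t_def by (intro greedy_choice[OF pe y, where m = 1]) auto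
  qed
qed

end

section \<open>Hall's condition when the root carries the most leaves\<close>

locale heavy_root_core = heavy_root X A V B r p d k s v0
  for X :: "'a set" and A and V :: "'c set" and B r p d k s v0 +
  fixes f :: "'c \<Rightarrow> 'a"
  assumes nice_f: "careful_embedding (forbidden f) base core f"
    and f_root: "f r = v0"
    and major: "card (leaves_at r) < card (signed_nbrs A s v0 - f ` inner)"
    and minor: "card {y \<in> leaves_at r. B r y = (\<not> s)} + (if inner = {} then 0 else 1)
       \<le> card (signed_nbrs A (\<not> s) v0 - f ` inner)"
begin

lemma partial_f: "partial_embedding core f" and f_forbidden: "f ` core \<inter> forbidden f = {}"
  using nice_f by (auto simp: careful_embedding_def)

lemma inj_f: "inj_on f core"
  using partial_f by (rule partial_inj)

lemma f_eq_iff: "x \<in> core \<Longrightarrow> y \<in> core \<Longrightarrow> f x = f y \<longleftrightarrow> x = y"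
  using inj_f by (auto dest: inj_onD)

text \<open>The effect of the reservation: the leaves of the root compete for neighbours of
  \<open>v0\<close> only with the inner children, among all non-leaves.\<close>

lemma adj_root_image: "x \<in> core \<Longrightarrow> adj A v0 (f x) \<longleftrightarrow> x \<in> inner"
proof
  assume x: "x \<in> core" "adj A v0 (f x)"
  then have "f x \<in> f ` inner" using f_forbidden by auto
  then show "x \<in> inner" using x(1) f_eq_iff inner_iff by blast
next
  assume x: "x \<in> inner"
  then have "adj B r x"
    using adj_parent[of x] core_in_V[of x] adj_commute[of B r x] by (auto simp: inner_iff)
  then show "adj A v0 (f x)"
    using partial_adj[OF partial_f root_core, of x] x f_root by (auto simp: inner_iff)
qed

lemma avail_root: "x \<in> leaves_at r \<Longrightarrow> avail f x = signed_nbrs A (B r x) v0 - f ` inner"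
  using adj_root_image nb_adj f_root inner_iff by (fastforce simp: avail_def leaves_at_iff)

text \<open>The candidates of a single leaf of the majority sign already exceed the number of leaves
  at the root; without such a leaf only the minority count matters. The surplus of one pays for a
  candidate shared with another support.\<close>

lemma root_leaves_avail:
  assumes J: "J \<subseteq> leaves_at r" "J \<noteq> {}"
  shows "card J + (if inner = {} then 0 else 1) \<le> card (\<Union>x\<in>J. avail f x)"
proof -
  have finJ: "finite J" using finite_subset[OF J(1) finite_leaves_at] .
  have le: "card (avail f x) \<le> card (\<Union>x\<in>J. avail f x)" if "x \<in> J" for x
    using that finJ by (intro card_mono) auto
  show ?thesis
  proof (cases "\<exists>x\<in>J. B r x = s")
    case True
    then obtain x where x: "x \<in> J" "B r x = s" by blast
    have "card J \<le> card (leaves_at r)" using J by (intro card_mono) auto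
    moreover have "card (leaves_at r) < card (avail f x)" using avail_root[of x] x J major by auto
    moreover have "(if inner = {} then 0 else (1::nat)) \<le> 1" by simp
    ultimately show ?thesis using le[OF x(1)] by linarith
  next
    case False
    obtain x where x: "x \<in> J" using J by blast
    then have av: "avail f x = signed_nbrs A (\<not> s) v0 - f ` inner" using avail_root[of x] False J by auto
    have "card J \<le> card {y \<in> leaves_at r. B r y = (\<not> s)}"
      using J False by (intro card_mono) auto
    then show ?thesis
      using le_trans[OF le_trans[OF add_right_mono minor[folded av]] le[OF x]] by blast
  qed
qed

lemma leaves_add:
  assumes "J \<subseteq> leaves" "J \<inter> leaves_at r = {}"
  shows "card (leaves_at r) + card J \<le> card leaves"
proof -
  have finJ: "finite J" using finite_subset[OF assms(1) finite_leaves] .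
  have "card (leaves_at r \<union> J) = card (leaves_at r) + card J"
    using assms finJ by (intro card_Un_disjoint) auto
  moreover have "card (leaves_at r \<union> J) \<le> card leaves"
    using assms by (intro card_mono) (auto simp: leaves_at_def)
  ultimately show ?thesis by simp
qed

lemma leaves_at_add:
  assumes "t \<noteq> r"
  shows "card (leaves_at r) + card (leaves_at t) \<le> card leaves"
  using assms by (intro leaves_add) (auto simp: leaves_at_iff)

text \<open>A bad \<open>m\<close> is saturated, so its neighbourhood and that of \<open>t\<close>
  need more images of non-leaves than there are, unless one vertex lies in the reserved set. In that
  tight case they cover all images of non-leaves, and a 4-cycle through \<open>v0\<close>
  appears.\<close>

lemma no_bad:
  assumes t: "t \<in> core" "t \<noteq> r"
    and big: "k + 2 \<le> 2 * card (preimage core f (signed_nbrs A s' (f t))) + 2 * card (leaves_at t)"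
  shows "bad t (preimage core f (signed_nbrs A s' (f t))) = {}"
proof (rule ccontr)
  let ?N = "signed_nbrs A s' (f t)"
  let ?W = "preimage core f ?N"
  assume "bad t ?W \<noteq> {}"
  then obtain m where m: "m \<in> bad t ?W" by blast
  then have mc: "m \<in> core" "m \<noteq> t" and tm: "adj B t m" and fm: "f m \<in> ?N" and dm: "card (nbrs B m) = 2"
    using centre_notin_preimage by (auto simp: bad_def preimage_def)
  obtain w where w: "w \<in> core" "f w \<in> ?N" "adj B m w" using m by (auto simp: bad_def preimage_def)
  have "w \<noteq> t" using w(2) nb_adj by fastforce
  have inr: "inner \<noteq> {}" using inner_nonempty[OF t] .
  have mr: "m \<noteq> r" using degree_root_ge[OF inr] dm by auto
  have ft: "f t \<noteq> v0" "f m \<noteq> v0" "f m \<noteq> f t"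
    using f_eq_iff t mc mr root_core f_root by metis+
  \<comment> \<open>If \<open>p m = r\<close>, then the second neighbour of \<open>m\<close> is the
    root, so the image of \<open>t\<close> is adjacent to \<open>v0\<close>; but \<open>t\<close> is
    a child of \<open>m\<close>, not of the root.\<close>
  have pm: "p m \<noteq> r"
  proof
    assume pm: "p m = r"
    have ptm: "p t = m" using tm pm t by (auto simp: adj_iff)
    have "{r, t, w} \<subseteq> nbrs B m" using adj_parent[of m] mc mr pm tm w adj_sym core_in_V by fastforce
    then have "card {r, t, w} \<le> 2" using dm card_mono[of "nbrs B m" "{r, t, w}"] by simp
    then have "w = r" using t \<open>w \<noteq> t\<close> by (auto simp: card_insert_if split: if_splits)
    then have "adj A v0 (f t)" using w(2) f_root nb_adj adj_sym by metis
    then have "t \<in> inner" using adj_root_image t by blast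
    then show False using ptm mr by (simp add: inner_iff)
  qed
  obtain s2 where sat: "signed_nbrs A s2 (f m) \<subseteq> f ` core \<union> forbidden f"
    using bad_saturated[OF nice_f base_cases t(1) m mr] by auto
  let ?M = "signed_nbrs A s2 (f m)"
  let ?U = "(?M \<inter> f ` core) \<union> (?N \<inter> f ` core)"
  have cW: "card ?W = card (?N \<inter> f ` core)" by (rule card_preimage[OF partial_f])
  have cU: "card (?M \<inter> f ` core) + card ?W \<le> card ?U + 1"
    unfolding cW by (rule card_Un_common[OF ft(3)]) (auto dest: nb_adj)
  have cfc: "card (f ` core) = card core" using inj_f by (rule card_image)
  have cUc: "card ?U \<le> card core" unfolding cfc[symmetric] by (intro card_mono) auto
  have L: "card (leaves_at r) + card (leaves_at t) \<le> card leaves" using leaves_at_add[OF t(2)] .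
  have M: "k \<le> 2 * card ?M" using semidegree partial_in[OF partial_f mc(1)] by blast
  have "?M = (?M \<inter> f ` core) \<union> (?M \<inter> forbidden f)" using sat by blast
  then have Msplit: "card ?M \<le> card (?M \<inter> f ` core) + card (?M \<inter> forbidden f)"
    by (metis card_Un_le)
  have cF: "card (?M \<inter> forbidden f) \<le> 1"
    using ft by (intro card_common[of "f m" v0]) (auto dest: nb_adj)
  show False
  proof (cases "?M \<inter> forbidden f = {}")
    case True
    then have "card ?M \<le> card (?M \<inter> f ` core)" using Msplit by simp
    then show False using big cU cUc M L card_core_leaves two_leaves by linarith
  next
    case False
    then obtain z where z: "z \<in> ?M" "adj A v0 z" "z \<notin> f ` inner" by auto
    have zc: "z \<notin> f ` core" using z f_forbidden by auto
    have "card core \<le> card ?U" using big cU M Msplit cF L card_core_leaves two_leaves by linarith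
    then have Ueq: "?U = f ` core" using cfc by (intro card_seteq) auto
    obtain q where q: "q \<in> inner" using inr by blast
    have qc: "q \<in> core" and aq: "adj A v0 (f q)" using q adj_root_image inner_iff by blast+
    have "f q \<notin> ?M"
    proof
      assume "f q \<in> ?M"
      then have "f q = z" using common_nbr[OF ft(2), of "f q" z] z aq nb_adj by metis
      then show False using zc qc by blast
    qed
    then have aqt: "adj A (f t) (f q)" using Ueq qc nb_adj by fastforce
    have amt: "adj A (f t) (f m)" using fm by (rule nb_adj)
    have "v0 \<in> ?U" using Ueq root_core f_root by blast
    \<comment> \<open>Either case gives two common neighbours: \<open>z\<close> and
      \<open>f t\<close> for \<open>v0\<close> and \<open>f m\<close>, or \<open>f q\<close> and
      \<open>f m\<close> for \<open>v0\<close> and \<open>f t\<close>.\<close>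
    then consider "v0 \<in> ?N" | "v0 \<in> ?M" by blast
    then show False
    proof cases
      case 1
      then have "adj A v0 (f t)" using nb_adj adj_sym by metis
      then have "z = f t"
        using common_nbr[OF ft(2), of z "f t"] z amt nb_adj adj_sym by metis
      then show False using zc t by blast
    next
      case 2
      then have "adj A v0 (f m)" using nb_adj adj_sym by metis
      then have "f q = f m" using common_nbr[OF ft(1), of "f q" "f m"] aq aqt amt by blast
      then have "q = m" using f_eq_iff qc mc by blast
      then show False using pm q by (simp add: inner_iff)
    qed
  qed
qed

text \<open>If the root is outside the preimage, the blocks avoid the leaves at \<open>t\<close> and
  those at the root, which are at least as many. If it is inside, its share contains all its leaves
  and one more vertex. The excess of 1 over k is lost in rounding when candidates are
  counted.\<close>

lemma few_in_core:
  assumes t: "t \<in> core" "t \<noteq> r"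
  shows "2 * card (preimage core f (signed_nbrs A s' (f t))) + 2 * card (leaves_at t) \<le> k + 1"
proof (rule ccontr)
  let ?W = "preimage core f (signed_nbrs A s' (f t))"
  assume "\<not> ?thesis"
  then have big: "k + 2 \<le> 2 * card ?W + 2 * card (leaves_at t)" by simp
  have nobad: "bad t ?W = {}" by (rule no_bad[OF t big])
  have ml: "card (leaves_at t) \<le> card (leaves_at r)" using most_leaves[OF t(1)] .
  have Wc: "?W \<subseteq> core" by (auto simp: preimage_def)
  show False
  proof (cases "r \<in> ?W")
    case False
    let ?C = "V - insert t (leaves_at t) - leaves_at r"
    have "block t ?W w \<subseteq> ?C" if w: "w \<in> ?W" for w
    proof -
      have "w \<notin> leaves" "w \<noteq> r" using w Wc False by (auto simp: core_def)
      then have "x \<notin> block t ?W w" if "x \<in> leaves_at r" for x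
        using that adj_leaf[of x w] adj_commute[of B x w] by (auto simp: block_def leaves_at_iff)
      then show ?thesis using block_leaves_at[OF partial_f t(1) w] by blast
    qed
    then have "2 * card ?W \<le> card ?C + card (bad t ?W)"
      using finite_V by (intro packing_partial(1)[OF partial_f t(1)]) auto
    moreover have "card ?C + card (leaves_at r) = card (V - insert t (leaves_at t))"
    proof -
      have "leaves_at r \<subseteq> V - insert t (leaves_at t)"
        using t leaves_sub by (auto simp: leaves_at_iff core_def)
      then show ?thesis using finite_V by (simp add: card_Diff_subset card_mono)
    qed
    ultimately show False using nobad card_minus_leaves_at[OF t(1)] big ml by simp
  next
    case True
    have sub: "leaves_at r \<subseteq> nbrs B r - {t}"
      using t chl_root(1) by (auto simp: nbrs_root leaves_at_iff core_def)
    have "card (leaves_at r) + 1 \<le> card (block t ?W r)"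
    proof -
      \<comment> \<open>The extra vertex is a neighbour of the root in the preimage, or the root
        itself if there is none.\<close>
      obtain u where u: "u \<in> block t ?W r" "u \<notin> leaves_at r"
      proof (cases "\<exists>w\<in>?W. adj B r w")
        case True
        then obtain w where w: "w \<in> ?W" "adj B r w" by blast
        then have "w \<in> block t ?W r" "w \<notin> leaves_at r"
          using centre_notin_preimage Wc by (auto simp: block_def leaves_at_iff core_def)
        then show ?thesis using that by blast
      next
        case False
        then have "r \<in> block t ?W r" by (auto simp: block_def)
        moreover have "r \<notin> leaves_at r" using root_core by (auto simp: leaves_at_iff core_def)
        ultimately show ?thesis using that by blast
      qed
      have "insert u (leaves_at r) \<subseteq> block t ?W r" using u sub by (auto simp: block_def)
      moreover have "finite (block t ?W r)" by (simp add: block_def)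
      ultimately have "card (insert u (leaves_at r)) \<le> card (block t ?W r)" by (rule card_mono[rotated])
      then show ?thesis using u by simp
    qed
    moreover have "2 * card ?W + card (block t ?W r) + card (leaves_at t) \<le> k + card (bad t ?W) + 2"
      using True nobad by (intro support_packing(2)[OF partial_f t(1)]) auto
    ultimately show False using nobad big ml by simp
  qed
qed

lemma single_support:
  assumes "x \<in> leaves" "p x \<noteq> r"
  shows "card (leaves_at (p x)) \<le> card (avail f x)"
proof -
  have t: "p x \<in> core" using support_core assms by blast
  have "k \<le> 2 * card (signed_nbrs A (B (p x) x) (f (p x)))" using semidegree partial_in[OF partial_f t] by blast
  then show ?thesis
    using card_avail[OF partial_f, of x] few_in_core[OF t assms(2), of "B (p x) x"] by linarith
qed

text \<open>One support besides the root is settled by \<open>single_support\<close>, the surplus at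
  the root absorbing a shared candidate. Two such supports have neighbourhoods with at least k - 1
  vertices in their union; the only count that survives is tight and closes a 4-cycle.\<close>

lemma leaves_hall:
  assumes J: "J \<subseteq> leaves" "J \<noteq> {}"
  shows "card J \<le> card (\<Union>x\<in>J. avail f x)"
proof (rule ccontr)
  let ?S = "\<Union>x\<in>J. avail f x"
  let ?N = "\<lambda>x. signed_nbrs A (B (p x) x) (f (p x))"
  assume "\<not> ?thesis"
  then have lt: "card ?S < card J" by simp
  define J0 J1 where "J0 = J \<inter> leaves_at r" and "J1 = J - leaves_at r"
  have finJ: "finite J" using finite_subset[OF J(1) finite_leaves] .
  have finS: "finite ?S" using finJ by auto
  let ?Q = "\<Union>x\<in>J0. avail f x"
  have cJ: "card J = card J0 + card J1"
    unfolding J0_def J1_def using finJ by (subst card_Un_disjoint[symmetric]) (auto intro: arg_cong[of _ _ card])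
  have S0: "?Q \<subseteq> ?S" by (auto simp: J0_def)
  have c0: "card J0 + (if inner = {} then 0 else 1) \<le> card ?Q" if "J0 \<noteq> {}"
    using that by (intro root_leaves_avail) (auto simp: J0_def)
  have S0n: "?Q \<subseteq> nbrs A v0"
    using avail_root by (auto simp: J0_def dest: nb_adj)
  have J1p: "x \<in> leaves \<and> p x \<noteq> r \<and> p x \<in> core" if "x \<in> J1" for x
    using that J support_core by (auto simp: J1_def leaves_at_iff)
  show False
  proof (cases "J1 = {}")
    case True
    then have "J0 \<noteq> {}" using J by (auto simp: J0_def J1_def)
    then have "card J \<le> card ?Q" using c0 True cJ by simp
    then show False using card_mono[OF finS S0] lt by linarith
  next
    case False
    then obtain x where x: "x \<in> J1" by blast
    then have xl: "x \<in> leaves" "p x \<noteq> r" "p x \<in> core" "x \<in> J" using J1p by (auto simp: J1_def)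
    have inr: "inner \<noteq> {}" using inner_nonempty xl by blast
    have vx: "f (p x) \<noteq> v0" using f_eq_iff xl root_core f_root by metis
    show False
    proof (cases "\<exists>y\<in>J1. p y \<noteq> p x")
      case False
      then have "J1 \<subseteq> leaves_at (p x)" using J1p by (auto simp: leaves_at_iff)
      then have "card J1 \<le> card (leaves_at (p x))" by (intro card_mono) auto
      then have c1: "card J1 \<le> card (avail f x)" using single_support[OF xl(1,2)] by linarith
      have Sx: "avail f x \<subseteq> ?S" using xl by blast
      show False
      proof (cases "J0 = {}")
        case True
        then show False using c1 cJ lt card_mono[OF finS Sx] by simp
      next
        case J0: False
        have "avail f x \<subseteq> nbrs A (f (p x))" by (auto simp: avail_def dest: nb_adj)
        then have "card ?Q + card (avail f x) \<le> card (?Q \<union> avail f x) + 1"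
          using vx S0n by (intro card_Un_common[of v0 "f (p x)"]) auto
        moreover have "card (?Q \<union> avail f x) \<le> card ?S" using S0 Sx finS by (intro card_mono) auto
        ultimately show False using c0[OF J0] inr c1 cJ lt by simp
      qed
    next
      case True
      then obtain y where y: "y \<in> J1" "p y \<noteq> p x" by blast
      then have yl: "y \<in> leaves" "p y \<noteq> r" "p y \<in> core" "y \<in> J" using J1p by (auto simp: J1_def)
      have vy: "f (p y) \<noteq> v0" and vxy: "f (p x) \<noteq> f (p y)"
        using f_eq_iff xl yl y root_core f_root by metis+
      let ?Y = "f ` core \<union> ?S"
      have finY: "finite ?Y" using finS by simp
      have cY: "card ?Y + card leaves = k + 1 + card ?S" by (rule card_core_Un_avail[OF partial_f finJ])
      have L: "card (leaves_at r) + card J1 \<le> card leaves"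
        using J by (intro leaves_add) (auto simp: J1_def)
      have NY: "?N u \<subseteq> ?Y" if "u \<in> J" for u using nb_sub_avail[OF that] .
      have sd: "k \<le> 2 * card (?N x)" "k \<le> 2 * card (?N y)"
        using semidegree partial_in[OF partial_f] xl yl by blast+
      have NN: "k \<le> card (?N x \<union> ?N y) + 1"
        using card_Un_nb[OF vxy, of "B (p x) x" "B (p y) y"] sd by linarith
      have NNY: "card (?N x \<union> ?N y) \<le> card ?Y" using NY xl yl finY by (intro card_mono) auto
      show False
      proof (cases "J0 = {}")
        case True
        then have "card J0 = 0" by simp
        then show False using NN NNY cY L lt cJ two_leaves by linarith
      next
        case J0: False
        have cS0: "card J0 + 1 \<le> card ?Q" using c0[OF J0] inr by simp
        have fin0: "finite ?Q" using S0 finS finite_subset by blast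
        have i1: "card (?Q \<inter> ?N x) \<le> 1" "card (?Q \<inter> ?N y) \<le> 1"
          by (rule card_common[OF vx[symmetric] S0n nb_sub_nbrs], rule card_common[OF vy[symmetric] S0n nb_sub_nbrs])
        have "?Q \<inter> (?N x \<union> ?N y) = (?Q \<inter> ?N x) \<union> (?Q \<inter> ?N y)" by blast
        then have i2: "card (?Q \<inter> (?N x \<union> ?N y)) \<le> card (?Q \<inter> ?N x) + card (?Q \<inter> ?N y)"
          by (metis card_Un_le)
        let ?T = "?Q \<union> (?N x \<union> ?N y)"
        have TY: "?T \<subseteq> ?Y" using S0 NY xl yl by blast
        have cT: "card ?Q + card (?N x \<union> ?N y) = card ?T + card (?Q \<inter> (?N x \<union> ?N y))"
          using fin0 by (intro card_Un_Int) auto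
        have cTY: "card ?T \<le> card ?Y" by (rule card_mono[OF finY TY])
        \<comment> \<open>\<open>?T\<close> has at least (k - 1) + (|J0| + 1) - 2 vertices and
          \<open>?Y\<close> at most k - 2 + |J0|, so all bounds used are equalities.\<close>
        have eqs: "card ?Y \<le> card ?T" "card (?Q \<inter> ?N x) = 1" "card (?Q \<inter> ?N y) = 1"
          using cT cTY i1 i2 cS0 NN cY L lt cJ two_leaves by linarith+
        have T: "?T = ?Y" using TY finY eqs(1) by (intro card_seteq) auto
        obtain a where a: "a \<in> ?Q" "a \<in> ?N x" using eqs(2) by (metis Int_iff card_1_singletonE insertI1)
        obtain b where b: "b \<in> ?Q" "b \<in> ?N y" using eqs(3) by (metis Int_iff card_1_singletonE insertI1)
        have S0c: "u \<notin> f ` core" if "u \<in> ?Q" for u using that by (auto simp: avail_def)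
        have inT: "u \<in> ?N x \<or> u \<in> ?N y" if "u \<in> f ` core" for u using that T S0c by blast
        have a0: "adj A v0 a" "adj A v0 b" using a b S0n by auto
        have "f (p x) \<notin> ?N x" using nb_adj by fastforce
        then have "f (p x) \<in> ?N y" using inT xl by blast
        then have xy: "adj A (f (p y)) (f (p x))" by (rule nb_adj)
        \<comment> \<open>The images of the two supports are adjacent. The one adjacent to
          \<open>v0\<close> is a common neighbour of \<open>v0\<close> and the other image, next to
          \<open>a\<close> or \<open>b\<close>.\<close>
        have "v0 \<in> ?N x \<or> v0 \<in> ?N y" using inT root_core f_root by blast
        then show False
        proof
          assume "v0 \<in> ?N x"
          then have "b = f (p x)"
            using common_nbr[OF vy, of b "f (p x)"] xy a0 b nb_adj adj_sym by metis
          then show False using S0c b xl by blast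
        next
          assume "v0 \<in> ?N y"
          then have "a = f (p y)"
            using common_nbr[OF vx, of a "f (p y)"] xy a0 a nb_adj adj_sym by metis
          then show False using S0c a yl by blast
        qed
      qed
    qed
  qed
qed

end

context heavy_root
begin

lemma embeds_if_heavy_root: "\<exists>g. inj_on g V \<and> g ` V \<subseteq> X \<and> (\<forall>x y. B x y \<longrightarrow> A (g x) (g y))"
proof -
  obtain g where g: "inj_on g inner" "\<forall>y\<in>inner. g y \<in> signed_nbrs A (B r y) v0"
    "card (leaves_at r) < card (signed_nbrs A s v0 - g ` inner)"
    "card {y \<in> leaves_at r. B r y = (\<not> s)} + (if inner = {} then 0 else 1)
       \<le> card (signed_nbrs A (\<not> s) v0 - g ` inner)"
    using place_inner by blast
  have "\<exists>f. careful_embedding (forbidden g) base core f \<and> (\<forall>x\<in>base. f x = (g(r := v0)) x)"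
    by (rule nice_complete[OF nice_base[OF g(1,2)]]) (use nice_step in auto)
  then obtain f where f: "careful_embedding (forbidden g) base core f" "\<forall>x\<in>base. f x = (g(r := v0)) x" by blast
  have "f ` inner = g ` inner" "f r = v0" using f(2) by (auto simp: inner_iff)
  then interpret heavy_root_core X A V B r p d k s v0 f
    using f g by unfold_locales auto
  show ?thesis by (rule embeds_if_hall[OF partial_f leaves_hall])
qed

end

section \<open>Paths\<close>

text \<open>\<open>P\<close> and \<open>Q\<close> stand for the positions on a path that are
  adjacent to its last and to its last but one vertex; the exclusions express that no 4-cycle
  arises. At most one position is unmarked, and below it the marks are constant, which soon violates
  an exclusion.\<close>

lemma two_marks_False:
  fixes P Q :: "nat set"
  assumes P: "P \<subseteq> {..<n}" "k \<le> 2 * card P + 2" and Q: "Q \<subseteq> {..<n}" "k \<le> 2 * card Q + 2"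
    and k: "5 \<le> k" "n + 2 \<le> k"
    and PQ: "\<And>l. l \<in> P \<Longrightarrow> Suc l \<notin> Q" "\<And>l. l \<in> Q \<Longrightarrow> Suc l \<notin> P"
    and PP: "\<And>l. l \<in> P \<Longrightarrow> Suc (Suc l) \<notin> P" and QQ: "\<And>l. l \<in> Q \<Longrightarrow> Suc (Suc l) \<notin> Q"
    and common: "card (P \<inter> Q) \<le> 1" and top: "n - 1 \<in> Q"
  shows False
proof -
  have fin: "finite P" "finite Q" using P Q finite_subset by blast+
  have c2: "2 \<le> card P" "2 \<le> card Q" using P Q k by linarith+
  have "card P + card Q \<le> card (P \<union> Q) + 1" using card_Un_Int[OF fin] common by linarith
  then have cu: "n \<le> card (P \<union> Q) + 1" using P Q k by linarith
  have cov: "l \<in> P \<or> l \<in> Q" if "l < n" "m < n" "m \<notin> P" "m \<notin> Q" "l \<noteq> m" for l m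
  proof (rule ccontr)
    assume "\<not> (l \<in> P \<or> l \<in> Q)"
    then have "P \<union> Q \<subseteq> {..<n} - {l, m}" using that P Q by auto
    then have "card (P \<union> Q) \<le> card ({..<n} - {l, m})" by (intro card_mono) auto
    also have "\<dots> = n - 2" using that by (subst card_Diff_subset) auto
    finally show False using cu that by linarith
  qed
  \<comment> \<open>On a fully marked initial segment the two rules \<open>PQ\<close> carry each
    mark to the next position and back.\<close>
  have spread: "(l \<in> P \<longleftrightarrow> 0 \<in> P) \<and> (l \<in> Q \<longleftrightarrow> 0 \<in> Q)"
    if cv: "\<forall>j<m. j \<in> P \<or> j \<in> Q" and lm: "l < m" for l m
    using lm
  proof (induction l)
    case (Suc l)
    then show ?case using cv PQ[of l] by (meson Suc_lessD)
  qed simp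
  have "card P \<le> n" using card_mono[OF _ P(1)] by simp
  then have "n = 2 \<or> 3 \<le> n" using c2 by linarith
  then show False
  proof
    assume n: "n = 2"
    have "P = {..<n}" by (rule card_seteq[OF _ P(1)]) (use n c2 in auto)
    moreover have "Q = {..<n}" by (rule card_seteq[OF _ Q(1)]) (use n c2 in auto)
    ultimately show False using PQ(1)[of 0] n by auto
  next
    assume n: "3 \<le> n"
    have s1: "Suc (n - 2) = n - 1" "Suc (Suc (n - 3)) = n - 1" "Suc (n - 3) = n - 2" using n by auto
    have n2: "n - 2 \<notin> P" using PQ(1)[of "n - 2"] top s1 by auto
    have n3: "n - 3 \<notin> Q" using QQ[of "n - 3"] top s1 by auto
    show False
    \<comment> \<open>The unmarked position is \<open>n - 3\<close> in the first case and
      \<open>n - 2\<close> in the second.\<close>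
    proof (cases "n - 2 \<in> Q")
      case True
      have n3P: "n - 3 \<notin> P" using PQ(1)[of "n - 3"] True s1 by auto
      have n1: "n - 1 \<notin> P" using PQ(2)[of "n - 2"] True s1 by auto
      have sub: "P \<subseteq> {..<n - 3}"
      proof
        fix l assume l: "l \<in> P"
        then have "l < n" "l \<noteq> n - 1" "l \<noteq> n - 2" "l \<noteq> n - 3" using P n1 n2 n3P by auto
        then show "l \<in> {..<n - 3}" using n by auto
      qed
      then have "card P \<le> n - 3" using card_mono[OF _ sub] by simp
      then have "7 \<le> k" using c2 k by linarith
      then have c3: "3 \<le> card P" using P by linarith
      then have m: "2 < n - 3" using \<open>card P \<le> n - 3\<close> by linarith
      have cv: "\<forall>j<n - 3. j \<in> P \<or> j \<in> Q" using cov[of _ "n - 3"] n n3 n3P by auto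
      obtain l where "l \<in> P" using c3 by fastforce
      then have "0 \<in> P" using spread[OF cv, of l] sub by auto
      moreover have "2 \<in> P" using spread[OF cv, of 2] m calculation by auto
      ultimately show False using PP[of 0] by (simp add: numeral_2_eq_2)
    next
      case False
      have cv: "\<forall>j<n - 2. j \<in> P \<or> j \<in> Q" using cov[of _ "n - 2"] n n2 False by auto
      have ex: "\<exists>l\<in>R. l < n - 2" if R: "R \<subseteq> {..<n}" "2 \<le> card R" "n - 2 \<notin> R" for R
      proof (rule ccontr)
        assume no: "\<not> ?thesis"
        have "R \<subseteq> {n - 1}"
        proof
          fix l assume l: "l \<in> R"
          then have "l < n" "\<not> l < n - 2" "l \<noteq> n - 2" using no R by auto
          then show "l \<in> {n - 1}" by auto
        qed
        then have "card R \<le> 1" using card_mono[of "{n - 1}" R] by simp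
        then show False using R by simp
      qed
      obtain l l' where "l \<in> P" "l < n - 2" "l' \<in> Q" "l' < n - 2"
        using ex[OF P(1) c2(1) n2] ex[OF Q(1) c2(2) False] by blast
      then have zero: "0 \<in> P" "0 \<in> Q" using spread[OF cv, of l] spread[OF cv, of l'] by auto
      show False
      proof (cases "n = 3")
        case True
        have "P \<subseteq> {0}"
        proof
          fix l assume l: "l \<in> P"
          then have "l < 3" "l \<noteq> 1" "l \<noteq> 2"
            using P True n2 PP[OF zero(1)] by (auto simp: numeral_2_eq_2)
          then show "l \<in> {0}" by auto
        qed
        then show False using c2 card_mono[of "{0}" P] by simp
      next
        case False
        then have "1 \<in> Q" using spread[OF cv, of 1] zero n by auto
        then show False using PQ(1)[OF zero(1)] by simp
      qed
    qed
  qed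
qed

section \<open>Oriented paths of given length\<close>

context c4_free_digraph
begin

text \<open>Despite the name these are paths, with distinct vertices; \<open>\<sigma>\<close>
  prescribes the direction of each arc.\<close>

definition walks :: "(nat \<Rightarrow> bool) \<Rightarrow> nat \<Rightarrow> (nat \<Rightarrow> 'a) \<Rightarrow> bool" where
  "walks \<sigma> i x \<longleftrightarrow> inj_on x {..i} \<and> x ` {..i} \<subseteq> X \<and> (\<forall>j<i. x (Suc j) \<in> signed_nbrs A (\<sigma> j) (x j))"

lemma walks_extend:
  assumes "walks \<sigma> i x" "z \<in> signed_nbrs A (\<sigma> i) (x i)" "z \<notin> x ` {..i}"
  shows "walks \<sigma> (Suc i) (x(Suc i := z))"
proof -
  have "inj_on (x(Suc i := z)) {..Suc i}"
    using assms unfolding walks_def atMost_Suc by (auto simp: inj_on_def)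
  moreover have "z \<in> X" using assms(2) nb_sub by blast
  ultimately show ?thesis using assms unfolding walks_def by (auto simp: less_Suc_eq atMost_Suc)
qed

lemma walks_replace_last:
  assumes "walks \<sigma> (Suc j) x" "z \<in> signed_nbrs A (\<sigma> j) (x j)" "z \<notin> x ` {..j}"
  shows "walks \<sigma> (Suc j) (x(Suc j := z))"
proof -
  have "walks \<sigma> j x" using assms(1) unfolding walks_def
    by (auto intro: inj_on_subset simp: atMost_Suc less_Suc_eq)
  then show ?thesis using walks_extend assms by blast
qed

lemma walks_adj: "walks \<sigma> i x \<Longrightarrow> j < i \<Longrightarrow> adj A (x j) (x (Suc j))"
  by (auto simp: walks_def dest: nb_adj)

lemma walks_eq: "walks \<sigma> i x \<Longrightarrow> j \<le> i \<Longrightarrow> l \<le> i \<Longrightarrow> x j = x l \<longleftrightarrow> j = l"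
  by (auto simp: walks_def dest: inj_onD)

text \<open>The longer path need not extend the given one, since its last vertex may first be
  exchanged. If all these paths are stuck, then either the neighbourhoods of two possible last
  vertices fill the rest of the path, or the last two vertices have their neighbours on it and
  \<open>two_marks_False\<close> applies.\<close>

lemma walks_step:
  assumes k: "5 \<le> k" and sd: "\<And>v s. v \<in> X \<Longrightarrow> k \<le> 2 * card (signed_nbrs A s v)"
    and w: "walks \<sigma> i x" and i: "i < k"
  shows "\<exists>x. walks \<sigma> (Suc i) x"
proof (rule ccontr)
  assume no: "\<not> ?thesis"
  have stuck: "signed_nbrs A (\<sigma> i) (y i) \<subseteq> y ` {..<i}" if "walks \<sigma> i y" for y
  proof
    fix z assume z: "z \<in> signed_nbrs A (\<sigma> i) (y i)"
    then have "z \<in> y ` {..i}" using no walks_extend[OF that] by blast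
    moreover have "z \<noteq> y i" using nb_adj[OF z] by auto
    ultimately show "z \<in> y ` {..<i}" by (auto simp: le_less)
  qed
  have xX: "x l \<in> X" if "l \<le> i" for l using w that by (auto simp: walks_def)
  have c3: "3 \<le> card (signed_nbrs A s v)" if "v \<in> X" for s v using sd[OF that, of s] k by linarith
  have "i \<noteq> 0"
  proof
    assume "i = 0"
    then have "signed_nbrs A (\<sigma> i) (x i) = {}" using stuck[OF w] by simp
    then show False using c3[OF xX[OF le_refl], of "\<sigma> i"] by simp
  qed
  then obtain n where n: "i = Suc n" by (meson not0_implies_Suc)
  have w': "walks \<sigma> (Suc n) x" using w n by simp
  let ?v = "x i" and ?u = "x n"
  let ?N = "signed_nbrs A (\<sigma> i) ?v" and ?M = "signed_nbrs A (\<sigma> n) ?u"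
  have N: "?N \<subseteq> x ` {..n}" using stuck[OF w] n by (simp add: lessThan_Suc_atMost)
  have uv: "adj A ?u ?v" using walks_adj[OF w, of n] n by simp
  show False
  proof (cases "\<exists>y\<in>?M - x ` {..n}. y \<noteq> ?v")
    case True
    then obtain y where y: "y \<in> ?M" "y \<notin> x ` {..n}" "y \<noteq> ?v" by blast
    have wy: "walks \<sigma> i (x(i := y))" using walks_replace_last[OF w' y(1,2)] n by simp
    have "(x(i := y)) ` {..<i} = x ` {..n}" using n by (auto simp: image_def less_Suc_eq_le)
    then have N2: "signed_nbrs A (\<sigma> i) y \<subseteq> x ` {..n}" using stuck[OF wy] by simp
    have yX: "y \<in> X" using y(1) nb_sub by blast
    have "card (x ` {..n}) \<le> Suc n" using card_image_le[of "{..n}" x] by simp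
    moreover have "card (?N \<union> signed_nbrs A (\<sigma> i) y) \<le> card (x ` {..n})" using N N2 by (intro card_mono) auto
    moreover have "k \<le> card (?N \<union> signed_nbrs A (\<sigma> i) y) + 1"
      using card_Un_nb[OF y(3)[symmetric], of "\<sigma> i" "\<sigma> i"] sd[OF xX, of i "\<sigma> i"] sd[OF yX, of "\<sigma> i"] by simp
    \<comment> \<open>At least k - 1 vertices lie among at most \<open>Suc n = i\<close> ones, and i
      < k; hence equality throughout.\<close>
    ultimately have ik: "k = Suc i" "card (x ` {..n}) \<le> card (?N \<union> signed_nbrs A (\<sigma> i) y)"
      using i n by linarith+
    have cov: "?N \<union> signed_nbrs A (\<sigma> i) y = x ` {..n}" using N N2 ik(2) by (intro card_seteq) auto
    \<comment> \<open>\<open>x m\<close> and \<open>x n\<close> already share the neighbour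
      \<open>x (Suc m)\<close>; an edge from \<open>x m\<close> to \<open>?v\<close> or to
      \<open>y\<close> would create a second one.\<close>
    define m where "m = n - 2"
    have m: "n = Suc (Suc m)" using ik k n by (simp add: m_def)
    have a1: "adj A (x m) (x (Suc m))" using walks_adj[OF w, of m] n m by simp
    have a2: "adj A ?u (x (Suc m))" using walks_adj[OF w, of "Suc m"] n m adj_sym by fastforce
    have ne: "x m \<noteq> ?u" using walks_eq[OF w, of m n] n m by simp
    have "x m \<in> x ` {..n}" using m by simp
    then have "x m \<in> ?N \<or> x m \<in> signed_nbrs A (\<sigma> i) y" using cov by blast
    then show False
    proof
      assume "x m \<in> ?N"
      then have "adj A (x m) ?v" by (intro adj_sym[of A ?v]) (rule nb_adj)
      then have "x (Suc m) = ?v" using common_nbr[OF ne a1 a2] uv by blast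
      then show False using walks_eq[OF w, of "Suc m" i] n m by simp
    next
      assume "x m \<in> signed_nbrs A (\<sigma> i) y"
      then have "adj A (x m) y" by (intro adj_sym[of A y]) (rule nb_adj)
      then have "x (Suc m) = y" using common_nbr[OF ne a1 a2] nb_adj[OF y(1)] by blast
      then show False using y(2) m by auto
    qed
  next
    case False
    let ?P = "{l. l < n \<and> adj A ?v (x l)}" and ?Q = "{l. l < n \<and> adj A ?u (x l)}"
    have ne: "x l \<noteq> ?v" "x l \<noteq> ?u" if "l < n" for l
      using walks_eq[OF w, of l i] walks_eq[OF w, of l n] that n by simp_all
    have inj: "x l = x l' \<longleftrightarrow> l = l'" if "l < n" "l' < n" for l l'
      using walks_eq[OF w, of l l'] that n by simp
    have adjs: "adj A (x l) (x (Suc l))" "adj A (x (Suc l)) (x l)" if "l < n" for l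
      using walks_adj[OF w, of l] that n adj_sym by fastforce+
    have "?N \<subseteq> insert ?u (x ` ?P)"
    proof
      fix z assume z: "z \<in> ?N"
      then obtain l where l: "l \<le> n" "z = x l" using N by auto
      then show "z \<in> insert ?u (x ` ?P)" using nb_adj[OF z] by (cases "l = n") auto
    qed
    then have "card ?N \<le> card (insert ?u (x ` ?P))" by (intro card_mono) auto
    also have "\<dots> \<le> Suc (card (x ` ?P))" by (simp add: card_insert_if)
    also have "card (x ` ?P) \<le> card ?P" by (intro card_image_le) auto
    finally have cP: "k \<le> 2 * card ?P + 2" using sd[OF xX, of i "\<sigma> i"] by simp
    have "?M \<subseteq> insert ?v (x ` ?Q)"
    proof
      fix z assume z: "z \<in> ?M"
      show "z \<in> insert ?v (x ` ?Q)"
      proof (cases "z = ?v")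
        case False2: False
        then obtain l where l: "l \<le> n" "z = x l" using z False by auto
        moreover have "l \<noteq> n" using nb_adj[OF z] l by auto
        ultimately show ?thesis using nb_adj[OF z] by auto
      qed simp
    qed
    then have "card ?M \<le> card (insert ?v (x ` ?Q))" by (intro card_mono) auto
    also have "\<dots> \<le> Suc (card (x ` ?Q))" by (simp add: card_insert_if)
    also have "card (x ` ?Q) \<le> card ?Q" by (intro card_image_le) auto
    finally have cQ: "k \<le> 2 * card ?Q + 2" using sd[OF xX, of n "\<sigma> n"] n by simp
    have "n \<noteq> 0"
    proof
      assume "n = 0"
      then have "?P = {}" by simp
      then have "card ?P = 0" by (simp only: card.empty)
      then show False using cP k by linarith
    qed
    show False
    proof (rule two_marks_False[OF _ cP _ cQ k])
      show "?P \<subseteq> {..<n}" "?Q \<subseteq> {..<n}" by auto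
      show "n + 2 \<le> k" using i n by simp
      show "Suc l \<notin> ?Q" if "l \<in> ?P" for l
      proof
        assume q: "Suc l \<in> ?Q"
        have "x l = ?u"
          using that q common_nbr[of ?v "x (Suc l)" "x l" ?u] ne[of "Suc l"] adjs[of l] adj_sym[OF uv]
            adj_sym[of A ?u "x (Suc l)"] by auto
        then show False using ne that by auto
      qed
      show "Suc l \<notin> ?P" if "l \<in> ?Q" for l
      proof
        assume q: "Suc l \<in> ?P"
        have "x l = ?v"
          using that q common_nbr[of ?u "x (Suc l)" "x l" ?v] ne[of "Suc l"] adjs[of l] uv
            adj_sym[of A ?v "x (Suc l)"] by auto
        then show False using ne that by auto
      qed
      show "Suc (Suc l) \<notin> ?P" if "l \<in> ?P" for l
      proof
        assume q: "Suc (Suc l) \<in> ?P"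
        have "x l = x (Suc (Suc l))"
          using that q common_nbr[of ?v "x (Suc l)" "x l" "x (Suc (Suc l))"] ne[of "Suc l"] adjs[of l] adjs[of "Suc l"]
          by auto
        then show False using inj q that by auto
      qed
      show "Suc (Suc l) \<notin> ?Q" if "l \<in> ?Q" for l
      proof
        assume q: "Suc (Suc l) \<in> ?Q"
        have "x l = x (Suc (Suc l))"
          using that q common_nbr[of ?u "x (Suc l)" "x l" "x (Suc (Suc l))"] ne[of "Suc l"] adjs[of l] adjs[of "Suc l"]
          by auto
        then show False using inj q that by auto
      qed
      have vu: "?v \<noteq> ?u" using walks_eq[OF w, of i n] n by simp
      have "l = l'" if "l \<in> ?P \<inter> ?Q" "l' \<in> ?P \<inter> ?Q" for l l'
        using that common_nbr[OF vu, of "x l" "x l'"] inj[of l l'] by auto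
      then show "card (?P \<inter> ?Q) \<le> 1" by (subst One_nat_def, subst card_le_Suc0_iff_eq) auto
      show "n - 1 \<in> ?Q" using \<open>n \<noteq> 0\<close> adjs(2)[of "n - 1"] by simp
    qed
  qed
qed

lemma walks_nth:
  assumes "distinct xs" "set xs \<subseteq> X" "length xs = Suc k"
    and "\<And>j. j < k \<Longrightarrow> xs ! Suc j \<in> signed_nbrs A (\<sigma> j) (xs ! j)"
  shows "\<exists>x. walks \<sigma> k x"
proof -
  have "inj_on ((!) xs) {..k}" using assms by (intro inj_on_nth) auto
  then have "walks \<sigma> k ((!) xs)" using assms nth_mem unfolding walks_def by fastforce
  then show ?thesis by blast
qed

lemma avoid_few:
  assumes "card F < card (signed_nbrs A s v)" "finite F"
  obtains z where "z \<in> signed_nbrs A s v" "z \<notin> F"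
  using assms card_mono[of F "signed_nbrs A s v"] by (metis leD subsetI)

lemma walks_exist:
  assumes sd: "\<And>v s. v \<in> X \<Longrightarrow> k \<le> 2 * card (signed_nbrs A s v)" and X: "X \<noteq> {}"
    and big: "\<And>s. 2 \<le> k \<Longrightarrow> \<exists>v\<in>X. 3 \<le> card (signed_nbrs A s v)"
  shows "\<exists>x. walks \<sigma> k x"
proof -
  obtain v0 where v0: "v0 \<in> X" using X by blast
  have w0: "walks \<sigma> 0 (\<lambda>_. v0)" using v0 by (simp add: walks_def)
  have inX: "z \<in> X" if "z \<in> signed_nbrs A s v" for z s v using that nb_sub by blast
  have ne: "z \<noteq> v" if "z \<in> signed_nbrs A s v" for z s v using nb_adj[OF that] by auto
  have flip: "v \<in> signed_nbrs A s z" if "z \<in> signed_nbrs A (\<not> s) v" for z s v using that nb_flip[of z A "\<not> s" v] by simp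
  consider "k = 0" | "k = 1" | "k = 2" | "k = 3" | "k = 4" | "5 \<le> k" by linarith
  then show ?thesis
  proof cases
    case 1
    then show ?thesis using w0 by blast
  next
    case 2
    have "card {v0} = 1" by simp
    obtain z where z: "z \<in> signed_nbrs A (\<sigma> 0) v0" using sd[OF v0, of "\<sigma> 0"] 2 by fastforce
    show ?thesis unfolding 2
      by (rule walks_nth[of "[v0, z]"]) (use z v0 inX ne[OF z] in auto)
  next
    case 3
    obtain v where v: "v \<in> X" "3 \<le> card (signed_nbrs A (\<sigma> 1) v)" using big 3 by blast
    obtain x0 where x0: "x0 \<in> signed_nbrs A (\<not> \<sigma> 0) v" using sd[OF v(1), of "\<not> \<sigma> 0"] 3 by fastforce
    obtain x2 where x2: "x2 \<in> signed_nbrs A (\<sigma> 1) v" "x2 \<notin> {x0}"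
      by (rule avoid_few[of "{x0}" "\<sigma> 1" v]) (use v in auto)
    show ?thesis unfolding 3
      by (rule walks_nth[of "[x0, v, x2]"])
        (use x0 x2 v inX ne[OF x0] ne[OF x2(1)] flip in \<open>auto simp: less_Suc_eq numeral_2_eq_2\<close>)
  next
    case 4
    obtain v where v: "v \<in> X" "3 \<le> card (signed_nbrs A (\<sigma> 1) v)" using big 4 by fastforce
    let ?M = "signed_nbrs A (\<not> \<sigma> 0) v"
    have M2: "2 \<le> card ?M" using sd[OF v(1), of "\<not> \<sigma> 0"] 4 by simp
    \<comment> \<open>Two choices for \<open>x0\<close> are kept besides \<open>x2\<close>, so that
      \<open>x3\<close> can be avoided as well.\<close>
    obtain x2 where x2: "x2 \<in> signed_nbrs A (\<sigma> 1) v" "2 \<le> card (?M - {x2})"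
    proof (cases "3 \<le> card ?M")
      case True
      obtain z where z: "z \<in> signed_nbrs A (\<sigma> 1) v" using v by fastforce
      have "2 \<le> card (?M - {z})" using True by (auto simp: card_Diff_singleton_if)
      then show ?thesis using that z by blast
    next
      case False
      then obtain z where "z \<in> signed_nbrs A (\<sigma> 1) v" "z \<notin> ?M"
        using avoid_few[of ?M "\<sigma> 1" v] v by auto
      then show ?thesis using that M2 by simp
    qed
    have "2 \<le> card (signed_nbrs A (\<sigma> 2) x2)" using sd[OF inX[OF x2(1)], of "\<sigma> 2"] 4 by simp
    then obtain x3 where x3: "x3 \<in> signed_nbrs A (\<sigma> 2) x2" "x3 \<notin> {v}"
      using avoid_few[of "{v}" "\<sigma> 2" x2] by auto
    have "\<not> ?M - {x2} \<subseteq> {x3}" using x2(2) card_mono[of "{x3}" "?M - {x2}"] by auto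
    then obtain x0 where x0: "x0 \<in> ?M" "x0 \<noteq> x2" "x0 \<noteq> x3" by blast
    show ?thesis unfolding 4
      by (rule walks_nth[of "[x0, v, x2, x3]"])
        (use x0 x2 x3 v inX ne[OF x0(1)] ne[OF x2(1)] ne[OF x3(1)] flip
          in \<open>auto simp: less_Suc_eq numeral_2_eq_2 numeral_3_eq_3\<close>)
  next
    case 5
    obtain v where v: "v \<in> X" "3 \<le> card (signed_nbrs A (\<sigma> 2) v)" using big 5 by fastforce
    have two: "2 \<le> card (signed_nbrs A s u)" if "u \<in> X" for s u using sd[OF that, of s] 5 by simp
    obtain x1 where x1: "x1 \<in> signed_nbrs A (\<not> \<sigma> 1) v" using two[OF v(1), of "\<not> \<sigma> 1"] by fastforce
    \<comment> \<open>Choosing \<open>x3\<close> outside this set makes it non-adjacent to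
      \<open>x1\<close>, which separates \<open>x0\<close> from \<open>x3\<close> and
      \<open>x4\<close> from \<open>x1\<close>. As \<open>v\<close> is the only common neighbour of
      \<open>x1\<close> and \<open>x3\<close>, also \<open>x0\<close> and \<open>x4\<close>
      differ.\<close>
    let ?F = "insert x1 (nbrs A v \<inter> nbrs A x1)"
    have "card (nbrs A v \<inter> nbrs A x1) \<le> 1"
      by (rule card_common[OF ne[OF x1, symmetric] subset_refl subset_refl])
    then have "card ?F < card (signed_nbrs A (\<sigma> 2) v)" using v(2) by (simp add: card_insert_if)
    then obtain x3 where x3: "x3 \<in> signed_nbrs A (\<sigma> 2) v" "x3 \<notin> ?F" by (rule avoid_few) auto
    have na: "\<not> adj A x1 x3" using x3 nb_adj[OF x3(1)] by auto
    have x1X: "x1 \<in> X" and x3X: "x3 \<in> X" using inX x1 x3 by blast+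
    obtain x0 where x0: "x0 \<in> signed_nbrs A (\<not> \<sigma> 0) x1" "x0 \<notin> {v}"
      by (rule avoid_few[of "{v}" "\<not> \<sigma> 0" x1]) (use two[OF x1X, of "\<not> \<sigma> 0"] in auto)
    obtain x4 where x4: "x4 \<in> signed_nbrs A (\<sigma> 3) x3" "x4 \<notin> {v}"
      by (rule avoid_few[of "{v}" "\<sigma> 3" x3]) (use two[OF x3X, of "\<sigma> 3"] in auto)
    have "x0 \<noteq> x3" "x4 \<noteq> x1" using na nb_adj[OF x0(1)] nb_adj[OF x4(1)] adj_sym by metis+
    moreover have "x0 \<noteq> x4"
    proof
      assume "x0 = x4"
      then have "x0 = v"
        using common_nbr[of x1 x3 x0 v] x3(2) nb_adj[OF x0(1)] nb_adj[OF x4(1)]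
          adj_sym[OF nb_adj[OF x1]] adj_sym[OF nb_adj[OF x3(1)]] by auto
      then show False using x0 by simp
    qed
    ultimately show ?thesis unfolding 5
      by (intro walks_nth[of "[x0, x1, v, x3, x4]"])
        (use x0 x1 x3 x4 v inX ne[OF x0(1)] ne[OF x1] ne[OF x3(1)] ne[OF x4(1)] flip
          in \<open>auto simp: less_Suc_eq numeral_2_eq_2 numeral_3_eq_3 eval_nat_numeral\<close>)
  next
    case 6
    have "\<exists>x. walks \<sigma> i x" if "i \<le> k" for i
      using that
    proof (induction i)
      case 0
      then show ?case using w0 by blast
    next
      case (Suc i)
      then show ?case using walks_step[OF 6 sd, of \<sigma> i] by auto
    qed
    then show ?thesis by blast
  qed
qed

end

section \<open>Trees of maximum degree at most two\<close>

context rooted_tree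
begin

lemma depth_inj_if_path:
  assumes deg: "\<And>x. x \<in> V \<Longrightarrow> card (nbrs B x) \<le> 2" and r: "card (nbrs B r) \<le> 1"
  shows "x \<in> V \<Longrightarrow> y \<in> V \<Longrightarrow> d x = d y \<Longrightarrow> x = y"
proof (induction "d x" arbitrary: x y rule: less_induct)
  case less
  show ?case
  proof (cases "x = r \<or> y = r")
    case True
    then show ?thesis using depth_eq_root less.prems by metis
  next
    case False
    then have "d (p x) = d (p y)" "d (p x) < d x" "p x \<in> V" "p y \<in> V"
      using less.prems depth[of x] depth[of y] parent_in by auto
    then have "p x = p y" using less.hyps by blast
    then have xy: "x \<in> children (p x)" "y \<in> children (p x)" using less.prems False by (auto simp: children_def)
    have "card (children (p x)) \<le> 1"
      using degree_eq[OF \<open>p x \<in> V\<close>] deg[OF \<open>p x \<in> V\<close>] r by (cases "p x = r") auto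
    then show ?thesis using xy card_le_Suc0_iff_eq[OF finite_chl, of "p x"] by auto
  qed
qed

text \<open>Each vertex has at most one child, so depth is injective; relative depths are closed
  under predecessors and hence form an initial segment.\<close>

lemma depth_enumerates_path:
  assumes deg: "\<And>x. x \<in> V \<Longrightarrow> card (nbrs B x) \<le> 2" and r: "card (nbrs B r) \<le> 1"
    and k: "card V = Suc k"
  shows "bij_betw (\<lambda>x. d x - d r) V {..k}"
proof -
  let ?e = "\<lambda>x. d x - d r"
  have inj: "inj_on ?e V"
    using depth_inj_if_path[OF deg r] root_depth_le by (auto intro!: inj_onI simp: eq_diff_iff)
  have down: "n \<in> ?e ` V" if h: "Suc n \<in> ?e ` V" for n
  proof -
    obtain x where x: "x \<in> V" "Suc n = d x - d r" using h by (elim imageE)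
    then have "x \<noteq> r" by auto
    then have "p x \<in> V" "d (p x) - d r = n" using x parent_in depth[of x] by auto
    then show ?thesis by blast
  qed
  let ?m = "Max (?e ` V)"
  have fin: "finite (?e ` V)" using finite_V by simp
  have "?m \<in> ?e ` V" using fin root_in by (intro Max_in) auto
  then have "?m - j \<in> ?e ` V" for j
  proof (induction j)
    case (Suc j)
    then show ?case using down[of "?m - Suc j"] by (cases "?m - j") (auto simp: Suc_diff_Suc)
  qed simp
  then have "{..?m} \<subseteq> ?e ` V" by (metis atMost_iff diff_diff_cancel subsetI)
  moreover have "?e ` V \<subseteq> {..?m}" using fin by auto
  ultimately obtain m where im: "?e ` V = {..m}" by blast
  have "card V = card {..m}" using card_image[OF inj] im by simp
  then have "m = k" using k by simp
  then show ?thesis using im inj by (simp add: bij_betw_def)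
qed

end

lemma (in c4_free_digraph) embeds_if_path:
  assumes "rooted_tree V B r p d" and k: "card V = Suc k"
    and deg: "\<And>x. x \<in> V \<Longrightarrow> card (nbrs B x) \<le> 2" and r: "card (nbrs B r) \<le> 1"
    and sd: "\<And>v s. v \<in> X \<Longrightarrow> k \<le> 2 * card (signed_nbrs A s v)" and X: "X \<noteq> {}"
    and big: "\<And>s. 2 \<le> k \<Longrightarrow> \<exists>v\<in>X. 3 \<le> card (signed_nbrs A s v)"
  shows "\<exists>g. inj_on g V \<and> g ` V \<subseteq> X \<and> (\<forall>x y. B x y \<longrightarrow> A (g x) (g y))"
proof -
  interpret rooted_tree V B r p d by fact
  let ?e = "\<lambda>x. d x - d r"
  have e: "bij_betw ?e V {..k}" by (rule depth_enumerates_path[OF deg r k])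
  let ?q = "inv_into V ?e"
  obtain x where x: "walks (\<lambda>i. B (?q i) (?q (Suc i))) k x" using walks_exist[OF sd X big] by blast
  have q: "?q (?e u) = u" if "u \<in> V" for u by (rule bij_betw_inv_into_left[OF e that])
  have ek: "?e u \<le> k" if "u \<in> V" for u using e that by (auto simp: bij_betw_def)
  have step: "x (?e u) \<in> signed_nbrs A (B (p u) u) (x (?e (p u)))" if u: "u \<in> V" "u \<noteq> r" for u
  proof -
    have s: "?e u = Suc (?e (p u))" using depth[OF u] root_depth_le[OF parent_in[OF u]] by simp
    then have "?e (p u) < k" using ek[OF u(1)] by simp
    then have "x (Suc (?e (p u))) \<in> signed_nbrs A (B (?q (?e (p u))) (?q (Suc (?e (p u))))) (x (?e (p u)))"
      using x by (simp add: walks_def)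
    then show ?thesis unfolding s[symmetric] q[OF u(1)] q[OF parent_in[OF u]] .
  qed
  have "inj_on (x \<circ> ?e) V"
    using e x by (intro comp_inj_on) (auto simp: bij_betw_def walks_def)
  moreover have "(x \<circ> ?e) ` V \<subseteq> X" using e x by (auto simp: bij_betw_def walks_def)
  moreover have "A ((x \<circ> ?e) u) ((x \<circ> ?e) w)" if uw: "B u w" for u w
    using edge_cases[OF uw] step[of u] step[of w] B_asym[OF uw] uw unfolding signed_nbrs_def by auto
  ultimately show ?thesis by (intro exI[of _ "x \<circ> ?e"]) blast
qed

section \<open>Oriented trees and 4-cycles in the library formalism\<close>

lemma (in wf_digraph) ends_iff: "u \<rightarrow> v \<longleftrightarrow> (\<exists>e\<in>arcs G. tail G e = u \<and> head G e = v)"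
  by (auto simp: arcs_ends_conv)

lemma parcs_mk_symmetric_adj:
  "(x, y) \<in> parcs (mk_symmetric G) \<longleftrightarrow> adj (dominates G) x y"
  by (auto simp: parcs_mk_symmetric adj_def arcs_ends_conv)

lemma (in digraph) card_nb_degree:
  "card (signed_nbrs (dominates G) True v) = out_degree G v" "card (signed_nbrs (dominates G) False v) = in_degree G v"
proof -
  have "signed_nbrs (dominates G) True v = head G ` out_arcs G v"
    by (auto simp: signed_nbrs_def arcs_ends_conv)
  moreover have "inj_on (head G) (out_arcs G v)"
    by (rule inj_onI) (auto simp: arc_to_ends_def intro!: no_multi_arcs)
  ultimately show "card (signed_nbrs (dominates G) True v) = out_degree G v"
    by (simp add: out_degree_def card_image)
  have "signed_nbrs (dominates G) False v = tail G ` in_arcs G v"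
    by (auto simp: signed_nbrs_def arcs_ends_conv)
  moreover have "inj_on (tail G) (in_arcs G v)"
    by (rule inj_onI) (auto simp: arc_to_ends_def intro!: no_multi_arcs)
  ultimately show "card (signed_nbrs (dominates G) False v) = in_degree G v"
    by (simp add: in_degree_def card_image)
qed

text \<open>Exactly one arc is chosen for each of the four edges, since the digraph may contain both
  directions while an oriented 4-cycle may not.\<close>

lemma (in digraph) c4_free_digraph_dominates:
  assumes no4: "\<not> (\<exists>C. oriented_4_cycle C \<and> subgraph C G)"
  shows "c4_free_digraph (verts G) (dominates G)"
proof
  show "finite (verts G)" by simp
  show "u \<in> verts G \<and> v \<in> verts G" if "u \<rightarrow> v" for u v using adj_in_verts[OF that] by blast
  show nl: "\<not> u \<rightarrow> u" for u using adj_not_same by blast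
  show "a = b" if xy: "x \<noteq> y" and adjs: "adj (dominates G) x a" "adj (dominates G) y a"
      "adj (dominates G) x b" "adj (dominates G) y b" for x y a b
  proof (rule ccontr)
    assume ab: "a \<noteq> b"
    have irr: "\<not> adj (dominates G) u u" for u using nl by (auto simp: adj_def)
    have dist: "distinct [x, a, y, b]" using xy ab adjs irr by auto
    have arc: "\<exists>e\<in>arcs G. {(tail G e, head G e), (head G e, tail G e)} = {(u, v), (v, u)}"
      if "adj (dominates G) u v" for u v
      using that unfolding adj_def ends_iff by (elim disjE bexE conjE) auto
    obtain e1 e2 e3 e4 where e: "e1 \<in> arcs G" "e2 \<in> arcs G" "e3 \<in> arcs G" "e4 \<in> arcs G"
      and ends: "{(tail G e1, head G e1), (head G e1, tail G e1)} = {(x, a), (a, x)}"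
        "{(tail G e2, head G e2), (head G e2, tail G e2)} = {(y, a), (a, y)}"
        "{(tail G e3, head G e3), (head G e3, tail G e3)} = {(y, b), (b, y)}"
        "{(tail G e4, head G e4), (head G e4, tail G e4)} = {(x, b), (b, x)}"
      using arc[OF adjs(1)] arc[OF adjs(2)] arc[OF adjs(4)] arc[OF adjs(3)] by blast
    have cases: "(tail G e = u \<and> head G e = v) \<or> (tail G e = v \<and> head G e = u)"
      if "{(tail G e, head G e), (head G e, tail G e)} = {(u, v), (v, u)}" for e u v
      using that by (auto simp: doubleton_eq_iff)
    note ec = cases[OF ends(1)] cases[OF ends(2)] cases[OF ends(3)] cases[OF ends(4)]
    have sides: "{tail G e1, head G e1} = {x, a}" "{tail G e2, head G e2} = {y, a}"
      "{tail G e3, head G e3} = {y, b}" "{tail G e4, head G e4} = {x, b}"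
      using ec by auto
    let ?C = "\<lparr>verts = {x, a, y, b}, arcs = {e1, e2, e3, e4}, tail = tail G, head = head G\<rparr>"
    have og: "oriented_graph ?C"
    proof
      show "tail ?C e \<in> verts ?C" "head ?C e \<in> verts ?C" if "e \<in> arcs ?C" for e
        using that ec by auto
      show "finite (verts ?C)" "finite (arcs ?C)" by auto
      show "tail ?C e \<noteq> head ?C e" if "e \<in> arcs ?C" for e
        using that e no_loops by auto
      show "e = e'" if "e \<in> arcs ?C" "e' \<in> arcs ?C" "arc_to_ends ?C e = arc_to_ends ?C e'" for e e'
        using that e no_multi_arcs by (auto simp: arc_to_ends_def)
      \<comment> \<open>The unordered pair of ends identifies an arc among the four, so the two arcs
        of a 2-cycle would coincide and form a loop.\<close>
      define U where "U e = {tail G e, head G e}" for e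
      have U: "U e1 = {x, a}" "U e2 = {y, a}" "U e3 = {y, b}" "U e4 = {x, b}"
        unfolding U_def by (rule sides)+
      have "{x, a} \<noteq> {y, a}" "{x, a} \<noteq> {y, b}" "{x, a} \<noteq> {x, b}"
        "{y, a} \<noteq> {y, b}" "{y, a} \<noteq> {x, b}" "{y, b} \<noteq> {x, b}"
        using dist by (auto simp: doubleton_eq_iff)
      then have ne: "U e1 \<noteq> U e2" "U e1 \<noteq> U e3" "U e1 \<noteq> U e4" "U e2 \<noteq> U e3" "U e2 \<noteq> U e4" "U e3 \<noteq> U e4"
        unfolding U by simp_all
      have same: "e = e'" if "e \<in> {e1, e2, e3, e4}" "e' \<in> {e1, e2, e3, e4}" "U e = U e'" for e e'
        using that ne ne[symmetric] by (elim insertE emptyE) simp_all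
      show "asym (arcs_ends ?C)"
      proof (rule asymI)
        fix u w assume "(u, w) \<in> arcs_ends ?C"
        then obtain e where e': "e \<in> {e1, e2, e3, e4}" "tail G e = u" "head G e = w"
          by (auto simp: arcs_ends_conv)
        show "(w, u) \<notin> arcs_ends ?C"
        proof
          assume "(w, u) \<in> arcs_ends ?C"
          then obtain e2' where e2': "e2' \<in> {e1, e2, e3, e4}" "tail G e2' = w" "head G e2' = u"
            by (auto simp: arcs_ends_conv)
          have "e = e2'" using same[OF e'(1) e2'(1)] e' e2' by (simp add: U_def insert_commute)
          then have "tail G e = head G e" using e' e2' by simp
          moreover have "e \<in> arcs G" using e'(1) e by auto
          ultimately show False using no_loops by blast
        qed
      qed
    qed
    have pc: "parcs (mk_symmetric ?C)
        = {(x, a), (a, x), (a, y), (y, a), (y, b), (b, y), (b, x), (x, b)}"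
    proof -
      have "parcs (mk_symmetric ?C) = {(tail G e1, head G e1), (head G e1, tail G e1)}
          \<union> {(tail G e2, head G e2), (head G e2, tail G e2)}
          \<union> {(tail G e3, head G e3), (head G e3, tail G e3)}
          \<union> {(tail G e4, head G e4), (head G e4, tail G e4)}"
        by (auto simp: parcs_mk_symmetric)
      then show ?thesis unfolding ends by auto
    qed
    have "verts ?C = {x, a, y, b}" by simp
    then have "oriented_4_cycle ?C"
      unfolding oriented_4_cycle_def using og dist pc by blast
    moreover have "wf_digraph ?C" using og
      by (simp add: oriented_graph_def digraph_def fin_digraph_def)
    then have "subgraph ?C G"
      using e adj_in_verts adjs wf_digraph by (auto simp: subgraph_def compatible_def adj_def)
    ultimately show False using no4 by blast
  qed
qed

lemma (in digraph) nbrs_le_max_total_degree: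
  assumes "v \<in> verts G"
  shows "card (nbrs (dominates G) v) \<le> max_total_degree G"
proof -
  have "nbrs (dominates G) v = snd ` out_arcs (with_proj (mk_symmetric G)) v"
    by (force simp: nbrs_def parcs_mk_symmetric_adj[symmetric])
  moreover have "inj_on snd (out_arcs (with_proj (mk_symmetric G)) v)"
    by (auto simp: inj_on_def)
  ultimately have "card (nbrs (dominates G) v) = out_degree (with_proj (mk_symmetric G)) v"
    by (simp add: out_degree_def card_image)
  then show ?thesis using assms unfolding max_total_degree_def by (intro Max_ge) auto
qed

text \<open>A path from \<open>x\<close> to \<open>y\<close> avoiding the edge would close with it
  to a cycle, of length at least 3 because a path of length 1 would be the edge itself.\<close>

lemma (in oriented_tree) cycle_free_edge:
  assumes xy: "adj (dominates G) x y"
    and R: "R = parcs (mk_symmetric G) - {(x, y), (y, x)}"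
  shows "(x, y) \<notin> R\<^sup>*"
proof
  assume reach: "(x, y) \<in> R\<^sup>*"
  let ?H = "\<lparr>pverts = verts G, parcs = R\<rparr>"
  interpret M: pair_wf_digraph "mk_symmetric G" ..
  interpret H: pair_wf_digraph ?H
    using M.arc_fst_in_verts M.arc_snd_in_verts by unfold_locales (auto simp: R)
  have xV: "x \<in> verts G" and yx: "(y, x) \<in> parcs (mk_symmetric G)"
    using xy adj_in_verts by (auto simp: adj_def parcs_mk_symmetric_adj)
  have "x \<noteq> y" using xy adj_not_same by (auto simp: adj_def)
  have "x \<rightarrow>\<^sup>*\<^bsub>with_proj ?H\<^esub> y" using H.reachable_conv'[of x y] xV reach by simp
  then obtain q where "H.apath x q y" using H.reachable_apath by blast
  then have q: "set q \<subseteq> R" "pcas x q y" "distinct (pawalk_verts x q)"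
    by (auto simp: H.apath_def H.awalk_def)
  have "M.awalk y ((y, x) # q) y"
    using q yx xV M.arc_fst_in_verts by (auto simp: M.awalk_def R)
  then have "M.cycle ((y, x) # q)" using q by (auto simp: M.cycle_def)
  moreover have "2 \<le> length q"
  proof (rule ccontr)
    assume "\<not> 2 \<le> length q"
    then consider "q = []" | e where "q = [e]" by (cases q; cases "tl q") auto
    then show False using q \<open>x \<noteq> y\<close> R by cases auto
  qed
  then have "3 \<le> length ((y, x) # q)" by simp
  ultimately have "\<exists>c. M.cycle c \<and> 3 \<le> length c" by blast
  with underlying_acyclic show False by (rule notE)
qed

text \<open>Distance from the root and a predecessor on a shortest walk serve as depth and parent.
  An arc outside the parent relation would have both ends joined to the root by parent edges,
  against \<open>cycle_free_edge\<close>.\<close>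

lemma (in oriented_tree) rooted_tree_exists:
  assumes r: "r \<in> verts G"
  shows "\<exists>p d. rooted_tree (verts G) (dominates G) r p d"
proof -
  let ?E = "parcs (mk_symmetric G)"
  interpret M: pair_wf_digraph "mk_symmetric G" ..
  have symE: "(x, y) \<in> ?E \<Longrightarrow> (y, x) \<in> ?E" for x y
    unfolding parcs_mk_symmetric_adj by (rule adj_sym)
  define d where "d x = (LEAST n. (r, x) \<in> ?E ^^ n)" for x
  have ex: "\<exists>n. (r, x) \<in> ?E ^^ n" if "x \<in> verts G" for x
  proof -
    have "r \<rightarrow>\<^sup>*\<^bsub>with_proj (mk_symmetric G)\<^esub> x"
      using underlying_connected r that by (auto simp: connected_def strongly_connected_def)
    then show ?thesis using M.reachable_conv by (auto simp: rtrancl_power)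
  qed
  have dE: "(r, x) \<in> ?E ^^ d x" if "x \<in> verts G" for x
    unfolding d_def using ex[OF that] by (rule LeastI_ex)
  have dle: "d x \<le> n" if "(r, x) \<in> ?E ^^ n" for x n
    unfolding d_def using that by (rule Least_le)
  have "\<exists>y. (y, x) \<in> ?E \<and> d x = Suc (d y)" if x: "x \<in> verts G" "x \<noteq> r" for x
  proof -
    have "d x \<noteq> 0" using dE[OF x(1)] x(2) by (cases "d x") auto
    then obtain m where m: "d x = Suc m" by (meson not0_implies_Suc)
    then obtain y where y: "(r, y) \<in> ?E ^^ m" "(y, x) \<in> ?E" using dE[OF x(1)] by auto
    have "y \<in> verts G" using M.in_arcsD1[OF y(2)] by simp
    then have "(r, x) \<in> ?E ^^ Suc (d y)" using dE[of y] y(2) by auto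
    then have "d x \<le> Suc (d y)" by (rule dle)
    then show ?thesis using dle[OF y(1)] m y(2) by (intro exI[of _ y]) auto
  qed
  then obtain p where p: "\<And>x. x \<in> verts G \<Longrightarrow> x \<noteq> r \<Longrightarrow> (p x, x) \<in> ?E \<and> d x = Suc (d (p x))"
    by metis
  have "rooted_tree (verts G) (dominates G) r p d"
  proof
    show "finite (verts G)" by simp
    show "r \<in> verts G" by (fact r)
    show "p x \<in> verts G" if "x \<in> verts G" "x \<noteq> r" for x
      using M.in_arcsD1 p[OF that] by fastforce
    show "d x = Suc (d (p x))" if "x \<in> verts G" "x \<noteq> r" for x using p[OF that] by blast
    show "x \<rightarrow> p x \<or> p x \<rightarrow> x" if "x \<in> verts G" "x \<noteq> r" for x
      using p[OF that] by (auto simp: parcs_mk_symmetric_adj adj_def)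
    show "\<not> y \<rightarrow> x" if "x \<rightarrow> y" for x y
      using no_two_cycles that by (auto simp: asym_iff)
    show "x \<in> verts G \<and> y \<in> verts G \<and> ((y \<noteq> r \<and> p y = x) \<or> (x \<noteq> r \<and> p x = y))" if xy: "x \<rightarrow> y" for x y
    proof -
      have V: "x \<in> verts G" "y \<in> verts G" using adj_in_verts[OF xy] by auto
      have "(y \<noteq> r \<and> p y = x) \<or> (x \<noteq> r \<and> p x = y)"
      proof (rule ccontr)
        assume no: "\<not> ?thesis"
        let ?R = "?E - {(x, y), (y, x)}"
        have "(z, r) \<in> ?R\<^sup>*" if "z \<in> verts G" for z
          using that
        proof (induction "d z" arbitrary: z rule: less_induct)
          case less
          show ?case
          proof (cases "z = r")
            case False
            then have pz: "(p z, z) \<in> ?E" "d (p z) < d z" using p less.prems by auto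
            then have "p z \<in> verts G" using M.in_arcsD1 by fastforce
            then have "(p z, r) \<in> ?R\<^sup>*" using less.hyps pz by blast
            moreover have "(z, p z) \<in> ?R" using symE[OF pz(1)] no False by auto
            ultimately show ?thesis by (rule converse_rtrancl_into_rtrancl[rotated])
          qed simp
        qed
        then have "(x, r) \<in> ?R\<^sup>*" "(y, r) \<in> ?R\<^sup>*" using V by blast+
        moreover have "sym ?R" using symE by (auto intro!: symI)
        then have "sym (?R\<^sup>*)" by (rule sym_rtrancl)
        ultimately have "(x, y) \<in> ?R\<^sup>*" by (meson rtrancl_trans symD)
        moreover have "adj (dominates G) x y" using xy by (simp add: adj_def)
        ultimately show False using cycle_free_edge by blast
      qed
      then show ?thesis using V by blast
    qed
  qed
  then show ?thesis by blast
qed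

text \<open>Edges correspond to their lower ends, the vertices other than the root;
  \<open>?h\<close> restores the direction.\<close>

lemma (in rooted_tree) card_edges: "card {(x, y). B x y} + 1 = card V"
proof -
  let ?h = "\<lambda>z. if B z (p z) then (z, p z) else (p z, z)"
  have inj: "inj_on ?h (V - {r})"
    using grandparent_neq by (intro inj_onI) (auto split: if_splits)
  have im: "?h ` (V - {r}) = {(x, y). B x y}"
  proof (intro subset_antisym subsetI)
    show "e \<in> {(x, y). B x y}" if "e \<in> ?h ` (V - {r})" for e
      using that parent_edge by (auto split: if_splits)
    show "e \<in> ?h ` (V - {r})" if h: "e \<in> {(x, y). B x y}" for e
    proof -
      obtain x y where e: "e = (x, y)" "B x y" using h by blast
      then consider "y \<in> V - {r}" "p y = x" | "x \<in> V - {r}" "p x = y" using edge_cases by blast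
      then show ?thesis
      proof cases
        case 1
        then have "?h y = e" using e B_asym by auto
        then show ?thesis using 1 by blast
      next
        case 2
        then have "?h x = e" using e by auto
        then show ?thesis using 2 by blast
      qed
    qed
  qed
  have "card {(x, y). B x y} = card (V - {r})" unfolding im[symmetric] by (rule card_image[OF inj])
  then show ?thesis using card_Suc_Diff1[OF finite_V root_in] by simp
qed

lemma (in oriented_tree) card_verts_arcs: "card (verts G) = Suc (card (arcs G))"
proof -
  have "verts G \<noteq> {}" using underlying_connected by (simp add: connected_def strongly_connected_def)
  then obtain r p d where "rooted_tree (verts G) (dominates G) r p d" using rooted_tree_exists by blast
  then have "card {(x, y). x \<rightarrow> y} + 1 = card (verts G)" by (rule rooted_tree.card_edges)
  moreover have "{(x, y). x \<rightarrow> y} = arc_to_ends G ` arcs G" by (simp add: arcs_ends_def)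
  ultimately show ?thesis using card_image[OF inj_on_arc_to_ends] by simp
qed

section \<open>Choice of the root and assembly of the three cases\<close>

lemma (in c4_free_digraph) embeds_tree:
  assumes rooted: "\<And>r. r \<in> V \<Longrightarrow> \<exists>p d. rooted_tree V B r p d"
    and k: "1 \<le> k" "card V = Suc k" and X: "X \<noteq> {}"
    and sd: "\<And>v s. v \<in> X \<Longrightarrow> k \<le> 2 * card (signed_nbrs A s v)"
    and deg: "\<And>x. x \<in> V \<Longrightarrow> card (nbrs B x) \<le> m"
    and big: "\<And>s. \<exists>v\<in>X. m < card (signed_nbrs A s v)"
  shows "\<exists>g. inj_on g V \<and> g ` V \<subseteq> X \<and> (\<forall>x y. B x y \<longrightarrow> A (g x) (g y))"
proof -
  have finV: "finite V" and Vne: "V \<noteq> {}" using k by (auto intro: card_ge_0_finite)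
  then obtain r0 p0 d0 where "rooted_tree V B r0 p0 d0" using rooted by blast
  then have sum: "(\<Sum>x\<in>V. card (nbrs B x)) = 2 * k"
    using rooted_tree.sum_degree k by fastforce
  have emb: "tree_embedding X A V B r p d k"
    if "rooted_tree V B r p d" "2 \<le> card (nbrs B r)" for r p d
    using that k sd c4_free_digraph_axioms
    by (intro tree_embedding.intro rooted_tree_core.intro rooted_tree_core_axioms.intro
        tree_embedding_axioms.intro) auto
  show ?thesis
  proof (cases "\<forall>x\<in>V. card (nbrs B x) \<le> 2")
    case True
    obtain r where r: "r \<in> V" "card (nbrs B r) \<le> 1"
    proof (rule ccontr)
      assume "\<not> thesis"
      then have "\<And>x. x \<in> V \<Longrightarrow> 2 \<le> card (nbrs B x)" using that by force
      then have "(\<Sum>x\<in>V. 2) \<le> (\<Sum>x\<in>V. card (nbrs B x))" by (intro sum_mono)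
      then show False using sum k by simp
    qed
    obtain p d where rt: "rooted_tree V B r p d" using rooted r by blast
    \<comment> \<open>A tree with at least two arcs has a vertex of degree at least 2, so
      \<open>big\<close> yields the three neighbours that short paths require.\<close>
    have m2: "2 \<le> m" if "2 \<le> k"
    proof (rule ccontr)
      assume "\<not> 2 \<le> m"
      then have "\<And>x. x \<in> V \<Longrightarrow> card (nbrs B x) \<le> 1" using deg by fastforce
      then have "(\<Sum>x\<in>V. card (nbrs B x)) \<le> (\<Sum>x\<in>V. 1)" by (intro sum_mono)
      then show False using sum k that by simp
    qed
    have big3: "\<exists>v\<in>X. 3 \<le> card (signed_nbrs A s v)" if k2: "2 \<le> k" for s
    proof -
      obtain v where v: "v \<in> X" "m < card (signed_nbrs A s v)" using big by blast
      then have "3 \<le> card (signed_nbrs A s v)" using m2[OF k2] by linarith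
      then show ?thesis using v by blast
    qed
    show ?thesis by (rule embeds_if_path[OF rt k(2) _ r(2) sd X big3]) (use True in auto)
  next
    case False
    \<comment> \<open>A description of the leaves at a vertex that does not refer to a root: the
      root is to be a vertex maximising their number, so it is chosen before the tree is
      rooted.\<close>
    define leaf_nbrs_of where "leaf_nbrs_of t = {y \<in> nbrs B t. card (nbrs B y) = 1}" for t
    have lf_eq: "rooted_tree.leaves_at V B r p t = leaf_nbrs_of t"
      if "rooted_tree V B r p d" "2 \<le> card (nbrs B r)" "t \<in> rooted_tree.core V B" for r p d t
    proof -
      interpret rooted_tree_core V B r p d
        using that(1,2) by (intro rooted_tree_core.intro rooted_tree_core_axioms.intro)
      have t: "t \<in> V" "t \<in> core" using that(3) core_sub by auto
      have "x \<in> leaves_at t \<longleftrightarrow> x \<in> leaf_nbrs_of t" for x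
      proof (cases "x \<in> leaves")
        case True
        then show ?thesis
          using leaves_at_iff[of x t] adj_leaf[of x t] adj_commute[of B t x] by (auto simp: leaf_nbrs_of_def leaves_def)
      next
        case False
        then show ?thesis by (auto simp: leaf_nbrs_of_def leaves_at_def leaves_def dest: adj_in_V)
      qed
      then show ?thesis by blast
    qed
    have empty: "rooted_tree.leaves_at V B r p t = {}"
      if "rooted_tree V B r p d" "2 \<le> card (nbrs B r)" "t \<notin> rooted_tree.core V B" for r p d t
    proof -
      interpret rooted_tree_core V B r p d
        using that(1,2) by (intro rooted_tree_core.intro rooted_tree_core_axioms.intro)
      have "x \<notin> leaves_at t" for x
        using that(3) parent_core[of x] leaves_at_iff[of x t] leaf_neq_root[of x] leaves_sub by blast
      then show ?thesis by blast
    qed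
    show ?thesis
    proof (cases "\<exists>t\<in>V. 2 \<le> card (leaf_nbrs_of t)")
      case True
      let ?M = "Max ((\<lambda>t. card (leaf_nbrs_of t)) ` V)"
      have "?M \<in> (\<lambda>t. card (leaf_nbrs_of t)) ` V" using finV Vne by (intro Max_in) auto
      then obtain r where r: "r \<in> V" "card (leaf_nbrs_of r) = ?M" by auto
      have maxr: "card (leaf_nbrs_of t) \<le> card (leaf_nbrs_of r)" if "t \<in> V" for t
        using that finV unfolding r(2) by (intro Max_ge) auto
      then have lr: "2 \<le> card (leaf_nbrs_of r)" using True by (meson le_trans)
      obtain p d where rt: "rooted_tree V B r p d" using rooted r by blast
      interpret rooted_tree V B r p d by (rule rt)
      have "card (leaf_nbrs_of r) \<le> card (nbrs B r)" by (intro card_mono) (auto simp: leaf_nbrs_of_def)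
      then have dr: "2 \<le> card (nbrs B r)" using lr by simp
      interpret tree_embedding X A V B r p d k by (rule emb[OF rt dr])
      have ch: "card (children r) = card (nbrs B r)" using nbrs_eq[OF root_in] by simp
      have "{y \<in> children r. B r y = True} \<union> {y \<in> children r. B r y = False} = children r" by auto
      then have "card {y \<in> children r. B r y = True} + card {y \<in> children r. B r y = False} = card (children r)"
        by (subst card_Un_disjoint[symmetric]) auto
      \<comment> \<open>The sign is dictated by the tree. This is why a vertex of large degree has
        to be available for both signs.\<close>
      then obtain s where s: "2 * card {y \<in> children r. B r y = (\<not> s)} \<le> card (children r)"
      proof (cases "2 * card {y \<in> children r. B r y = False} \<le> card (children r)")
        case True
        then show ?thesis using that[of True] by simp
      next
        case False
        then show ?thesis
          using that[of False] \<open>card {y \<in> children r. B r y = True} + _ = _\<close> by simp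
      qed
      obtain v0 where v0: "v0 \<in> X" "m < card (signed_nbrs A s v0)" using big by blast
      have "heavy_root X A V B r p d k s v0"
      proof
        show "2 \<le> card (leaves_at r)" using lf_eq[OF rt dr root_core] lr by simp
        show "card (leaves_at t) \<le> card (leaves_at r)" if "t \<in> core" for t
          using lf_eq[OF rt dr root_core] lf_eq[OF rt dr that] maxr core_in_V[OF that] by simp
        show "2 * card {y \<in> children r. B r y = (\<not> s)} \<le> card (children r)" by (rule s)
        show "v0 \<in> X" by (rule v0)
        show "card (children r) < card (signed_nbrs A s v0)" using v0 deg[OF r(1)] ch by simp
      qed
      then show ?thesis by (rule heavy_root.embeds_if_heavy_root)
    next
      case one: False
      obtain r where r: "r \<in> V" "3 \<le> card (nbrs B r)" using False by fastforce
      then have dr: "2 \<le> card (nbrs B r)" by simp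
      obtain p d where rt: "rooted_tree V B r p d" using rooted r by blast
      interpret tree_embedding X A V B r p d k by (rule emb[OF rt dr])
      have "card (leaves_at t) \<le> 1" for t
      proof (cases "t \<in> core")
        case True
        then show ?thesis using lf_eq[OF rt dr True] one core_in_V[OF True] by fastforce
      next
        case False
        then show ?thesis using empty[OF rt dr] by simp
      qed
      then show ?thesis using rooted r X by (intro embeds_if_branching) auto
    qed
  qed
qed

theorem theorem1:
  fixes k :: nat
    and T :: "('c, 'd) pre_digraph"
    and D :: "('a, 'b) pre_digraph"
  assumes "k \<ge> 1"
    and "oriented_tree T" and "card (arcs T) = k"
    and "digraph D" and "verts D \<noteq> {}"
    and "real (min_semidegree D) \<ge> real k / 2"
    and "\<not> (\<exists>C. oriented_4_cycle C \<and> subgraph C D)"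
    and "max_pm_degree D > max_total_degree T"
  shows "contains_digraph D T"
proof -
  interpret T: oriented_tree T by fact
  interpret D: digraph D by fact
  interpret c4_free_digraph "verts D" "dominates D"
    using assms(7) by (rule D.c4_free_digraph_dominates)
  have "\<exists>g. inj_on g (verts T) \<and> g ` verts T \<subseteq> verts D \<and>
      (\<forall>x y. x \<rightarrow>\<^bsub>T\<^esub> y \<longrightarrow> g x \<rightarrow>\<^bsub>D\<^esub> g y)"
  proof (rule embeds_tree)
    show "\<exists>p d. rooted_tree (verts T) (dominates T) r p d" if "r \<in> verts T" for r
      using that by (rule T.rooted_tree_exists)
    show "1 \<le> k" "card (verts T) = Suc k" "verts D \<noteq> {}"
      using assms T.card_verts_arcs by auto
    show "card (nbrs (dominates T) x) \<le> max_total_degree T" if "x \<in> verts T" for x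
      using that by (rule T.nbrs_le_max_total_degree)
    show "k \<le> 2 * card (signed_nbrs (dominates D) s v)" if "v \<in> verts D" for v s
    proof -
      have "min_semidegree D \<le> card (signed_nbrs (dominates D) s v)"
        unfolding min_semidegree_def using that D.card_nb_degree[of v]
        by (cases s) (auto intro!: Min_le)
      then show ?thesis using assms(6) by linarith
    qed
    \<comment> \<open>The largest outdegree and the largest indegree are both at least
      \<open>max_pm_degree D\<close>, so either sign finds its vertex.\<close>
    show "\<exists>v\<in>verts D. max_total_degree T < card (signed_nbrs (dominates D) s v)" for s
    proof -
      have "max_pm_degree D = min (Max (out_degree D ` verts D)) (Max (in_degree D ` verts D))"
        using assms(5) by (intro max_pm_degree_eq_min) auto
      moreover have "Max (out_degree D ` verts D) \<in> out_degree D ` verts D"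
        "Max (in_degree D ` verts D) \<in> in_degree D ` verts D"
        using assms(5) by (intro Max_in; simp)+
      ultimately obtain u w where "u \<in> verts D" "w \<in> verts D"
        "max_pm_degree D \<le> out_degree D u" "max_pm_degree D \<le> in_degree D w" by fastforce
      then show ?thesis using assms(8) D.card_nb_degree by (cases s) (auto intro: less_le_trans)
    qed
  qed
  then show ?thesis by (simp add: contains_digraph_def)
qed

end
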